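(* Let $N\ge 2$ be an integer, let $\alpha\in\mathbb R$, and for $x=(x_1,\dots,x_N)\in\mathbb R^{2N}$ with $x_j=(x_{j1},x_{j2})\in\mathbb R^2$ put $$\mathbf F_j=\alpha\left(-\sum_{k\ne j}\frac{x_{j2}-x_{k2}}{r_{jk}^2},\ \sum_{k\neq j}\frac{x_{j1}-x_{k1}}{r_{jk}^2}\right),\qquad j=1,\dots,N,$$ and $$D_{N,\alpha}=\min_{l=1,\dots,N-1}\left(\frac{\min_{k\in\mathbb Z}|k-l\alpha|}{l}\right)^2 .$$ Then for every $u\in H^1(\mathbb R^{2N})$, $$\int_{\mathbb R^{2N}}\sum_{j=1}^N\bigl|(i\nabla_{x_j}+\mathbf F_j)u\bigr|^2\,dx\ \ge\ D_{N,\alpha}\int_{\mathbb R^{2N}}|u|^2\Bigl(\sum_{k\ne j}\frac{1}{r_{kj}^2}\Bigr)\,dx .$$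
   Context: $r_{jk}=|x_j-x_k|$ is the Euclidean distance in $\mathbb R^2$; $\nabla_{x_j}$ is the gradient in the variable $x_j\in\mathbb R^2$; $i$ is the imaginary unit; functions are complex-valued. In the definition of $\mathbf F_j$ the sums run over $k\in\{1,\dots,N\}\setminus\{j\}$. On the right-hand side of the inequality, $\sum_{k\neq j}$ is the sum over all ordered pairs $(k,j)$ with $k,j\in\{1,\dots,N\}$, $k\neq j$. Both sides are understood as elements of $[0,+\infty]$, the right-hand side being $0$ if $D_{N,\alpha}=0$. *)

theory Defs
  imports "HOL-Analysis.Analysis"
begin

subsection \<open>The Sobolev space \<open>H\<^sup>1\<close>\<close>

primrec C_k :: "nat \<Rightarrow> ('a::euclidean_space \<Rightarrow> real) \<Rightarrow> bool" where
  "C_k 0 f \<longleftrightarrow> continuous_on UNIV f"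
| "C_k (Suc n) f \<longleftrightarrow> (\<forall>x. f differentiable (at x)) \<and>
     (\<forall>v. C_k n (\<lambda>x. frechet_derivative f (at x) v))"

definition test_functions :: "('a::euclidean_space \<Rightarrow> real) set" where
  "test_functions = {\<phi>. (\<forall>n. C_k n \<phi>) \<and> compact (closure {x. \<phi> x \<noteq> 0})}"

definition locally_integrable :: "('a::euclidean_space \<Rightarrow> complex) \<Rightarrow> bool" where
  "locally_integrable f \<longleftrightarrow> (\<forall>K. compact K \<longrightarrow> f absolutely_integrable_on K)"

definition has_weak_derivative ::
  "('a::euclidean_space \<Rightarrow> complex) \<Rightarrow> 'a \<Rightarrow> ('a \<Rightarrow> complex) \<Rightarrow> bool" where
  "has_weak_derivative u v g \<longleftrightarrow> locally_integrable u \<and> locally_integrable g \<and>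
     (\<forall>\<phi>\<in>test_functions.
        (LINT x|lebesgue. frechet_derivative \<phi> (at x) v *\<^sub>R u x) =
        - (LINT x|lebesgue. \<phi> x *\<^sub>R g x))"

text \<open>Weak derivatives are unique up to null sets; the following picks a representative.\<close>

definition weak_derivative ::
  "('a::euclidean_space \<Rightarrow> complex) \<Rightarrow> 'a \<Rightarrow> 'a \<Rightarrow> complex" where
  "weak_derivative u v = (SOME g. has_weak_derivative u v g)"

definition L2 :: "('a::euclidean_space \<Rightarrow> complex) set" where
  "L2 = {f \<in> borel_measurable lebesgue. integrable lebesgue (\<lambda>x. (norm (f x))\<^sup>2)}"

text \<open>Elements of \<open>L\<^sup>2\<close> and \<open>H\<^sup>1\<close> are functions here, not classes modulo null sets.\<close>

definition H1 :: "('a::euclidean_space \<Rightarrow> complex) set" where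
  "H1 = {u \<in> L2. \<forall>b\<in>Basis. (\<exists>g. has_weak_derivative u b g) \<and> weak_derivative u b \<in> L2}"


subsection \<open>The magnetic potential and the constant\<close>

text \<open>
  A configuration of \<open>N = CARD('n)\<close> particles is a point \<open>x\<close> of \<open>(\<real>\<^sup>2)\<^sup>N\<close> with \<open>x $ j\<close> the position
  of particle \<open>j\<close>.  Since \<open>a / 0 = 0\<close>, the singular terms below vanish where two
  particles coincide, which is a null set.
\<close>

definition magnetic_potential :: "real \<Rightarrow> 'n::finite \<Rightarrow> (real^2)^'n \<Rightarrow> real^2" where
  "magnetic_potential \<alpha> j x = \<alpha> *\<^sub>R vector
     [- (\<Sum>k\<in>UNIV - {j}. (x $ j $ 2 - x $ k $ 2) / (dist (x $ j) (x $ k))\<^sup>2),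
        \<Sum>k\<in>UNIV - {j}. (x $ j $ 1 - x $ k $ 1) / (dist (x $ j) (x $ k))\<^sup>2]"

text \<open>The weak gradient in the variable \<open>x $ j\<close>.\<close>

definition weak_gradient ::
  "'n::finite \<Rightarrow> ((real^2)^'n \<Rightarrow> complex) \<Rightarrow> (real^2)^'n \<Rightarrow> complex^2" where
  "weak_gradient j u x = (\<chi> c. weak_derivative u (axis j (axis c 1)) x)"

definition magnetic_gradient ::
  "real \<Rightarrow> 'n::finite \<Rightarrow> ((real^2)^'n \<Rightarrow> complex) \<Rightarrow> (real^2)^'n \<Rightarrow> complex^2" where
  "magnetic_gradient \<alpha> j u x =
     (\<chi> c. \<i> * weak_gradient j u x $ c + complex_of_real (magnetic_potential \<alpha> j x $ c) * u x)"

definition dist_to_int :: "real \<Rightarrow> real" where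
  "dist_to_int t = (INF k::int. \<bar>of_int k - t\<bar>)"

text \<open>The infimum is attained, so it is a minimum.\<close>

lemma dist_to_int_attained: "dist_to_int t = \<bar>of_int (round t) - t\<bar>"
  unfolding dist_to_int_def
proof (rule cInf_eq_minimum)
  show "\<bar>of_int (round t) - t\<bar> \<in> range (\<lambda>k::int. \<bar>of_int k - t\<bar>)" by blast
next
  fix y assume "y \<in> range (\<lambda>k::int. \<bar>of_int k - t\<bar>)"
  then show "\<bar>of_int (round t) - t\<bar> \<le> y"
    using round_diff_minimal[of t] by (auto simp: abs_minus_commute)
qed

definition hardy_constant :: "nat \<Rightarrow> real \<Rightarrow> real" where
  "hardy_constant N \<alpha> = (MIN l\<in>{1..N - 1}. (dist_to_int (real l * \<alpha>) / real l)\<^sup>2)"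

end

theory Submission
  imports Defs "HOL-Complex_Analysis.Conformal_Mappings"
    "HOL-Computational_Algebra.Fundamental_Theorem_Algebra"
begin

text \<open>
  Fix all particles but the \<open>j\<close>-th and write \<open>p(z) = \<Prod>\<^sub>k (z - x\<^sub>k)\<close>.  Then \<open>F\<^sub>j\<close> is \<open>\<alpha>\<close> times the gradient
  of \<open>arg p\<close>.  Away from the critical moduli of \<open>p\<close>, a level curve of \<open>|p|\<close> is a union of closed
  curves parametrised by \<open>arg p\<close>, each of parameter length \<open>2\<pi>l\<close> with \<open>1 \<le> l \<le> N - 1\<close>.  On such a curve
  the one-dimensional operator \<open>i d/d\<theta> + \<alpha>\<close> has the spectrum \<open>k/l + \<alpha>\<close> with integral \<open>k\<close>, which
  produces the constant and the weight \<open>|p'/p|\<^sup>2\<close>.  Summing over \<open>j\<close>, the weights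
  \<open>|\<Sum>\<^sub>k (x\<^sub>j - x\<^sub>k)/r\<^sub>j\<^sub>k\<^sup>2|\<^sup>2\<close> dominate \<open>\<Sum> 1/r\<^sub>j\<^sub>k\<^sup>2\<close>, since the mixed terms of every triangle add up to
  a nonnegative number.  The level curves are obtained by lifting \<open>exp\<close> through the covering \<open>p\<close> over
  an annulus; the lifts are permuted by translation by \<open>2\<pi>i\<close>, and \<open>l\<close> is the length of a cycle.
\<close>


section \<open>Inequalities on the circle and for point configurations\<close>

text \<open>In the coordinates \<open>s + \<i> t = log p\<close> the Jacobian of a lift cancels the
  weight exactly, and of the energy only the derivative in \<open>t\<close>, along the level curves,
  is kept; the component across them is thrown away. Along a closed curve of length
  \<open>2 pi l\<close> the potential produces the phase \<open>2 pi l \<alpha>\<close>, which can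
  be reduced modulo \<open>2 pi\<close> but no further: hence the distance of
  \<open>l \<alpha>\<close> to the integers.

  Two obstacles shape the analytic half. A function in \<open>H1\<close> need not be differentiable
  along curves, while field and weight are unbounded near the zeros of \<open>p\<close>, so density
  of C^1 functions does not carry the inequality over by itself. The limit is taken on regions
  \<open>c \<le> ln |p| \<le> d\<close>, where both are bounded, and the regions are then enlarged.
  Moreover, the approximation takes place in all variables jointly, whereas the inequality concerns
  one particle: Fubini and Fatou transfer the approximation to almost every slice.\<close>

lemma has_vector_derivative_cis:
  "((\<lambda>x. cis (b * x)) has_vector_derivative \<i> * b * cis (b * x)) (at x within S)"
proof -
  have "((\<lambda>z. exp (\<i> * b * z)) has_field_derivative \<i> * b * exp (\<i> * b * of_real x)) (at (of_real x))"
    by (auto intro!: derivative_eq_intros)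
  from has_vector_derivative_real_field[OF this] show ?thesis
    by (simp add: cis_conv_exp mult.assoc)
qed

text \<open>The square is completed with the logarithmic derivative \<open>m\<close> of a positive solution of
  \<open>y'' = - d\<^sup>2 y\<close>.\<close>

lemma dirichlet_wirtinger_strict:
  fixes k k' :: "real \<Rightarrow> complex"
  assumes T: "0 < T" and d: "0 \<le> d" "d * T < pi"
    and der: "\<And>x. x \<in> {0..T} \<Longrightarrow> (k has_vector_derivative k' x) (at x within {0..T})"
    and cont: "continuous_on {0..T} k'"
    and bdry: "k 0 = 0" "k T = 0"
  shows "d\<^sup>2 * integral {0..T} (\<lambda>x. (norm (k x))\<^sup>2) \<le> integral {0..T} (\<lambda>x. (norm (k' x))\<^sup>2)"
proof -
  \<comment> \<open>The logarithmic derivative of \<open>cos (d * (x - T/2))\<close>. Centring the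
    cosine makes it positive on the closed interval as soon as \<open>d * T < pi\<close>; the
    quotient satisfies the Riccati equation \<open>m' = - d^2 - m^2\<close>.\<close>
  define m where "m x = - d * tan (d * (x - T/2))" for x
  have contk: "continuous_on {0..T} k"
    using der has_vector_derivative_continuous continuous_on_eq_continuous_within by blast
  have cos_pos: "cos (d * (x - T/2)) > 0" if "x \<in> {0..T}" for x
  proof -
    have "\<bar>x - T/2\<bar> \<le> T/2" using that by (auto simp: abs_if)
    then have "d * \<bar>x - T/2\<bar> \<le> d * (T/2)" using d mult_left_mono by blast
    then have "\<bar>d * (x - T/2)\<bar> < pi / 2" using d by (simp add: abs_mult)
    then show ?thesis by (intro cos_gt_zero_pi) auto
  qed
  have m': "(m has_real_derivative - d\<^sup>2 - (m x)\<^sup>2) (at x within {0..T})" if "x \<in> {0..T}" for x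
    unfolding m_def using cos_pos[OF that]
    by (auto intro!: derivative_eq_intros simp: tan_def power2_eq_square field_simps
          sin_squared_eq)
  define g where "g x = (- d\<^sup>2 - (m x)\<^sup>2) * (k x \<bullet> k x) + m x * (2 * (k x \<bullet> k' x))" for x
  have "((\<lambda>x. m x * (k x \<bullet> k x)) has_vector_derivative g x) (at x within {0..T})"
    if "x \<in> {0..T}" for x
    unfolding g_def has_real_derivative_iff_has_vector_derivative[symmetric]
    using m'[OF that] der[OF that]
    by (auto simp: has_vector_derivative_def has_field_derivative_def inner_commute algebra_simps
        intro!: derivative_eq_intros)
  then have "(g has_integral (m T * (k T \<bullet> k T) - m 0 * (k 0 \<bullet> k 0))) {0..T}"
    using T by (intro fundamental_theorem_of_calculus) auto
  then have g0: "(g has_integral 0) {0..T}" by (simp add: bdry)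
  \<comment> \<open>\<open>g\<close> is the derivative of \<open>m |k|^2\<close>, whose boundary
    values vanish with \<open>k\<close>. Expanding \<open>|k' - m k|^2 \<ge> 0\<close> and inserting
    the Riccati equation leaves exactly this bound.\<close>
  have le: "d\<^sup>2 * (norm (k x))\<^sup>2 + g x \<le> (norm (k' x))\<^sup>2" for x
  proof -
    have "0 \<le> (norm (k' x - m x *\<^sub>R k x))\<^sup>2" by simp
    then show ?thesis
      unfolding g_def power2_norm_eq_inner
      by (simp add: inner_diff_left inner_diff_right inner_commute algebra_simps power2_eq_square)
  qed
  have i1: "((\<lambda>x. d\<^sup>2 * (norm (k x))\<^sup>2) has_integral d\<^sup>2 * integral {0..T} (\<lambda>x. (norm (k x))\<^sup>2)) {0..T}"
    by (intro has_integral_mult_right integrable_integral integrable_continuous_interval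
          continuous_intros contk)
  have i2: "((\<lambda>x. (norm (k' x))\<^sup>2) has_integral integral {0..T} (\<lambda>x. (norm (k' x))\<^sup>2)) {0..T}"
    by (intro integrable_integral integrable_continuous_interval continuous_intros cont)
  from has_integral_le[OF has_integral_add[OF i1 g0] i2] le show ?thesis by simp
qed

text \<open>At \<open>d * T = pi\<close> the cosine vanishes at the end points, so \<open>d\<close>
  is shrunk by \<open>sqrt z\<close> with \<open>z < 1\<close> and \<open>z\<close> tends to 1. The
  limiting case occurs when \<open>l * \<alpha>\<close> is a half-integer.\<close>

lemma dirichlet_wirtinger:
  fixes k k' :: "real \<Rightarrow> complex"
  assumes T: "0 < T" and d: "0 \<le> d" "d * T \<le> pi"
    and der: "\<And>x. x \<in> {0..T} \<Longrightarrow> (k has_vector_derivative k' x) (at x within {0..T})"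
    and cont: "continuous_on {0..T} k'"
    and bdry: "k 0 = 0" "k T = 0"
  shows "d\<^sup>2 * integral {0..T} (\<lambda>x. (norm (k x))\<^sup>2) \<le> integral {0..T} (\<lambda>x. (norm (k' x))\<^sup>2)"
proof (rule field_le_mult_one_interval)
  fix z :: real assume z: "0 < z" "z < 1"
  have "sqrt z * d * T < pi"
  proof (cases "d = 0")
    case False
    then have "d * T > 0" using d T by simp
    moreover have "sqrt z < 1" using z by simp
    ultimately have "sqrt z * (d * T) < 1 * (d * T)" by (intro mult_strict_right_mono)
    then show ?thesis using d by (simp add: mult.assoc)
  qed auto
  from dirichlet_wirtinger_strict[OF T _ this der cont bdry] z d
  show "z * (d\<^sup>2 * integral {0..T} (\<lambda>x. (norm (k x))\<^sup>2)) \<le> integral {0..T} (\<lambda>x. (norm (k' x))\<^sup>2)"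
    by (simp add: power_mult_distrib mult.assoc)
qed

text \<open>Subtracting the extremal \<open>H\<close>, for which equality holds, leaves zero boundary values, and the
  cross term integrates to zero because \<open>H'' = - \<beta>\<^sup>2 H\<close>.\<close>

lemma quasiperiodic_wirtinger:
  fixes h h' :: "real \<Rightarrow> complex"
  assumes T: "0 < T" and \<delta>: "\<bar>\<delta>\<bar> \<le> pi"
    and der: "\<And>x. x \<in> {0..T} \<Longrightarrow> (h has_vector_derivative h' x) (at x within {0..T})"
    and cont: "continuous_on {0..T} h'"
    and bdry: "h T = cis \<delta> * h 0"
  shows "(\<delta> / T)\<^sup>2 * integral {0..T} (\<lambda>x. (norm (h x))\<^sup>2) \<le> integral {0..T} (\<lambda>x. (norm (h' x))\<^sup>2)"
proof -
  \<comment> \<open>With this frequency \<open>H\<close> picks up the same phase over the interval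
    as \<open>h\<close> and agrees with \<open>h\<close> at 0, so the difference vanishes at both
    ends.\<close>
  define \<beta> where "\<beta> = \<delta> / T"
  define H where "H x = h 0 * cis (\<beta> * x)" for x
  define H' where "H' x = \<i> * \<beta> * H x" for x
  have derH: "(H has_vector_derivative H' x) (at x within S)" for x S
    unfolding H_def H'_def
    using has_vector_derivative_mult_right[OF has_vector_derivative_cis, of "h 0" \<beta> x S]
    by (simp add: mult.left_commute mult.assoc)
  have derH': "(H' has_vector_derivative - \<beta>\<^sup>2 *\<^sub>R H x) (at x within S)" for x S
    using has_vector_derivative_mult_right[OF derH, of "\<i> * \<beta>" x S]
    by (simp add: H'_def[abs_def] scaleR_conv_of_real power2_eq_square algebra_simps)
  define k where "k x = h x - H x" for x
  define k' where "k' x = h' x - H' x" for x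
  have conth: "continuous_on {0..T} h"
    using der has_vector_derivative_continuous continuous_on_eq_continuous_within by blast
  have contH: "continuous_on {0..T} H" unfolding H_def by (intro continuous_intros)
  have contH': "continuous_on {0..T} H'" unfolding H'_def by (intro continuous_intros contH)
  have derk: "(k has_vector_derivative k' x) (at x within {0..T})" if "x \<in> {0..T}" for x
    unfolding k_def k'_def by (intro has_vector_derivative_diff der that derH)
  have contk': "continuous_on {0..T} k'"
    unfolding k'_def by (intro continuous_intros cont contH')
  have contk: "continuous_on {0..T} k"
    unfolding k_def by (intro continuous_intros conth contH)
  have kb: "k 0 = 0" "k T = 0" using bdry T by (auto simp: k_def H_def \<beta>_def)
  \<comment> \<open>The bound on \<delta> says that \<beta> does not exceed the first Dirichlet
    frequency \<open>pi / T\<close>, so the remainder \<open>k\<close> obeys the inequality with the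
    constant \<open>\<beta>^2\<close>.\<close>
  have "\<bar>\<beta>\<bar> * T \<le> pi" using \<delta> T by (simp add: \<beta>_def)
  from dirichlet_wirtinger[OF T _ this derk contk' kb]
  have W: "\<beta>\<^sup>2 * integral {0..T} (\<lambda>x. (norm (k x))\<^sup>2) \<le> integral {0..T} (\<lambda>x. (norm (k' x))\<^sup>2)"
    by simp
  define g where "g x = H' x \<bullet> k' x - \<beta>\<^sup>2 * (H x \<bullet> k x)" for x
  have "((\<lambda>x. H' x \<bullet> k x) has_vector_derivative g x) (at x within {0..T})" if "x \<in> {0..T}" for x
    unfolding g_def using derH'[of x "{0..T}"] derk[OF that]
    by (auto simp: has_vector_derivative_def algebra_simps intro!: derivative_eq_intros)
  then have "(g has_integral (H' T \<bullet> k T - H' 0 \<bullet> k 0)) {0..T}"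
    using T by (intro fundamental_theorem_of_calculus) auto
  then have g0: "(g has_integral 0) {0..T}" by (simp add: kb)
  have eq: "(norm (h' x))\<^sup>2 = \<beta>\<^sup>2 * (norm (h x))\<^sup>2 + ((norm (k' x))\<^sup>2 - \<beta>\<^sup>2 * (norm (k x))\<^sup>2) + 2 * g x" for x
  proof -
    have "H' x \<bullet> H' x = \<beta>\<^sup>2 * (H x \<bullet> H x)"
      unfolding power2_norm_eq_inner[symmetric]
      by (simp add: H'_def norm_mult power_mult_distrib)
    moreover have "h x = H x + k x" "h' x = H' x + k' x" by (auto simp: k_def k'_def)
    ultimately show ?thesis
      unfolding power2_norm_eq_inner g_def
      by (simp add: inner_add_left inner_add_right inner_commute algebra_simps)
  qed
  note II = integrable_integral integrable_continuous_interval
  have "((\<lambda>x. \<beta>\<^sup>2 * (norm (h x))\<^sup>2 + ((norm (k' x))\<^sup>2 - \<beta>\<^sup>2 * (norm (k x))\<^sup>2) + 2 * g x) has_integral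
     \<beta>\<^sup>2 * integral {0..T} (\<lambda>x. (norm (h x))\<^sup>2) + (integral {0..T} (\<lambda>x. (norm (k' x))\<^sup>2)
       - \<beta>\<^sup>2 * integral {0..T} (\<lambda>x. (norm (k x))\<^sup>2)) + 2 * 0) {0..T}"
    by (intro has_integral_add has_integral_diff has_integral_mult_right g0 II continuous_intros conth contk contk')
  then have "integral {0..T} (\<lambda>x. (norm (h' x))\<^sup>2) = \<beta>\<^sup>2 * integral {0..T} (\<lambda>x. (norm (h x))\<^sup>2) + (integral {0..T} (\<lambda>x. (norm (k' x))\<^sup>2)
       - \<beta>\<^sup>2 * integral {0..T} (\<lambda>x. (norm (k x))\<^sup>2))"
    unfolding eq[symmetric] by (simp add: integral_unique)
  with W show ?thesis by (simp add: \<beta>_def)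
qed

text \<open>The gauge factor \<open>cis (- \<alpha> * x)\<close> has modulus 1 and turns
  \<open>\<i> d/dx + \<alpha>\<close> into a plain derivative up to a unimodular factor. The price
  is that periodicity becomes quasiperiodicity with phase \<open>- 2 pi l \<alpha>\<close>.\<close>

lemma magnetic_circle_inequality:
  fixes f f' :: "real \<Rightarrow> complex" and l :: nat and \<alpha> :: real
  assumes l: "0 < l"
    and der: "\<And>x. x \<in> {0..2 * pi * l} \<Longrightarrow> (f has_vector_derivative f' x) (at x within {0..2 * pi * l})"
    and cont: "continuous_on {0..2 * pi * l} f'"
    and per: "f (2 * pi * l) = f 0"
  shows "(dist_to_int (l * \<alpha>) / l)\<^sup>2 * integral {0..2 * pi * l} (\<lambda>x. (norm (f x))\<^sup>2)
    \<le> integral {0..2 * pi * l} (\<lambda>x. (norm (\<i> * f' x + \<alpha> * f x))\<^sup>2)"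
proof -
  define T where "T = 2 * pi * l"
  have T: "0 < T" using l by (simp add: T_def)
  \<comment> \<open>The phase matters modulo \<open>2 pi\<close> only; rounding selects the
    representative in \<open>[- pi, pi]\<close>, and \<open>(\<delta> / T)^2\<close> is then the
    constant of the claim.\<close>
  define \<delta> where "\<delta> = 2 * pi * (of_int (round (l * \<alpha>)) - l * \<alpha>)"
  define h where "h x = cis (- \<alpha> * x) * f x" for x
  define h' where "h' x = cis (- \<alpha> * x) * (f' x - \<i> * \<alpha> * f x)" for x
  have conth: "continuous_on {0..T} f"
    using der has_vector_derivative_continuous continuous_on_eq_continuous_within T_def by blast
  have dcis: "((\<lambda>x. cis (- \<alpha> * x)) has_vector_derivative - \<i> * \<alpha> * cis (- \<alpha> * x)) (at x within S)" for x S
    using has_vector_derivative_cis[of "- \<alpha>"] by simp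
  have der_h: "(h has_vector_derivative h' x) (at x within {0..T})" if "x \<in> {0..T}" for x
    unfolding h_def h'_def
    using has_vector_derivative_mult[OF dcis der[folded T_def, OF that]]
    by (simp add: algebra_simps)
  have cont_h: "continuous_on {0..T} h'"
    unfolding h'_def by (intro continuous_intros conth cont[folded T_def])
  have "\<bar>of_int (round (l * \<alpha>)) - l * \<alpha>\<bar> \<le> 1/2"
    using of_int_round_abs_le by blast
  then have \<delta>: "\<bar>\<delta>\<bar> \<le> pi" by (simp add: \<delta>_def abs_mult)
  have "cis \<delta> = cis (2 * pi * of_int (round (l * \<alpha>))) * cis (- \<alpha> * T)"
    unfolding cis_mult \<delta>_def T_def by (simp add: algebra_simps)
  also have "cis (2 * pi * of_int (round (l * \<alpha>))) = 1"
    by (rule cis_multiple_2pi) auto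
  finally have bdry: "h T = cis \<delta> * h 0" using per by (simp add: h_def T_def)
  have "(\<delta> / T)\<^sup>2 = (dist_to_int (l * \<alpha>) / l)\<^sup>2"
    using l by (simp add: dist_to_int_attained \<delta>_def T_def power_divide power_mult_distrib)
  moreover have "norm (h x) = norm (f x)" for x by (simp add: h_def norm_mult)
  moreover have "norm (h' x) = norm (\<i> * f' x + \<alpha> * f x)" for x
  proof -
    have "norm (h' x) = norm (\<i> * (f' x - \<i> * \<alpha> * f x))" by (simp add: h'_def norm_mult)
    then show ?thesis by (simp add: algebra_simps)
  qed
  ultimately show ?thesis
    using quasiperiodic_wirtinger[OF T \<delta> der_h cont_h bdry] by (simp add: T_def)
qed

text \<open>Expanding the squares, the diagonal products give the inverse squared distances. The
  mixed products are grouped by triples: each of the three points of a triangle serves once as the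
  common vertex, and only the total of the three is known to be nonnegative.\<close>

lemma sum_norm_sq_ge_inverse_sq:
  fixes x :: "'n::finite \<Rightarrow> 'a::real_inner"
  shows "(\<Sum>(k, j)\<in>{(k, j). k \<noteq> j}. 1 / (dist (x k) (x j))\<^sup>2)
    \<le> (\<Sum>j\<in>UNIV. (norm (\<Sum>k\<in>UNIV - {j}. (1 / (dist (x j) (x k))\<^sup>2) *\<^sub>R (x j - x k)))\<^sup>2)"
proof -
  define y where "y j k = (1 / (dist (x j) (x k))\<^sup>2) *\<^sub>R (x j - x k)" for j k
  define T where "T j k m = (if k = m then 0 else y j k \<bullet> y j m)" for j k m
  have y0: "y j j = 0" for j by (simp add: y_def)
  \<comment> \<open>The cyclic sum over a nondegenerate triangle is \<open>1 / (2 R\<^sup>2)\<close> with \<open>R\<close> its circumradius.\<close>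
  have cyc: "0 \<le> T j k m + T k m j + T m j k" for j k m
  proof (cases "k = m \<or> j = k \<or> j = m")
    case True
    then show ?thesis by (auto simp: T_def y0)
  next
    case False
    define a b where "a = x j - x k" and "b = x k - x m"
    have c: "x j - x m = a + b" "x m - x j = - (a + b)" "x k - x j = - a" "x m - x k = - b"
      by (auto simp: a_def b_def)
    define A B C where "A = a \<bullet> a" "B = b \<bullet> b" "C = (a + b) \<bullet> (a + b)"
    have nn: "0 \<le> A" "0 \<le> B" "0 \<le> C" by (auto simp: A_B_C_def)
    have y: "y j k = (1/A) *\<^sub>R a" "y k j = - ((1/A) *\<^sub>R a)" "y k m = (1/B) *\<^sub>R b"
      "y m k = - ((1/B) *\<^sub>R b)" "y j m = (1/C) *\<^sub>R (a + b)" "y m j = - ((1/C) *\<^sub>R (a + b))"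
      unfolding y_def dist_norm power2_norm_eq_inner c a_def[symmetric] b_def[symmetric]
        A_B_C_def inner_minus_left inner_minus_right by (simp_all only: scaleR_minus_right minus_minus)
    have eq: "T j k m + T k m j + T m j k = (a \<bullet> (a + b)) / (A * C) - (a \<bullet> b) / (A * B) + (b \<bullet> (a + b)) / (B * C)"
    proof -
      have "k \<noteq> m" "m \<noteq> j" "j \<noteq> k" using False by auto
      then show ?thesis by (simp add: T_def y inner_commute mult.commute)
    qed
    show ?thesis
    proof (cases "A = 0 \<or> B = 0 \<or> C = 0")
      \<comment> \<open>Distinct particles may occupy the same place. Terms with a zero denominator
        vanish, and the one term that can remain is an inverse square.\<close>
      case True
      then consider "a = 0" | "b = 0" | "a + b = 0" by (auto simp: A_B_C_def)
      then show ?thesis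
      proof cases
        case 3
        then have "b = - a" by (simp add: add_eq_0_iff2 minus_equation_iff) 
        then show ?thesis unfolding eq by (simp add: A_B_C_def)
      qed (auto simp: eq A_B_C_def)
    next
      case False
      then have pos: "A > 0" "B > 0" "C > 0" using nn by auto
      have "(a \<bullet> (a + b)) / (A * C) - (a \<bullet> b) / (A * B) + (b \<bullet> (a + b)) / (B * C)
         = ((a \<bullet> (a + b)) * B - (a \<bullet> b) * C + (b \<bullet> (a + b)) * A) / (A * B * C)"
        using pos by (simp add: field_simps)
      \<comment> \<open>Half of the right-hand side is the Gram determinant of \<open>a\<close> and
        \<open>b\<close>, so its sign is the Cauchy-Schwarz inequality.\<close>
      also have "(a \<bullet> (a + b)) * B - (a \<bullet> b) * C + (b \<bullet> (a + b)) * A = 2 * (A * B - (a \<bullet> b)\<^sup>2)"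
        by (simp add: A_B_C_def inner_add_left inner_add_right inner_commute algebra_simps power2_eq_square)
      finally show ?thesis
        using Cauchy_Schwarz_ineq[of a b] pos by (simp add: eq A_B_C_def)
    qed
  qed
  define S where "S = (\<Sum>j\<in>UNIV. \<Sum>k\<in>UNIV. \<Sum>m\<in>UNIV. T j k m)"
  \<comment> \<open>A cyclic relabelling of the three summation indices does not change the total,
    so summing the inequality for triples gives \<open>0 \<le> S + S + S\<close>.\<close>
  have S1: "(\<Sum>j\<in>UNIV. \<Sum>k\<in>UNIV. \<Sum>m\<in>UNIV. T m j k) = S"
  proof -
    have "(\<Sum>j\<in>UNIV. \<Sum>k\<in>UNIV. \<Sum>m\<in>UNIV. T m j k) = (\<Sum>j\<in>UNIV. \<Sum>m\<in>UNIV. \<Sum>k\<in>UNIV. T m j k)"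
      by (rule sum.cong[OF refl], rule sum.swap)
    also have "\<dots> = S" unfolding S_def by (rule sum.swap)
    finally show ?thesis .
  qed
  have S2: "(\<Sum>j\<in>UNIV. \<Sum>k\<in>UNIV. \<Sum>m\<in>UNIV. T k m j) = S"
  proof -
    have "(\<Sum>j\<in>UNIV. \<Sum>k\<in>UNIV. \<Sum>m\<in>UNIV. T k m j) = (\<Sum>k\<in>UNIV. \<Sum>j\<in>UNIV. \<Sum>m\<in>UNIV. T k m j)"
      by (rule sum.swap)
    also have "\<dots> = S" unfolding S_def by (rule sum.cong[OF refl], rule sum.swap)
    finally show ?thesis .
  qed
  have "0 \<le> (\<Sum>j\<in>UNIV. \<Sum>k\<in>UNIV. \<Sum>m\<in>UNIV. T j k m + T k m j + T m j k)"
    by (intro sum_nonneg cyc)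
  also have "\<dots> = S + S + S" unfolding sum.distrib S1 S2 by (simp add: S_def)
  finally have S: "0 \<le> S" by simp
  have rem: "(\<Sum>k\<in>UNIV - {j}. y j k) = (\<Sum>k\<in>UNIV. y j k)" for j
    by (rule sum.mono_neutral_left) (auto simp: y0)
  have "(\<Sum>j\<in>UNIV. (norm (\<Sum>k\<in>UNIV - {j}. y j k))\<^sup>2) = (\<Sum>j\<in>UNIV. \<Sum>k\<in>UNIV. \<Sum>m\<in>UNIV. y j k \<bullet> y j m)"
    unfolding rem power2_norm_eq_inner by (simp add: inner_sum_left inner_sum_right) (simp add: inner_commute)
  also have "\<dots> = (\<Sum>j\<in>UNIV. \<Sum>k\<in>UNIV. \<Sum>m\<in>UNIV. T j k m + (if k = m then y j k \<bullet> y j k else 0))"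
    by (intro sum.cong refl) (simp add: T_def)
  also have "\<dots> = S + (\<Sum>j\<in>UNIV. \<Sum>k\<in>UNIV. y j k \<bullet> y j k)"
    unfolding sum.distrib S_def by simp
  also have "(\<Sum>j\<in>UNIV. \<Sum>k\<in>UNIV. y j k \<bullet> y j k) = (\<Sum>j\<in>UNIV. \<Sum>k\<in>UNIV. 1 / (dist (x k) (x j))\<^sup>2)"
  proof (intro sum.cong refl)
    fix j k
    show "y j k \<bullet> y j k = 1 / (dist (x k) (x j))\<^sup>2"
      by (simp add: y_def power2_norm_eq_inner[symmetric] dist_norm norm_minus_commute power2_eq_square)
  qed
  also have "\<dots> = (\<Sum>(k, j)\<in>UNIV. 1 / (dist (x k) (x j))\<^sup>2)"
    by (subst sum.swap) (simp add: sum.cartesian_product)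
  also have "\<dots> = (\<Sum>(k, j)\<in>{(k, j). k \<noteq> j}. 1 / (dist (x k) (x j))\<^sup>2)"
    by (rule sum.mono_neutral_right) auto
  finally show ?thesis using S by (simp add: y_def)
qed

section \<open>Polynomials as coverings of regular annuli\<close>

text \<open>Over a regular value \<open>p - w\<close> is squarefree and splits into distinct linear
  factors, so the degree counts its roots. That the number is the same for all regular values is
  what excludes further sheets in the covering argument.\<close>

lemma card_regular_fibre:
  fixes p :: "complex poly"
  assumes deg: "0 < degree p" and reg: "\<And>z. poly p z = w \<Longrightarrow> poly (pderiv p) z \<noteq> 0"
  shows "finite {z. poly p z = w}" "card {z. poly p z = w} = degree p"
proof -
  define q where "q = p - [:w:]"
  have dq: "degree q = degree p"
  proof -
    have "q = p + [:- w:]" by (simp add: q_def)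
    then show ?thesis using deg by (metis degree_add_eq_left degree_pCons_0)
  qed
  then have q0: "q \<noteq> 0" using deg by auto
  have roots: "{z. poly p z = w} = {z. poly q z = 0}" by (auto simp: q_def)
  show fin: "finite {z. poly p z = w}" unfolding roots using q0 by (rule poly_roots_finite)
  have "rsquarefree q" using reg by (auto simp: rsquarefree_roots q_def pderiv_diff)
  from complex_poly_decompose_rsquarefree[OF this]
  have "degree q = degree (\<Prod>z|poly q z = 0. [:-z, 1:])"
    using q0 by (metis degree_smult_eq leading_coeff_0_iff)
  also have "\<dots> = card {z. poly q z = 0}"
    by (subst degree_prod_sum_eq) auto
  finally show "card {z. poly p z = w} = degree p" using dq roots by simp
qed

text \<open>Around each of the finitely many preimages of \<open>w\<close> the polynomial is
  injective on a ball; a common radius makes these balls disjoint. No properness argument is needed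
  to rule out other sheets, because the fibres are counted.\<close>

lemma covering_space_poly:
  fixes p :: "complex poly"
  assumes deg: "0 < degree p" and A: "open A"
    and reg: "\<And>z. poly p z \<in> A \<Longrightarrow> poly (pderiv p) z \<noteq> 0"
  shows "covering_space (poly p -` A) (poly p) A"
proof
  show "continuous_on (poly p -` A) (poly p)" by (intro continuous_intros)
  have "\<exists>z. poly p z = w" if "w \<in> A" for w
    using card_regular_fibre[OF deg, of w] reg that deg
    by (metis (mono_tags, lifting) card.empty empty_Collect_eq less_irrefl)
  then show "poly p ` (poly p -` A) = A" by blast
  have cont: "continuous_on X (poly p)" for X by (intro continuous_intros)
  have hol: "poly p holomorphic_on X" for X by (intro holomorphic_intros)
  fix w assume w: "w \<in> A"
  define Z where "Z = {z. poly p z = w}"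
  have fib: "finite {z. poly p z = w'}" "card {z. poly p z = w'} = degree p" if "w' \<in> A" for w'
    using card_regular_fibre[OF deg, of w'] reg that by auto
  have finZ: "finite Z" and cardZ: "card Z = degree p" using fib w by (auto simp: Z_def)
  have ev: "\<forall>\<^sub>F r in at_right 0. 0 < r \<and> (\<forall>z\<in>Z. inj_on (poly p) (ball z r)) \<and>
      (\<forall>z\<in>Z. \<forall>z'\<in>Z. z' \<noteq> z \<longrightarrow> ball z r \<inter> ball z' r = {})"
  proof (intro eventually_conj eventually_ball_finite ballI finZ eventually_at_right_less)
    fix z assume z: "z \<in> Z"
    then have "deriv (poly p) z \<noteq> 0"
      using reg w by (simp add: Z_def poly_DERIV[THEN DERIV_imp_deriv])
    from has_complex_derivative_locally_injective[OF hol _ open_UNIV this]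
    obtain r where "r > 0" "inj_on (poly p) (ball z r)" by blast
    then show "\<forall>\<^sub>F r in at_right 0. inj_on (poly p) (ball z r)"
      unfolding eventually_at_right_field
      by (meson inj_on_subset less_imp_le subset_ball)
    fix z' assume "z' \<in> Z"
    show "\<forall>\<^sub>F r in at_right 0. z' \<noteq> z \<longrightarrow> ball z r \<inter> ball z' r = {}"
    proof (cases "z' = z")
      case False
      have "ball z r \<inter> ball z' r = {}" if "r < dist z z' / 2" for r
        using that by (intro disjoint_ballI) auto
      moreover have "0 < dist z z' / 2" using False by simp
      ultimately show ?thesis unfolding eventually_at_right_field by blast
    qed simp
  qed
  then obtain r where r: "0 < r" and inj: "\<And>z. z \<in> Z \<Longrightarrow> inj_on (poly p) (ball z r)"
    and disj: "\<And>z z'. z \<in> Z \<Longrightarrow> z' \<in> Z \<Longrightarrow> z' \<noteq> z \<Longrightarrow> ball z r \<inter> ball z' r = {}"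
    using eventually_happens'[OF _ ev] by auto
  \<comment> \<open>A value in \<open>T\<close> is attained in every one of the balls.\<close>
  define T where "T = A \<inter> (\<Inter>z\<in>Z. poly p ` ball z r)"
  have wT: "w \<in> T"
    using w r by (auto simp: T_def Z_def intro!: image_eqI)
  have openT: "open T"
    unfolding T_def by (intro open_Int A open_INT finZ ballI open_mapping_thm3[OF hol] inj) auto
  define V where "V = (\<lambda>z. ball z r \<inter> poly p -` T) ` Z"
  have openpT: "open (X \<inter> poly p -` T)" if "open X" for X
    using that openT by (intro open_Int open_vimage) (auto intro!: continuous_intros)
  \<comment> \<open>The balls contain one preimage each, which makes \<open>degree p\<close>
    distinct preimages, and there are no more than that.\<close>
  have cover: "\<exists>z\<in>Z. y \<in> ball z r" if y: "poly p y \<in> T" for y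
  proof -
    have "\<forall>z\<in>Z. \<exists>x. x \<in> ball z r \<and> poly p x = poly p y" using y by (fastforce simp: T_def)
    then obtain q where q: "\<And>z. z \<in> Z \<Longrightarrow> q z \<in> ball z r \<and> poly p (q z) = poly p y" by metis
    have "inj_on q Z"
      by (rule inj_onI) (metis IntI disj empty_iff q)
    moreover have yA: "poly p y \<in> A" using y by (simp add: T_def)
    ultimately have "q ` Z = {z. poly p z = poly p y}"
      using q fib[OF yA] cardZ by (intro card_subset_eq) (auto simp: card_image)
    then show ?thesis using q by (metis (mono_tags, lifting) imageE mem_Collect_eq)
  qed
  have evenly: "\<exists>v. \<Union> v = poly p -` A \<inter> poly p -` T \<and>
      (\<forall>u\<in>v. openin (top_of_set (poly p -` A)) u) \<and>
      pairwise disjnt v \<and> (\<forall>u\<in>v. \<exists>q. homeomorphism u T (poly p) q)"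
  proof (rule exI[of _ V], intro conjI ballI)
    show "\<Union> V = poly p -` A \<inter> poly p -` T" using cover by (auto simp: V_def T_def)
    show "pairwise disjnt V"
      using disj by (force simp: V_def pairwise_def disjnt_def)
    fix u assume "u \<in> V"
    then obtain z where z: "z \<in> Z" and u: "u = ball z r \<inter> poly p -` T" by (auto simp: V_def)
    have "open u" unfolding u by (intro openpT) auto
    then show "openin (top_of_set (poly p -` A)) u"
      by (intro open_openin_trans) (auto simp: u T_def intro!: open_vimage A continuous_intros)
    obtain g where g: "g holomorphic_on (poly p ` ball z r)" "\<And>y. y \<in> ball z r \<Longrightarrow> g (poly p y) = y"
      by (rule holomorphic_has_inverse[OF hol open_ball inj[OF z]]) (erule that)
    have Tsub: "T \<subseteq> poly p ` ball z r" using z by (auto simp: T_def)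
    have contg: "continuous_on T g"
      by (rule continuous_on_subset[OF holomorphic_on_imp_continuous_on[OF g(1)] Tsub])
    have gT: "g w' \<in> u \<and> poly p (g w') = w'" if w': "w' \<in> T" for w'
    proof -
      obtain y where "y \<in> ball z r" "w' = poly p y" using Tsub w' by blast
      then show ?thesis using g(2) w' by (simp add: u)
    qed
    have "homeomorphism u T (poly p) g"
    proof (rule homeomorphismI[OF cont contg])
      show "poly p ` u \<subseteq> T" by (auto simp: u)
      show "g ` T \<subseteq> u" using gT by blast
      show "g (poly p x) = x" if "x \<in> u" for x using that g(2) by (simp add: u)
      show "poly p (g y) = y" if "y \<in> T" for y using that gT by blast
    qed
    then show "\<exists>q. homeomorphism u T (poly p) q" by blast
  qed
  have "openin (top_of_set A) T" using openT by (intro open_openin_trans) (auto simp: A T_def)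
  with wT evenly show "\<exists>T. w \<in> T \<and> openin (top_of_set A) T \<and>
      (\<exists>v. \<Union> v = poly p -` A \<inter> poly p -` T \<and>
         (\<forall>u\<in>v. openin (top_of_set (poly p -` A)) u) \<and>
         pairwise disjnt v \<and> (\<forall>u\<in>v. \<exists>q. homeomorphism u T (poly p) q))" by blast
qed

text \<open>\<open>I\<close> is an open interval of values of \<open>ln |p|\<close> free of critical
  ones, and \<open>t0\<close> is a base point in it. Logarithmic coordinates replace the annulus by
  a strip, which is simply connected; hence lifts of \<open>exp\<close> exist on the whole strip,
  while the failure of periodicity records the monodromy.\<close>

locale regular_annulus =
  fixes p :: "complex poly" and I :: "real set" and t0 :: real
  assumes deg: "0 < degree p" and openI: "open I" and convexI: "convex I" and t0: "t0 \<in> I"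
    and regular: "\<And>z. poly p z \<noteq> 0 \<Longrightarrow> ln (cmod (poly p z)) \<in> I \<Longrightarrow> poly (pderiv p) z \<noteq> 0"
begin

definition strip :: "complex set" where "strip = {s. Re s \<in> I}"
definition annulus :: "complex set" where "annulus = {w. w \<noteq> 0 \<and> ln (cmod w) \<in> I}"
definition base_fibre :: "complex set" where "base_fibre = {z. poly p z = exp (of_real t0)}"
definition is_lift :: "(complex \<Rightarrow> complex) \<Rightarrow> bool" where
  "is_lift g \<longleftrightarrow> continuous_on strip g \<and> (\<forall>s\<in>strip. poly p (g s) = exp s)"
text \<open>Meaningful for \<open>z\<close> in \<open>base_fibre\<close>: there a lift exists and is
  determined on \<open>strip\<close>. Its values off the strip are arbitrary.\<close>

definition lift :: "complex \<Rightarrow> complex \<Rightarrow> complex" where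
  "lift z = (SOME g. is_lift g \<and> g (of_real t0) = z)"
definition monodromy :: "complex \<Rightarrow> complex" where
  "monodromy z = lift z (of_real t0 + 2 * pi * \<i>)"

lemma strip_open: "open strip"
proof -
  have "strip = Re -` I" by (auto simp: strip_def)
  then show ?thesis using openI by (auto intro!: open_vimage continuous_intros)
qed

lemma strip_convex: "convex strip"
proof -
  have "strip = Re -` I" by (auto simp: strip_def)
  then show ?thesis using convexI by (auto intro!: convex_linear_vimage bounded_linear.linear[OF bounded_linear_Re])
qed

lemma annulus_open: "open annulus"
proof -
  have "open ({w. w \<noteq> (0::complex)} \<inter> (\<lambda>w. ln (cmod w)) -` I)"
    by (intro continuous_open_preimage openI) (auto intro!: continuous_intros open_Collect_neq)
  then show ?thesis by (simp add: annulus_def vimage_def Collect_conj_eq)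
qed

lemma t0_strip: "of_real t0 \<in> strip" using t0 by (simp add: strip_def)

lemma exp_in_annulus: "exp s \<in> annulus \<longleftrightarrow> s \<in> strip" by (simp add: annulus_def strip_def)

lemma covering: "covering_space (poly p -` annulus) (poly p) annulus"
  using covering_space_poly[OF deg annulus_open] regular by (auto simp: annulus_def)

lemma lift_exists:
  assumes "s \<in> strip" "poly p z = exp s"
  shows "\<exists>g. is_lift g \<and> g s = z"
proof -
  have "path_connected strip" "simply_connected strip" "locally path_connected strip"
    using strip_convex by (auto intro: convex_imp_path_connected convex_imp_simply_connected
        convex_imp_locally_path_connected)
  moreover have "continuous_on strip exp" by (intro continuous_intros)
  moreover have "exp \<in> strip \<rightarrow> annulus" by (simp add: exp_in_annulus)
  moreover have "z \<in> poly p -` annulus" using assms by (simp add: exp_in_annulus)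
  ultimately obtain g where
    "continuous_on strip g" "g s = z" "\<And>y. y \<in> strip \<Longrightarrow> poly p (g y) = exp y"
    using assms covering_space_lift_strong[OF covering, of z s strip exp] by metis
  then show ?thesis by (auto simp: is_lift_def)
qed

lemma lift_unique:
  assumes "is_lift g1" "is_lift g2" "a \<in> strip" "g1 a = g2 a" "s \<in> strip"
  shows "g1 s = g2 s"
proof (rule covering_space_lift_unique[OF covering, of g1 a g2 strip exp])
  show "connected strip" using strip_convex by (rule convex_connected)
  show "continuous_on strip exp" by (intro continuous_intros)
  show "exp \<in> strip \<rightarrow> annulus" by (simp add: exp_in_annulus)
  show "continuous_on strip g1" "continuous_on strip g2" using assms by (simp_all add: is_lift_def)
  show "g1 \<in> strip \<rightarrow> poly p -` annulus" "g2 \<in> strip \<rightarrow> poly p -` annulus"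
    using assms by (simp_all add: is_lift_def exp_in_annulus)
  show "exp x = poly p (g1 x)" "exp x = poly p (g2 x)" if "x \<in> strip" for x
    using assms that by (simp_all add: is_lift_def)
qed (use assms in simp_all)

section \<open>Lifts labelled by their value at the base point, and the monodromy action on the
  labels\<close>

lemma is_lift_lift: "is_lift (lift z)" and lift_base: "lift z (of_real t0) = z" if "z \<in> base_fibre"
proof -
  have "\<exists>g. is_lift g \<and> g (of_real t0) = z"
    using lift_exists[OF t0_strip] that by (simp add: base_fibre_def)
  from someI_ex[OF this] show "is_lift (lift z)" "lift z (of_real t0) = z"
    by (auto simp: lift_def)
qed

lemma poly_lift: "z \<in> base_fibre \<Longrightarrow> s \<in> strip \<Longrightarrow> poly p (lift z s) = exp s"
  using is_lift_lift unfolding is_lift_def by blast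

lemma lift_eq:
  assumes "is_lift g" "s \<in> strip"
  shows "g (of_real t0) \<in> base_fibre" "g s = lift (g (of_real t0)) s"
proof -
  show *: "g (of_real t0) \<in> base_fibre"
    using assms t0_strip by (simp add: base_fibre_def is_lift_def)
  show "g s = lift (g (of_real t0)) s"
    by (rule lift_unique[OF assms(1) is_lift_lift[OF *] t0_strip _ assms(2)]) (simp add: lift_base[OF *])
qed

lemma lift_surj:
  assumes "s \<in> strip" "poly p z = exp s"
  shows "\<exists>y\<in>base_fibre. lift y s = z"
  using lift_exists[OF assms] lift_eq[OF _ assms(1)] by metis

lemma lift_inj:
  assumes "z \<in> base_fibre" "z' \<in> base_fibre" "s \<in> strip" "lift z s = lift z' s"
  shows "z = z'"
  using lift_unique[OF is_lift_lift is_lift_lift assms(3,4) t0_strip] lift_base assms(1,2) by simp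

text \<open>\<open>exp\<close> determines its argument up to multiples of \<open>2 pi \<i>\<close>,
  and lifts that meet over one point coincide. Thus the images of a cell of height
  \<open>2 pi\<close> under the various lifts do not overlap.\<close>

lemma lift_inj_cell:
  assumes "z \<in> base_fibre" "z' \<in> base_fibre" "s \<in> strip" "s' \<in> strip" "lift z s = lift z' s'"
    and "\<bar>Im s - Im s'\<bar> < 2 * pi"
  shows "z = z'" "s = s'"
proof -
  have "exp s = exp s'" using poly_lift assms by metis
  then show "s = s'" using assms(6) exp_complex_eqI by blast
  then show "z = z'" using lift_inj assms by blast
qed

text \<open>Since \<open>exp\<close> has period \<open>2 pi \<i>\<close>, translating a lift gives a
  lift again, possibly with another label.\<close>

lemma lift_period:
  assumes "z \<in> base_fibre" "s \<in> strip"
  shows "monodromy z \<in> base_fibre" "lift z (s + 2 * pi * \<i>) = lift (monodromy z) s"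
proof -
  define g where "g s = lift z (s + 2 * pi * \<i>)" for s
  have "continuous_on ((\<lambda>s. s + 2 * pi * \<i>) ` strip) (lift z)"
    using is_lift_lift[OF assms(1)] unfolding is_lift_def
    by (rule_tac continuous_on_subset) (auto simp: strip_def)
  then have "continuous_on strip g" unfolding g_def
    by (rule continuous_on_compose2) (auto intro!: continuous_intros)
  moreover have "poly p (g s) = exp s" if "s \<in> strip" for s
  proof -
    have "s + 2 * pi * \<i> \<in> strip" using that by (simp add: strip_def)
    from poly_lift[OF assms(1) this] show ?thesis by (simp add: g_def exp_add)
  qed
  ultimately have g: "is_lift g" by (simp add: is_lift_def)
  have "g (of_real t0) = monodromy z" by (simp add: g_def monodromy_def)
  with lift_eq[OF g assms(2)] show "monodromy z \<in> base_fibre" "lift z (s + 2 * pi * \<i>) = lift (monodromy z) s"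
    by (auto simp: g_def)
qed

lemma funpow_monodromy: "z \<in> base_fibre \<Longrightarrow> (monodromy ^^ m) z \<in> base_fibre"
  by (induction m) (auto intro: lift_period(1)[OF _ t0_strip])

lemma base_fibre_finite: "finite base_fibre" and base_fibre_card: "card base_fibre = degree p"
proof -
  have "poly (pderiv p) z \<noteq> 0" if "poly p z = exp (of_real t0)" for z
    using regular[of z] that t0 by simp
  from card_regular_fibre[OF deg, of "exp (of_real t0)", OF this]
  show "finite base_fibre" "card base_fibre = degree p" by (auto simp: base_fibre_def)
qed

lemma inj_on_monodromy: "inj_on monodromy base_fibre"
proof (rule inj_onI)
  fix z z' assume z: "z \<in> base_fibre" "z' \<in> base_fibre" "monodromy z = monodromy z'"
  have "of_real t0 + 2 * pi * \<i> \<in> strip" using t0 by (simp add: strip_def)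
  from lift_inj[OF z(1,2) this] z(3) show "z = z'" by (simp add: monodromy_def)
qed

lemma monodromy_bij: "bij_betw monodromy base_fibre base_fibre"
  by (metis bij_betw_imageI endo_inj_surj image_subsetI base_fibre_finite inj_on_monodromy lift_period(1) t0_strip)

text \<open>Pigeonhole among the \<open>degree p\<close> labels; an initial segment of the orbit can
  be cancelled because the monodromy is injective. This bounds the winding lengths \<open>l\<close>
  by the degree.\<close>

lemma monodromy_order:
  assumes z: "z \<in> base_fibre"
  obtains l where "0 < l" "l \<le> degree p" "(monodromy ^^ l) z = z"
proof -
  have "\<not> inj_on (\<lambda>m. (monodromy ^^ m) z) {0..degree p}"
  proof
    assume "inj_on (\<lambda>m. (monodromy ^^ m) z) {0..degree p}"
    then have "card {0..degree p} \<le> card base_fibre"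
      using funpow_monodromy[OF z] by (intro card_inj_on_le base_fibre_finite) auto
    then show False by (simp add: base_fibre_card)
  qed
  then obtain a b where ab: "a < b" "b \<le> degree p" "(monodromy ^^ a) z = (monodromy ^^ b) z"
    unfolding inj_on_def by (metis atLeastAtMost_iff linorder_neqE_nat)
  have inj: "inj_on (monodromy ^^ a) base_fibre"
    by (rule bij_betw_imp_inj_on[OF bij_betw_funpow[OF monodromy_bij]])
  have "(monodromy ^^ a) z = (monodromy ^^ a) ((monodromy ^^ (b - a)) z)"
    using ab by (metis comp_apply funpow_add le_add_diff_inverse less_imp_le)
  then have "(monodromy ^^ (b - a)) z = z"
    using inj z funpow_monodromy[OF z] by (metis inj_onD)
  then show ?thesis using ab by (intro that[of "b - a"]) auto
qed

text \<open>Continuity keeps a lift near \<open>lift z s\<close> in a ball on which \<open>p\<close>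
  has a holomorphic inverse \<open>g\<close>, so locally the lift is
  \<open>g \<circ> exp\<close>.\<close>

lemma lift_derivative:
  assumes z: "z \<in> base_fibre" and s: "s \<in> strip"
  shows "(lift z has_field_derivative exp s / poly (pderiv p) (lift z s)) (at s)"
proof -
  have ne: "poly (pderiv p) (lift z s) \<noteq> 0"
    using regular[of "lift z s"] poly_lift[OF z s] s by (simp add: strip_def)
  have hol: "poly p holomorphic_on UNIV" by (intro holomorphic_intros)
  have d: "deriv (poly p) (lift z s) = poly (pderiv p) (lift z s)"
    by (rule DERIV_imp_deriv[OF poly_DERIV])
  obtain r where r: "r > 0" "inj_on (poly p) (ball (lift z s) r)"
    using has_complex_derivative_locally_injective[OF hol _ open_UNIV, of "lift z s"] ne d by auto
  obtain g where g: "g holomorphic_on poly p ` ball (lift z s) r"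
    "\<And>y. y \<in> ball (lift z s) r \<Longrightarrow> deriv (poly p) y * deriv g (poly p y) = 1"
    "\<And>y. y \<in> ball (lift z s) r \<Longrightarrow> g (poly p y) = y"
    using holomorphic_has_inverse[OF _ open_ball r(2)] hol holomorphic_on_subset by blast
  have op: "open (poly p ` ball (lift z s) r)"
    by (rule open_mapping_thm3[OF _ open_ball r(2)]) (use hol holomorphic_on_subset in blast)
  have ls: "lift z s \<in> ball (lift z s) r" using r by simp
  have "(g has_field_derivative deriv g (poly p (lift z s))) (at (poly p (lift z s)))"
    using g(1) op ls by (intro holomorphic_derivI) auto
  moreover have "deriv g (poly p (lift z s)) = 1 / poly (pderiv p) (lift z s)"
    using g(2)[OF ls] ne d by (simp add: field_simps)
  ultimately have dg: "(g has_field_derivative 1 / poly (pderiv p) (lift z s)) (at (exp s))"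
    using poly_lift[OF z s] by simp
  have D: "((\<lambda>s. g (exp s)) has_field_derivative exp s / poly (pderiv p) (lift z s)) (at s)"
    using DERIV_chain2[OF dg DERIV_exp] by simp
  have "isCont (lift z) s"
    using is_lift_lift[OF z] s strip_open by (auto simp: is_lift_def continuous_on_eq_continuous_at)
  then have "\<forall>\<^sub>F y in nhds s. lift z y \<in> ball (lift z s) r"
    using r(1) by (intro topological_tendstoD[of "lift z" "lift z s"])
      (auto simp: continuous_at_imp_continuous_at_within isCont_def tendsto_at_iff_tendsto_nhds)
  moreover have "\<forall>\<^sub>F y in nhds s. y \<in> strip" using s strip_open by (rule eventually_nhds_in_open[rotated])
  ultimately have ev: "\<forall>\<^sub>F y in nhds s. g (exp y) = lift z y"
    by eventually_elim (use g(3) poly_lift[OF z] in fastforce)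
  from D show ?thesis by (rule DERIV_cong_ev[OF refl ev refl, THEN iffD1])
qed

end

section \<open>Change of variables and iterated integrals\<close>

text \<open>For finite measure this is the equivalence between the measure of the image and the
  integral of the Jacobian. The same equivalence shows that one side is infinite exactly if the
  other is. The function \<open>d\<close> stands for the Jacobian on \<open>T\<close> and is
  measurable on the whole space.\<close>

lemma emeasure_differentiable_image:
  fixes G :: "real^'n::{finite,wellorder} \<Rightarrow> real^'n::_"
  assumes T: "T \<in> sets lebesgue"
    and der: "\<And>x. x \<in> T \<Longrightarrow> (G has_derivative G' x) (at x within T)"
    and inj: "inj_on G T"
    and d: "d \<in> borel_measurable lebesgue" "\<And>x. x \<in> T \<Longrightarrow> d x = \<bar>det (matrix (G' x))\<bar>"
  shows "emeasure lebesgue (G ` T) = (\<integral>\<^sup>+x. ennreal (d x) * indicator T x \<partial>lebesgue)"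
proof -
  define e where "e x = (if x \<in> T then d x else 0)" for x
  have e: "e \<in> borel_measurable lebesgue" "\<And>x. 0 \<le> e x"
    unfolding e_def using T d by (auto intro!: measurable_If_set)
  have int_e: "(\<integral>\<^sup>+x. ennreal (d x) * indicator T x \<partial>lebesgue) = (\<integral>\<^sup>+x. ennreal (e x) \<partial>lebesgue)"
    by (intro nn_integral_cong) (auto simp: e_def indicator_def)
  have "((\<lambda>x. \<bar>det (matrix (G' x))\<bar>) has_integral m) T \<longleftrightarrow> (e has_integral m) UNIV" for m
    unfolding e_def has_integral_restrict_UNIV by (rule has_integral_cong) (simp add: d)
  then have iff: "G ` T \<in> lmeasurable \<and> measure lebesgue (G ` T) = m \<longleftrightarrow> (e has_integral m) UNIV" for m
    using has_measure_differentiable_image[OF T der inj] by simp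
  have GT: "G ` T \<in> sets lebesgue"
    by (rule differentiable_image_in_sets_lebesgue[OF T]) (use der in \<open>auto simp: differentiable_on_def differentiable_def\<close>)
  show ?thesis
  proof (cases "G ` T \<in> lmeasurable")
    case True
    then have "(e has_integral measure lebesgue (G ` T)) UNIV" using iff by blast
    then have "(\<integral>\<^sup>+x. ennreal (e x) \<partial>lebesgue) = ennreal (measure lebesgue (G ` T))"
      using has_integral_iff_nn_integral_lebesgue[of e] e by simp
    then show ?thesis using True by (simp add: int_e emeasure_eq_measure2)
  next
    case False
    then have "\<not> (e has_integral m) UNIV" for m using iff by blast
    then have "(\<integral>\<^sup>+x. ennreal (e x) \<partial>lebesgue) \<noteq> ennreal m" if "0 \<le> m" for m
      using has_integral_iff_nn_integral_lebesgue[of e] e that by blast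
    then have "(\<integral>\<^sup>+x. ennreal (e x) \<partial>lebesgue) = \<infinity>"
      by (metis ennreal_cases infinity_ennreal_def)
    moreover have "emeasure lebesgue (G ` T) = \<infinity>"
      using False GT by (metis fmeasurableI infinity_ennreal_def less_top)
    ultimately show ?thesis by (simp add: int_e)
  qed
qed

lemma nn_integral_change_of_variables:
  fixes G :: "real^'n::{finite,wellorder} \<Rightarrow> real^'n::_" and f :: "real^'n::_ \<Rightarrow> ennreal"
  assumes S: "S \<in> sets lebesgue"
    and der: "\<And>x. x \<in> S \<Longrightarrow> (G has_derivative G' x) (at x within S)"
    and inj: "inj_on G S"
    and d: "d \<in> borel_measurable lebesgue" "\<And>x. x \<in> S \<Longrightarrow> d x = \<bar>det (matrix (G' x))\<bar>"
    and f: "f \<in> borel_measurable borel"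
  shows "(\<integral>\<^sup>+x. f x * indicator (G ` S) x \<partial>lebesgue) = (\<integral>\<^sup>+x. ennreal (d x) * f (G x) * indicator S x \<partial>lebesgue)"
proof -
  have GS: "G ` S \<in> sets lebesgue"
    by (rule differentiable_image_in_sets_lebesgue[OF S]) (use der in \<open>auto simp: differentiable_on_def differentiable_def\<close>)
  \<comment> \<open>Extending \<open>G\<close> by 0 makes it measurable on the whole space, so that
    it can be used to push measures forward; the density vanishes off \<open>S\<close>
    anyway.\<close>
  define H where "H x = (if x \<in> S then G x else 0)" for x
  have contG: "continuous_on S G"
    using der has_derivative_continuous continuous_on_eq_continuous_within by blast
  have [measurable]: "S \<in> sets lebesgue" "G ` S \<in> sets lebesgue" by fact+
  have H[measurable]: "H \<in> measurable lebesgue borel"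
    unfolding H_def using continuous_imp_measurable_on_sets_lebesgue[OF contG S] S
    by (simp add: borel_measurable_if)
  have [measurable]: "d \<in> borel_measurable lebesgue" by fact
  have id[measurable]: "(\<lambda>x :: real^'n::{finite,wellorder}. x) \<in> measurable lebesgue borel"
    by (auto simp: measurable_def)
  define M where "M = distr (density lebesgue (\<lambda>x. ennreal (d x) * indicator S x)) borel H"
  define N where "N = distr (density lebesgue (indicator (G ` S))) borel (\<lambda>x. x)"
  have "M = N"
  proof (rule measure_eqI)
    show "sets M = sets N" by (simp add: M_def N_def)
    fix B assume "B \<in> sets M"
    then have B: "B \<in> sets borel" by (simp add: M_def)
    define T where "T = S \<inter> H -` B"
    have T: "T \<in> sets lebesgue"
      using measurable_sets[OF H B] S by (auto simp: T_def)
    have "emeasure M B = (\<integral>\<^sup>+x. ennreal (d x) * indicator S x * indicator (H -` B) x \<partial>lebesgue)"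
      unfolding M_def using B measurable_sets[OF H B] by (simp add: emeasure_distr emeasure_density)
    also have "\<dots> = (\<integral>\<^sup>+x. ennreal (d x) * indicator T x \<partial>lebesgue)"
      by (intro nn_integral_cong) (auto simp: T_def indicator_def)
    also have "\<dots> = emeasure lebesgue (G ` T)"
    proof (rule emeasure_differentiable_image[symmetric, OF T _ _ d(1)])
      show "(G has_derivative G' x) (at x within T)" if "x \<in> T" for x
        using that der by (auto simp: T_def intro: has_derivative_subset)
      show "inj_on G T" using inj by (rule inj_on_subset) (auto simp: T_def)
      show "d x = \<bar>det (matrix (G' x))\<bar>" if "x \<in> T" for x using that d by (simp add: T_def)
    qed
    also have "G ` T = G ` S \<inter> B" by (auto simp: T_def H_def)
    also have "emeasure lebesgue (G ` S \<inter> B) = emeasure N B"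
    proof -
      have B': "B \<in> sets lebesgue" using B by auto
      have "emeasure N B = (\<integral>\<^sup>+x. indicator (G ` S) x * indicator B x \<partial>lebesgue)"
        unfolding N_def using B B' by (subst emeasure_distr) (simp_all add: emeasure_density)
      also have "\<dots> = (\<integral>\<^sup>+x. indicator (G ` S \<inter> B) x \<partial>lebesgue)"
        by (simp add: indicator_inter_arith)
      also have "\<dots> = emeasure lebesgue (G ` S \<inter> B)"
        using GS B' by (intro nn_integral_indicator) auto
      finally show ?thesis ..
    qed
    finally show "emeasure M B = emeasure N B" .
  qed
  have [measurable]: "f \<in> borel_measurable borel" by fact
  have "(\<integral>\<^sup>+x. ennreal (d x) * f (G x) * indicator S x \<partial>lebesgue)
      = (\<integral>\<^sup>+x. ennreal (d x) * indicator S x * f (H x) \<partial>lebesgue)"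
    by (intro nn_integral_cong) (auto simp: H_def indicator_def)
  also have "\<dots> = integral\<^sup>N M f"
    unfolding M_def by (simp add: nn_integral_distr nn_integral_density)
  also have "\<dots> = (\<integral>\<^sup>+x. indicator (G ` S) x * f x \<partial>lebesgue)"
    unfolding \<open>M = N\<close> N_def by (simp add: nn_integral_distr nn_integral_density)
  finally show ?thesis by (simp add: mult.commute)
qed

section \<open>Lebesgue measure on vectors as a product measure, and iterated integrals\<close>

lemma borel_measurable_vec_lambda:
  "(vec_lambda :: ('n::finite \<Rightarrow> 'a::euclidean_space) \<Rightarrow> _) \<in> measurable (\<Pi>\<^sub>M i\<in>UNIV. lborel) borel"
proof (subst borel_measurable_euclidean_space, rule ballI)
  fix b :: "'a^'n" assume "b \<in> Basis"
  then obtain i c where "b = axis i c" by (auto simp: Basis_vec_def)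
  then show "(\<lambda>x. vec_lambda x \<bullet> b) \<in> borel_measurable (\<Pi>\<^sub>M i\<in>UNIV. lborel)"
    by (simp add: inner_axis)
qed

text \<open>Lebesgue measure is determined by the volumes of boxes. A box in \<open>'a^'n\<close> is
  a product of boxes in \<open>'a\<close>, and the two products of side lengths match because the
  basis vectors are the \<open>axis i c\<close>.\<close>

lemma lborel_vec:
  "(lborel :: ('a::euclidean_space^'n::finite) measure) = distr (\<Pi>\<^sub>M i\<in>UNIV. lborel) borel vec_lambda"
proof (rule lborel_eqI)
  note borel_measurable_vec_lambda[measurable]
  interpret product_sigma_finite "\<lambda>_::'n. lborel :: 'a measure" ..
  fix l u :: "'a^'n" assume le: "\<And>b. b \<in> Basis \<Longrightarrow> l \<bullet> b \<le> u \<bullet> b"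
  have le': "l $ i \<bullet> c \<le> u $ i \<bullet> c" if "c \<in> Basis" for i c
    using le[of "axis i c"] that by (simp add: inner_axis axis_in_Basis_iff)
  have "vec_lambda -` box l u \<inter> space (\<Pi>\<^sub>M i\<in>UNIV. lborel) = (\<Pi>\<^sub>E i\<in>UNIV. box (l $ i) (u $ i))"
    by (auto simp: mem_box Basis_vec_def inner_axis space_PiM PiE_def Pi_def)
  then have "emeasure (distr (\<Pi>\<^sub>M i\<in>UNIV. lborel) borel vec_lambda) (box l u)
     = (\<Prod>i\<in>UNIV. emeasure lborel (box (l $ i) (u $ i)))"
    by (simp add: emeasure_distr emeasure_PiM)
  also have "\<dots> = (\<Prod>i\<in>UNIV. ennreal (\<Prod>c\<in>Basis. (u $ i - l $ i) \<bullet> c))"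
    using le' by (intro prod.cong refl) (simp add: emeasure_lborel_box)
  also have "\<dots> = ennreal (\<Prod>i\<in>UNIV. \<Prod>c\<in>Basis. (u $ i - l $ i) \<bullet> c)"
    using le' by (intro prod_ennreal prod_nonneg) (simp add: inner_diff_left)
  also have "(\<Prod>i\<in>UNIV. \<Prod>c\<in>Basis. (u $ i - l $ i) \<bullet> c) = (\<Prod>(i, c)\<in>UNIV \<times> Basis. (u - l) \<bullet> axis i c)"
    by (simp add: prod.cartesian_product inner_axis)
  also have "\<dots> = (\<Prod>b\<in>Basis. (u - l) \<bullet> b)"
  proof (rule prod.reindex_bij_betw[of "\<lambda>(i, c). axis i c", unfolded case_prod_unfold, THEN trans[rotated]])
    show "bij_betw (\<lambda>x. axis (fst x) (snd x)) (UNIV \<times> Basis) (Basis :: ('a^'n) set)"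
      unfolding bij_betw_def
    proof
      show "inj_on (\<lambda>x. axis (fst x) (snd x)) (UNIV \<times> (Basis :: 'a set))"
        by (auto simp: inj_on_def axis_eq_axis nonzero_Basis)
      show "(\<lambda>x. axis (fst x) (snd x)) ` (UNIV \<times> Basis) = (Basis :: ('a^'n) set)"
      proof safe
        fix b :: "'a^'n" assume "b \<in> Basis"
        then obtain i c where "b = axis i c" "c \<in> Basis" by (auto simp: Basis_vec_def)
        then show "b \<in> (\<lambda>x. axis (fst x) (snd x)) ` (UNIV \<times> Basis)"
          by (intro image_eqI[of _ _ "(i, c)"]) auto
      qed (auto simp: axis_in_Basis_iff)
    qed
  qed (simp add: case_prod_unfold)
  finally show "emeasure (distr (\<Pi>\<^sub>M i\<in>UNIV. lborel) borel vec_lambda) (box l u) = ennreal (\<Prod>b\<in>Basis. (u - l) \<bullet> b)" .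
qed simp

lemma nn_integral_vec_split:
  fixes f :: "'a::euclidean_space^'n::finite \<Rightarrow> ennreal"
  assumes f[measurable]: "f \<in> borel_measurable borel"
  shows "(\<integral>\<^sup>+x. f x \<partial>lborel) =
    (\<integral>\<^sup>+y. (\<integral>\<^sup>+z. f (vec_lambda (y(j := z))) \<partial>lborel) \<partial>(\<Pi>\<^sub>M i\<in>UNIV - {j}. lborel))"
proof -
  note borel_measurable_vec_lambda[measurable]
  interpret product_sigma_finite "\<lambda>_::'n. lborel :: 'a measure" ..
  have ins: "insert j (UNIV - {j}) = UNIV" by auto
  have "(\<integral>\<^sup>+x. f x \<partial>lborel) = (\<integral>\<^sup>+x. f (vec_lambda x) \<partial>(\<Pi>\<^sub>M i\<in>UNIV. lborel))"
    by (subst lborel_vec) (simp add: nn_integral_distr)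
  also have "\<dots> = (\<integral>\<^sup>+x. f (vec_lambda x) \<partial>(\<Pi>\<^sub>M i\<in>insert j (UNIV - {j}). lborel))"
    by (simp add: ins)
  also have "\<dots> = (\<integral>\<^sup>+y. (\<integral>\<^sup>+z. f (vec_lambda (y(j := z))) \<partial>lborel) \<partial>(\<Pi>\<^sub>M i\<in>UNIV - {j}. lborel))"
    by (rule product_nn_integral_insert) (auto simp: ins)
  finally show ?thesis .
qed

lemma borel_measurable_vector2:
  "(\<lambda>(s, t). vector [s, t] :: real^2) \<in> borel_measurable (lborel \<Otimes>\<^sub>M lborel)"
  by (subst borel_measurable_euclidean_space)
    (auto simp: Basis_vec_def inner_axis split_beta forall_2 vector_def)

lemma borel_measurable_nn_integral_real2:
  fixes f :: "real^2 \<Rightarrow> ennreal"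
  assumes "f \<in> borel_measurable borel"
  shows "(\<lambda>s. \<integral>\<^sup>+t. f (vector [s, t]) \<partial>lborel) \<in> borel_measurable borel"
proof -
  have "(\<lambda>s. \<integral>\<^sup>+t. f (vector [s, t]) \<partial>lborel) \<in> borel_measurable lborel"
    using measurable_compose[OF borel_measurable_vector2 assms]
    by (intro lborel.borel_measurable_nn_integral) (simp add: split_beta')
  then show ?thesis by simp
qed

lemma nn_integral_real2:
  fixes f :: "real^2 \<Rightarrow> ennreal"
  assumes f[measurable]: "f \<in> borel_measurable borel"
  shows "(\<integral>\<^sup>+x. f x \<partial>lborel) = (\<integral>\<^sup>+s. (\<integral>\<^sup>+t. f (vector [s, t]) \<partial>lborel) \<partial>lborel)"
proof -
  interpret product_sigma_finite "\<lambda>_::2. lborel :: real measure" ..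
  have U: "UNIV - {2} = {1::2}" using exhaust_2 by auto
  have vec: "vec_lambda (y(2 := t)) = vector [y 1, t :: real]" for y :: "2 \<Rightarrow> real" and t
    by (simp add: vec_eq_iff forall_2)
  note [measurable] = borel_measurable_nn_integral_real2[OF f]
  show ?thesis
    unfolding nn_integral_vec_split[OF f, of 2] U vec
    by (rule product_nn_integral_singleton) measurable
qed

section \<open>Monodromy and the fibrewise circle inequality\<close>

lemma sum_periodic:
  fixes f :: "nat \<Rightarrow> 'a::comm_semiring_1"
  assumes "\<And>k. f (k + l) = f k"
  shows "(\<Sum>k<l * q. f k) = of_nat q * (\<Sum>k<l. f k)"
proof (induction q)
  case (Suc q)
  have shift: "f (k + l * q) = f k" for k
  proof (induction q)
    case (Suc q)
    have "f (k + l * Suc q) = f ((k + l * q) + l)" by (simp add: algebra_simps)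
    then show ?case using assms Suc by simp
  qed auto
  have "(\<Sum>k<l * Suc q. f k) = (\<Sum>k<l * q. f k) + (\<Sum>k=l*q..<l*q+l. f k)"
    by (simp add: lessThan_atLeast0 sum.atLeastLessThan_concat algebra_simps)
  also have "(\<Sum>k=l*q..<l*q+l. f k) = (\<Sum>k<l. f k)"
    using sum.shift_bounds_nat_ivl[of f 0 "l * q" l] shift by (simp add: lessThan_atLeast0 add.commute)
  finally show ?case using Suc by (simp add: algebra_simps)
qed auto

context regular_annulus begin

lemma shift_monodromy:
  assumes per: "\<And>z t. z \<in> base_fibre \<Longrightarrow> g z (t + 2 * pi) = g (monodromy z) t" and z: "z \<in> base_fibre"
  shows "g z (t + 2 * pi * real m) = g ((monodromy ^^ m) z) t"
proof (induction m arbitrary: t)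
  case (Suc m)
  have "g z (t + 2 * pi * real (Suc m)) = g z ((t + 2 * pi) + 2 * pi * real m)"
    by (simp add: algebra_simps)
  then show ?case using Suc per[OF funpow_monodromy[OF z]] by simp
qed auto

text \<open>Each full turn replaces the label by its image under the monodromy, so \<open>m\<close>
  turns along one lift are one turn along each of the first \<open>m\<close> iterates.\<close>

lemma integral_monodromy:
  fixes g :: "complex \<Rightarrow> real \<Rightarrow> real"
  assumes per: "\<And>z t. z \<in> base_fibre \<Longrightarrow> g z (t + 2 * pi) = g (monodromy z) t"
    and cont: "\<And>z. z \<in> base_fibre \<Longrightarrow> continuous_on UNIV (g z)" and z: "z \<in> base_fibre"
  shows "integral {0..2 * pi * real m} (g z) = (\<Sum>k<m. integral {0..2 * pi} (g ((monodromy ^^ k) z)))"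
proof (induction m)
  case (Suc m)
  have "integral {0..2 * pi * real (Suc m)} (g z)
      = integral {0..2 * pi * real m} (g z) + integral {2 * pi * real m..2 * pi * real (Suc m)} (g z)"
    by (intro Henstock_Kurzweil_Integration.integral_combine[symmetric] integrable_continuous_interval
        continuous_on_subset[OF cont[OF z]]) (auto simp: algebra_simps)
  also have "integral {2 * pi * real m..2 * pi * real (Suc m)} (g z)
      = integral {0..2 * pi} (g z \<circ> (\<lambda>t. t + 2 * pi * real m))"
    using integral_shift[of 0 "2 * pi * real m" "2 * pi" "g z"] continuous_on_subset[OF cont[OF z]]
    by (simp add: algebra_simps)
  also have "g z \<circ> (\<lambda>t. t + 2 * pi * real m) = g ((monodromy ^^ m) z)"
    using shift_monodromy[of g, OF per z] by auto
  finally show ?case using Suc by simp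
qed auto

text \<open>The monodromy is not decomposed into cycles. Instead every label is followed for the
  same number \<open>L\<close> of turns, a multiple of all the possible return times, and the factor
  \<open>L\<close> is divided out after summing over the fibre.\<close>

lemma fibre_circle_inequality:
  fixes f f' :: "complex \<Rightarrow> real \<Rightarrow> complex"
  assumes der: "\<And>z t. z \<in> base_fibre \<Longrightarrow> (f z has_vector_derivative f' z t) (at t)"
    and cont: "\<And>z. z \<in> base_fibre \<Longrightarrow> continuous_on UNIV (f' z)"
    and per: "\<And>z t. z \<in> base_fibre \<Longrightarrow> f z (t + 2 * pi) = f (monodromy z) t"
    and per': "\<And>z t. z \<in> base_fibre \<Longrightarrow> f' z (t + 2 * pi) = f' (monodromy z) t"
    and D: "\<And>l. 0 < l \<Longrightarrow> l \<le> degree p \<Longrightarrow> D \<le> (dist_to_int (real l * \<alpha>) / real l)\<^sup>2"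
  shows "D * (\<Sum>z\<in>base_fibre. integral {0..2 * pi} (\<lambda>t. (norm (f z t))\<^sup>2))
    \<le> (\<Sum>z\<in>base_fibre. integral {0..2 * pi} (\<lambda>t. (norm (\<i> * f' z t + \<alpha> * f z t))\<^sup>2))"
proof -
  \<comment> \<open>After \<open>L\<close> turns every cycle of the monodromy has closed up.\<close>
  define L where "L = (fact (degree p) :: nat)"
  define a where "a z = integral {0..2 * pi} (\<lambda>t. (norm (f z t))\<^sup>2)" for z
  define b where "b z = integral {0..2 * pi} (\<lambda>t. (norm (\<i> * f' z t + \<alpha> * f z t))\<^sup>2)" for z
  have contf: "continuous_on UNIV (f z)" if "z \<in> base_fibre" for z
    using has_vector_derivative_continuous[OF der[OF that]] by (intro continuous_at_imp_continuous_on ballI)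
  have ia: "integral {0..2 * pi * real m} (\<lambda>t. (norm (f z t))\<^sup>2) = (\<Sum>k<m. a ((monodromy ^^ k) z))"
    if "z \<in> base_fibre" for z m
    unfolding a_def using that per
    by (intro integral_monodromy[where g = "\<lambda>z t. (norm (f z t))\<^sup>2"]) (auto intro!: continuous_intros contf)
  have ib: "integral {0..2 * pi * real m} (\<lambda>t. (norm (\<i> * f' z t + \<alpha> * f z t))\<^sup>2)
      = (\<Sum>k<m. b ((monodromy ^^ k) z))"
    if "z \<in> base_fibre" for z m
    unfolding b_def using that per per'
    by (intro integral_monodromy[where g = "\<lambda>z t. (norm (\<i> * f' z t + \<alpha> * f z t))\<^sup>2"])
      (auto intro!: continuous_intros contf cont)
  have orbit: "D * (\<Sum>k<L. a ((monodromy ^^ k) z)) \<le> (\<Sum>k<L. b ((monodromy ^^ k) z))"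
    if z: "z \<in> base_fibre" for z
  proof -
    \<comment> \<open>Any return time up to the degree will do, minimal or not: after
      \<open>l\<close> turns the curve is closed, and \<open>L\<close> turns run through it
      \<open>q\<close> times.\<close>
    obtain l where l: "0 < l" "l \<le> degree p" "(monodromy ^^ l) z = z"
      using monodromy_order[OF z] by blast
    have "l dvd L" unfolding L_def using l by (intro dvd_fact) auto
    then obtain q where q: "L = l * q" by blast
    have "(monodromy ^^ (k + l)) z = (monodromy ^^ k) z" for k
      using l by (simp add: funpow_add)
    then have sums: "(\<Sum>k<L. a ((monodromy ^^ k) z)) = real q * (\<Sum>k<l. a ((monodromy ^^ k) z))"
      "(\<Sum>k<L. b ((monodromy ^^ k) z)) = real q * (\<Sum>k<l. b ((monodromy ^^ k) z))"
      unfolding q by (intro sum_periodic; simp)+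
    have "f z (2 * pi * real l) = f z 0"
      using shift_monodromy[of f, OF per z, of 0 l] l by simp
    from magnetic_circle_inequality[OF l(1) _ _ this, of "f' z" \<alpha>]
    have "(dist_to_int (real l * \<alpha>) / real l)\<^sup>2 * (\<Sum>k<l. a ((monodromy ^^ k) z))
       \<le> (\<Sum>k<l. b ((monodromy ^^ k) z))"
      using der[OF z] continuous_on_subset[OF cont[OF z]]
      by (simp add: ia[OF z] ib[OF z] has_vector_derivative_at_within)
    moreover have "D * (\<Sum>k<l. a ((monodromy ^^ k) z))
        \<le> (dist_to_int (real l * \<alpha>) / real l)\<^sup>2 * (\<Sum>k<l. a ((monodromy ^^ k) z))"
      using D[OF l(1,2)] by (intro mult_right_mono sum_nonneg) (auto simp: a_def intro!: Henstock_Kurzweil_Integration.integral_nonneg integrable_continuous_interval continuous_intros continuous_on_subset[OF contf] funpow_monodromy z)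
    ultimately have "D * (\<Sum>k<l. a ((monodromy ^^ k) z)) \<le> (\<Sum>k<l. b ((monodromy ^^ k) z))" by linarith
    from mult_left_mono[OF this, of "real q"] show ?thesis
      unfolding sums by (simp add: algebra_simps)
  qed
  \<comment> \<open>Each iterate of the monodromy permutes the fibre, so the sums over the fibre are
    all equal.\<close>
  have sumL: "(\<Sum>z\<in>base_fibre. \<Sum>k<L. c ((monodromy ^^ k) z)) = real L * (\<Sum>z\<in>base_fibre. c z)" for c :: "complex \<Rightarrow> real"
  proof -
    have "(\<Sum>z\<in>base_fibre. \<Sum>k<L. c ((monodromy ^^ k) z)) = (\<Sum>k<L. \<Sum>z\<in>base_fibre. c ((monodromy ^^ k) z))"
      by (rule sum.swap)
    also have "\<dots> = (\<Sum>k<L. \<Sum>z\<in>base_fibre. c z)"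
      by (intro sum.cong refl sum.reindex_bij_betw bij_betw_funpow monodromy_bij)
    finally show ?thesis by simp
  qed
  have "(\<Sum>z\<in>base_fibre. D * (\<Sum>k<L. a ((monodromy ^^ k) z))) \<le> (\<Sum>z\<in>base_fibre. \<Sum>k<L. b ((monodromy ^^ k) z))"
    by (intro sum_mono orbit)
  then have "D * (real L * (\<Sum>z\<in>base_fibre. a z)) \<le> real L * (\<Sum>z\<in>base_fibre. b z)"
    by (simp only: sum_distrib_left[of D, symmetric] sumL)
  then have "real L * (D * (\<Sum>z\<in>base_fibre. a z)) \<le> real L * (\<Sum>z\<in>base_fibre. b z)"
    by (simp add: algebra_simps)
  moreover have "real L > 0" by (simp add: L_def)
  ultimately have "D * (\<Sum>z\<in>base_fibre. a z) \<le> (\<Sum>z\<in>base_fibre. b z)"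
    by (rule mult_left_le_imp_le)
  then show ?thesis by (simp add: a_def b_def)
qed

end

section \<open>The plane as the complex numbers, and conformal changes of variables\<close>

definition to_complex :: "real^2 \<Rightarrow> complex" where "to_complex x = Complex (x $ 1) (x $ 2)"
definition of_complex :: "complex \<Rightarrow> real^2" where "of_complex z = vector [Re z, Im z]"

lemma to_of_complex [simp]: "to_complex (of_complex z) = z" "of_complex (to_complex x) = x"
  by (simp_all add: to_complex_def of_complex_def vec_eq_iff forall_2)

lemma bounded_linear_to_complex: "bounded_linear to_complex"
  by (rule linear_conv_bounded_linear[THEN iffD1]) (auto simp: linear_iff to_complex_def complex_eq_iff)

lemma bounded_linear_of_complex: "bounded_linear of_complex"
  by (rule linear_conv_bounded_linear[THEN iffD1]) (auto simp: linear_iff of_complex_def vec_eq_iff forall_2)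

lemmas continuous_on_to_complex [continuous_intros] = bounded_linear.continuous_on[OF bounded_linear_to_complex]
lemmas continuous_on_of_complex [continuous_intros] = bounded_linear.continuous_on[OF bounded_linear_of_complex]

lemma borel_measurable_to_complex [measurable]: "to_complex \<in> borel_measurable borel"
  by (intro borel_measurable_continuous_onI continuous_intros)

text \<open>The real Jacobian determinant of multiplication by a complex number is the square of its
  modulus.\<close>

lemma nn_integral_conformal:
  fixes g g' :: "complex \<Rightarrow> complex" and f :: "real^2 \<Rightarrow> ennreal" and S :: "(real^2) set"
  assumes S: "S \<in> sets borel"
    and der: "\<And>x. x \<in> S \<Longrightarrow> (g has_field_derivative g' (to_complex x)) (at (to_complex x))"
    and cont: "continuous_on S (\<lambda>x. g' (to_complex x))"
    and inj: "inj_on g (to_complex ` S)"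
    and f: "f \<in> borel_measurable borel"
  shows "(\<integral>\<^sup>+x. f x * indicator ((\<lambda>x. of_complex (g (to_complex x))) ` S) x \<partial>lborel)
    = (\<integral>\<^sup>+x. ennreal ((cmod (g' (to_complex x)))\<^sup>2) * f (of_complex (g (to_complex x))) * indicator S x \<partial>lborel)" (is ?int)
    and "(\<lambda>x. of_complex (g (to_complex x))) ` S \<in> sets lebesgue" (is ?meas)
proof -
  define G where "G x = of_complex (g (to_complex x))" for x
  define G' where "G' x h = of_complex (g' (to_complex x) * to_complex h)" for x h
  define d where "d x = (if x \<in> S then (cmod (g' (to_complex x)))\<^sup>2 else 0)" for x
  have S': "S \<in> sets lebesgue" using S by simp
  have derG: "(G has_derivative G' x) (at x within S)" if "x \<in> S" for x
  proof -
    have "((\<lambda>x. g (to_complex x)) has_derivative (\<lambda>h. g' (to_complex x) * to_complex h)) (at x within S)"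
      using has_derivative_compose[OF bounded_linear_imp_has_derivative[OF bounded_linear_to_complex]
          der[OF that, unfolded has_field_derivative_def]]
      by (simp add: has_derivative_at_withinI)
    from bounded_linear.has_derivative[OF bounded_linear_of_complex this]
    show ?thesis by (simp add: G_def[abs_def] G'_def[abs_def])
  qed
  have det: "d x = \<bar>det (matrix (G' x))\<bar>" if "x \<in> S" for x
    using that
    by (simp add: d_def det_2 matrix_def G'_def to_complex_def of_complex_def axis_def cmod_def power2_eq_square)
  have d: "d \<in> borel_measurable lebesgue"
    unfolding d_def using S'
    by (subst borel_measurable_if)
      (auto intro!: continuous_imp_measurable_on_sets_lebesgue continuous_intros cont)
  have inj': "inj_on G S"
  proof (rule inj_onI)
    fix x y assume xy: "x \<in> S" "y \<in> S" "G x = G y"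
    then have "g (to_complex x) = g (to_complex y)" unfolding G_def by (metis to_of_complex(1))
    then have "to_complex x = to_complex y" using inj xy by (auto dest: inj_onD)
    then show "x = y" by (metis to_of_complex(2))
  qed
  have "(\<integral>\<^sup>+x. f x * indicator (G ` S) x \<partial>lborel) = (\<integral>\<^sup>+x. ennreal (d x) * f (G x) * indicator S x \<partial>lborel)"
    using nn_integral_change_of_variables[OF S' derG inj' d det f] by (simp add: nn_integral_completion)
  also have "\<dots> = (\<integral>\<^sup>+x. ennreal ((cmod (g' (to_complex x)))\<^sup>2) * f (G x) * indicator S x \<partial>lborel)"
    by (intro nn_integral_cong) (auto simp: d_def indicator_def)
  finally show ?int by (simp add: G_def)
  have "G ` S \<in> sets lebesgue"
    by (rule differentiable_image_in_sets_lebesgue[OF S']) (use derG in \<open>auto simp: differentiable_on_def differentiable_def\<close>)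
  then show ?meas by (simp add: G_def[abs_def])
qed

text \<open>On each vertical line \<open>|p|^2 - m^2\<close> is a nonzero polynomial in the real
  coordinate and has finitely many zeros; Fubini does the rest. This covers critical level curves as
  well as, for \<open>m = 0\<close>, the zeros of \<open>p\<close>.\<close>

lemma AE_poly_cmod_neq:
  fixes p :: "complex poly"
  assumes deg: "0 < degree p"
  shows "AE x in lborel. cmod (poly p (to_complex x)) \<noteq> m"
proof -
  let ?E = "{x. cmod (poly p (to_complex x)) = m}"
  have meas: "?E \<in> sets borel"
    by (intro borel_closed closed_Collect_eq continuous_intros)
  have fin: "finite {t. cmod (poly p (to_complex (vector [s, t]))) = m}" for s
  proof -
    \<comment> \<open>For real \<open>t\<close> the second factor is the conjugate of the first, so
      \<open>q\<close> takes the value \<open>|p (s + \<i> t)|^2 - m^2\<close>. The product has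
      degree \<open>2 * degree p > 0\<close>, so subtracting a constant cannot annihilate
      it.\<close>
    define q where "q = pcompose p [:of_real s, \<i>:] * pcompose (map_poly cnj p) [:of_real s, - \<i>:] - [:of_real (m\<^sup>2):]"
    have cnj_poly: "poly (map_poly cnj p) (cnj z) = cnj (poly p z)" for z
      by (simp add: poly_altdef degree_map_poly coeff_map_poly)
    have dq: "degree (pcompose p [:of_real s, \<i>:] * pcompose (map_poly cnj p) [:of_real s, - \<i>:]) = 2 * degree p"
    proof -
      have "map_poly cnj p \<noteq> 0"
        using deg degree_map_poly[of cnj p] by (metis complex_cnj_zero_iff degree_0 less_irrefl)
      then show ?thesis using deg by (subst degree_mult_eq) (auto simp: degree_pcompose degree_map_poly pcompose_eq_0_iff)
    qed
    have "q \<noteq> 0"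
    proof
      assume "q = 0"
      then have "pcompose p [:of_real s, \<i>:] * pcompose (map_poly cnj p) [:of_real s, - \<i>:] = [:of_real (m\<^sup>2):]"
        by (simp add: q_def)
      with dq deg show False by simp
    qed
    then have "finite {z. poly q z = 0}" by (rule poly_roots_finite)
    then have "finite (of_real -` {z. poly q z = 0} :: real set)"
      by (rule finite_vimageI) (simp add: inj_def)
    moreover have "poly q (of_real t) = 0" if "cmod (poly p (to_complex (vector [s, t]))) = m" for t
    proof -
      define z where "z = to_complex (vector [s, t])"
      have z: "z = of_real s + of_real t * \<i>" by (simp add: z_def to_complex_def complex_eq_iff)
      have "of_real s - of_real t * \<i> = cnj z" by (simp add: z)
      then have "poly q (of_real t) = poly p z * cnj (poly p z) - of_real (m\<^sup>2)"
        using cnj_poly[of z] by (simp add: q_def poly_pcompose z)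
      then show ?thesis using that by (simp add: complex_norm_square[symmetric] z_def)
    qed
    ultimately show ?thesis by (auto elim!: rev_finite_subset)
  qed
  have "emeasure lborel ?E = (\<integral>\<^sup>+x. indicator ?E x \<partial>lborel)" using meas by simp
  also have "\<dots> = (\<integral>\<^sup>+s. \<integral>\<^sup>+t. indicator ?E (vector [s, t]) \<partial>lborel \<partial>lborel)"
    using meas by (intro nn_integral_real2) auto
  also have "\<dots> = (\<integral>\<^sup>+s. 0 \<partial>(lborel :: real measure))"
  proof (intro nn_integral_cong)
    fix s :: real
    have "AE t in lborel. t \<notin> {t. cmod (poly p (to_complex (vector [s, t]))) = m}"
      using fin by (intro AE_not_in finite_imp_null_set_lborel)
    then have "AE t in lborel. indicator ?E (vector [s, t]) = (0 :: ennreal)"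
      by eventually_elim simp
    then have "(\<integral>\<^sup>+t. indicator ?E (vector [s, t]) \<partial>lborel) = (\<integral>\<^sup>+t. 0 \<partial>(lborel :: real measure))"
      by (rule nn_integral_cong_AE)
    then show "(\<integral>\<^sup>+t. indicator ?E (vector [s, t]) \<partial>lborel) = 0" by simp
  qed
  finally have "?E \<in> null_sets lborel" using meas by auto
  from AE_not_in[OF this] show ?thesis by simp
qed

section \<open>The inequality on a regular annulus\<close>

text \<open>A vector field written as a complex number: the conjugate of \<open>p' / p\<close> is
  the gradient of \<open>ln |p|\<close>, and multiplication by \<open>\<i>\<close> rotates it into
  the gradient of \<open>arg p\<close>.\<close>

definition vortex_field :: "complex poly \<Rightarrow> real \<Rightarrow> real^2 \<Rightarrow> complex" where
  "vortex_field p \<alpha> x = \<alpha> * \<i> * cnj (poly (pderiv p) (to_complex x) / poly p (to_complex x))"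

text \<open>The partial derivatives are separate arguments, so that the same expression serves for
  classical derivatives and for the limits that replace weak ones.\<close>

definition vortex_energy ::
  "complex poly \<Rightarrow> real \<Rightarrow> (real^2 \<Rightarrow> complex) \<Rightarrow> (real^2 \<Rightarrow> complex) \<Rightarrow> (real^2 \<Rightarrow> complex) \<Rightarrow> real^2 \<Rightarrow> real" where
  "vortex_energy p \<alpha> v v1 v2 x =
     (norm (\<i> * v1 x + of_real (Re (vortex_field p \<alpha> x)) * v x))\<^sup>2 +
     (norm (\<i> * v2 x + of_real (Im (vortex_field p \<alpha> x)) * v x))\<^sup>2"

definition vortex_weight :: "complex poly \<Rightarrow> (real^2 \<Rightarrow> complex) \<Rightarrow> real^2 \<Rightarrow> real" where
  "vortex_weight p v x = (cmod (poly (pderiv p) (to_complex x) / poly p (to_complex x)))\<^sup>2 * (norm (v x))\<^sup>2"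

lemma vortex_nonneg: "0 \<le> vortex_weight p v x" "0 \<le> vortex_energy p \<alpha> v v1 v2 x"
  by (simp_all add: vortex_weight_def vortex_energy_def)

lemma borel_measurable_vortex:
  assumes [measurable]: "v \<in> borel_measurable borel" "v1 \<in> borel_measurable borel" "v2 \<in> borel_measurable borel"
  shows "vortex_energy p \<alpha> v v1 v2 \<in> borel_measurable borel" "vortex_weight p v \<in> borel_measurable borel"
proof -
  have [measurable]: "poly q \<in> borel_measurable borel" for q :: "complex poly"
    by (intro borel_measurable_continuous_onI continuous_intros)
  have [measurable]: "cnj \<in> borel_measurable borel"
    by (intro borel_measurable_continuous_onI continuous_intros)
  show "vortex_energy p \<alpha> v v1 v2 \<in> borel_measurable borel"
    unfolding vortex_energy_def[abs_def] vortex_field_def by measurable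
  show "vortex_weight p v \<in> borel_measurable borel"
    unfolding vortex_weight_def[abs_def] by measurable
qed

text \<open>Cauchy-Schwarz for the coefficients. With \<open>(X, Y)\<close> tangent to a level curve
  it bounds the tangential part of the magnetic gradient by the whole.\<close>

lemma norm_scaleR_add_sq_le:
  fixes a b :: "'a::real_normed_vector"
  shows "(norm (X *\<^sub>R a + Y *\<^sub>R b))\<^sup>2 \<le> (X\<^sup>2 + Y\<^sup>2) * ((norm a)\<^sup>2 + (norm b)\<^sup>2)"
proof -
  have "norm (X *\<^sub>R a + Y *\<^sub>R b) \<le> \<bar>X\<bar> * norm a + \<bar>Y\<bar> * norm b"
    by (metis norm_scaleR norm_triangle_ineq)
  then have "(norm (X *\<^sub>R a + Y *\<^sub>R b))\<^sup>2 \<le> (\<bar>X\<bar> * norm a + \<bar>Y\<bar> * norm b)\<^sup>2"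
    by (intro power_mono) auto
  also have "(A * c + B * d)\<^sup>2 \<le> (A\<^sup>2 + B\<^sup>2) * (c\<^sup>2 + d\<^sup>2)" for A B c d :: real
    using zero_le_power2[of "A * d - B * c"] by (simp add: power2_eq_square algebra_simps)
  finally show ?thesis by simp
qed

lemma nn_integral_half_open_continuous:
  fixes h :: "real \<Rightarrow> real"
  assumes "continuous_on UNIV h" "\<And>t. 0 \<le> h t"
  shows "(\<integral>\<^sup>+t. ennreal (h t) * indicator {0..<c} t \<partial>lborel) = ennreal (integral {0..c} h)"
proof -
  have "(h has_integral integral {0..c} h) {0..c}"
    by (intro integrable_integral integrable_continuous_interval continuous_on_subset[OF assms(1)]) auto
  from nn_integral_has_integral_lebesgue[OF _ this] assms(2)
  have "(\<integral>\<^sup>+t. ennreal (indicator {0..c} t * h t) \<partial>lborel) = ennreal (integral {0..c} h)"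
    by (simp add: nn_integral_completion)
  moreover have "(\<integral>\<^sup>+t. ennreal (h t) * indicator {0..<c} t \<partial>lborel) = (\<integral>\<^sup>+t. ennreal (indicator {0..c} t * h t) \<partial>lborel)"
  proof (rule nn_integral_cong_AE)
    show "AE t in lborel. ennreal (h t) * indicator {0..<c} t = ennreal (indicator {0..c} t * h t)"
      using AE_lborel_singleton[of c] by eventually_elim (auto simp: indicator_def)
  qed
  ultimately show ?thesis by simp
qed

context regular_annulus begin

definition dlift :: "complex \<Rightarrow> complex \<Rightarrow> complex" where
  "dlift z s = exp s / poly (pderiv p) (lift z s)"

definition lift2 :: "complex \<Rightarrow> real^2 \<Rightarrow> real^2" where
  "lift2 z x = of_complex (lift z (to_complex x))"

text \<open>The coordinates are \<open>ln |p|\<close> and \<open>arg p\<close>. The interval for the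
  argument is half open, so that the lifts cover every point of the region once, the seam
  included.\<close>

definition cell :: "real set \<Rightarrow> (real^2) set" where
  "cell B = {x. x $ 1 \<in> I \<inter> B \<and> 0 \<le> x $ 2 \<and> x $ 2 < 2 * pi}"

definition sector :: "real set \<Rightarrow> (real^2) set" where
  "sector B = {x. poly p (to_complex x) \<noteq> 0 \<and> ln (cmod (poly p (to_complex x))) \<in> I \<inter> B}"

lemma cell_sets: "B \<in> sets borel \<Longrightarrow> cell B \<in> sets borel"
proof -
  assume B: "B \<in> sets borel"
  have "cell B = (\<lambda>x::real^2. x $ 1) -` (I \<inter> B) \<inter> {x. 0 \<le> x $ 2 \<and> x $ 2 < 2 * pi}"
    by (auto simp: cell_def)
  moreover have "(\<lambda>x::real^2. x $ 1) -` (I \<inter> B) \<in> sets borel"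
  proof -
    have "(\<lambda>x::real^2. x $ 1) -` (I \<inter> B) \<inter> space borel \<in> sets borel"
      by (rule measurable_sets[OF borel_measurable_continuous_onI])
        (use B openI in \<open>auto intro!: continuous_intros\<close>)
    then show ?thesis by simp
  qed
  moreover have "{x::real^2. 0 \<le> x $ 2 \<and> x $ 2 < 2 * pi} \<in> sets borel"
    unfolding Collect_conj_eq
    by (intro sets.Int borel_closed borel_open closed_Collect_le open_Collect_less continuous_intros)
  ultimately show ?thesis by simp
qed

lemma cell_strip: "x \<in> cell B \<Longrightarrow> to_complex x \<in> strip"
  by (simp add: cell_def strip_def to_complex_def)

lemma dlift: "z \<in> base_fibre \<Longrightarrow> s \<in> strip \<Longrightarrow> (lift z has_field_derivative dlift z s) (at s)"
  unfolding dlift_def by (rule lift_derivative)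

lemma pderiv_lift_nonzero: "z \<in> base_fibre \<Longrightarrow> s \<in> strip \<Longrightarrow> poly (pderiv p) (lift z s) \<noteq> 0"
  using regular[of "lift z s"] poly_lift[of z s] by (simp add: strip_def)

text \<open>This is the derivative of \<open>log (p (lift z s)) = s\<close>. In square modulus it
  says that the Jacobian of the lift and the weight are reciprocal.\<close>

lemma dlift_log_derivative:
  assumes "z \<in> base_fibre" "s \<in> strip"
  shows "dlift z s * (poly (pderiv p) (lift z s) / poly p (lift z s)) = 1"
  using pderiv_lift_nonzero[OF assms] poly_lift[OF assms] by (simp add: dlift_def)

lemma continuous_on_lift: "z \<in> base_fibre \<Longrightarrow> continuous_on strip (lift z)"
  using is_lift_lift by (simp add: is_lift_def)

lemma continuous_on_dlift: "z \<in> base_fibre \<Longrightarrow> continuous_on strip (dlift z)"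
  unfolding dlift_def using pderiv_lift_nonzero
  by (intro continuous_intros continuous_on_lift) auto

lemma lift2_disjoint: "disjoint_family_on (\<lambda>z. lift2 z ` cell B) base_fibre"
  unfolding disjoint_family_on_def
proof safe
  fix z z' x y assume z: "z \<in> base_fibre" "z' \<in> base_fibre" "z \<noteq> z'"
    and xy: "x \<in> cell B" "y \<in> cell B" "lift2 z x = lift2 z' y"
  have "lift z (to_complex x) = lift z' (to_complex y)"
    using xy(3) unfolding lift2_def by (metis to_of_complex(1))
  moreover have "\<bar>Im (to_complex x) - Im (to_complex y)\<bar> < 2 * pi"
    using xy by (auto simp: cell_def to_complex_def)
  ultimately have "z = z'"
    using lift_inj_cell(1)[OF z(1,2) cell_strip[OF xy(1)] cell_strip[OF xy(2)]] by blast
  then show "lift2 z x \<in> {}" using z by simp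
qed

lemma inj_on_lift_cell: "z \<in> base_fibre \<Longrightarrow> inj_on (lift z) (to_complex ` cell B)"
proof (rule inj_onI, safe)
  fix x y assume z: "z \<in> base_fibre" and xy: "x \<in> cell B" "y \<in> cell B"
    and eq: "lift z (to_complex x) = lift z (to_complex y)"
  have "\<bar>Im (to_complex x) - Im (to_complex y)\<bar> < 2 * pi"
    using xy by (auto simp: cell_def to_complex_def)
  then show "to_complex x = to_complex y"
    using lift_inj_cell(2)[OF z z cell_strip[OF xy(1)] cell_strip[OF xy(2)] eq] by blast
qed

text \<open>A point \<open>x\<close> is reached over the logarithmic polar coordinates of its value
  \<open>p x\<close>, with \<open>Arg2pi\<close> choosing the representative in the cell.\<close>

lemma sector_eq: "sector B = (\<Union>z\<in>base_fibre. lift2 z ` cell B)"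
proof safe
  fix x assume x: "x \<in> sector B"
  define w where "w = poly p (to_complex x)"
  have w: "w \<noteq> 0" "ln (cmod w) \<in> I" "ln (cmod w) \<in> B" using x by (auto simp: sector_def w_def)
  define y :: "real^2" where "y = vector [ln (cmod w), Arg2pi w]"
  have y: "y \<in> cell B"
    using w Arg2pi_ge_0[of w] Arg2pi_lt_2pi[of w] by (simp add: y_def cell_def)
  have "exp (to_complex y) = exp (of_real (ln (cmod w)) + \<i> * of_real (Arg2pi w))"
    by (simp add: y_def to_complex_def Complex_eq)
  also have "\<dots> = of_real (exp (ln (cmod w))) * exp (\<i> * of_real (Arg2pi w))"
    by (simp only: exp_add exp_of_real)
  also have "\<dots> = w" using w Arg2pi_eq[of w] by simp
  finally have "poly p (to_complex x) = exp (to_complex y)" by (simp add: w_def)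
  from lift_surj[OF cell_strip[OF y] this] obtain z where "z \<in> base_fibre" "lift z (to_complex y) = to_complex x"
    by blast
  then show "x \<in> (\<Union>z\<in>base_fibre. lift2 z ` cell B)"
    using y by (auto simp: lift2_def intro!: bexI[of _ z] image_eqI[of _ _ y])
next
  fix z x assume z: "z \<in> base_fibre" and x: "x \<in> cell B"
  have "poly p (lift z (to_complex x)) = exp (to_complex x)"
    using poly_lift[OF z cell_strip[OF x]] .
  then show "lift2 z x \<in> sector B"
    using x by (simp add: sector_def lift2_def cell_def) (simp add: to_complex_def)
qed

lemma nn_integral_sector:
  fixes f :: "real^2 \<Rightarrow> ennreal"
  assumes B: "B \<in> sets borel" and f[measurable]: "f \<in> borel_measurable borel"
  shows "(\<integral>\<^sup>+x. f x * indicator (sector B) x \<partial>lborel)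
    = (\<Sum>z\<in>base_fibre. \<integral>\<^sup>+x. ennreal ((cmod (dlift z (to_complex x)))\<^sup>2) * f (lift2 z x) * indicator (cell B) x \<partial>lborel)"
proof -
  have cf: "(\<integral>\<^sup>+x. f x * indicator (lift2 z ` cell B) x \<partial>lborel)
      = (\<integral>\<^sup>+x. ennreal ((cmod (dlift z (to_complex x)))\<^sup>2) * f (lift2 z x) * indicator (cell B) x \<partial>lborel)"
    "lift2 z ` cell B \<in> sets lebesgue" if z: "z \<in> base_fibre" for z
  proof -
    have d: "(lift z has_field_derivative dlift z (to_complex x)) (at (to_complex x))" if "x \<in> cell B" for x
      using dlift[OF z cell_strip[OF that]] .
    have c: "continuous_on (cell B) (\<lambda>x. dlift z (to_complex x))"
      by (rule continuous_on_compose2[OF continuous_on_dlift[OF z]])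
        (auto intro!: continuous_intros cell_strip)
    show "(\<integral>\<^sup>+x. f x * indicator (lift2 z ` cell B) x \<partial>lborel)
      = (\<integral>\<^sup>+x. ennreal ((cmod (dlift z (to_complex x)))\<^sup>2) * f (lift2 z x) * indicator (cell B) x \<partial>lborel)"
      using nn_integral_conformal(1)[OF cell_sets[OF B] d c inj_on_lift_cell[OF z] f]
      unfolding lift2_def[abs_def] .
    show "lift2 z ` cell B \<in> sets lebesgue"
      using nn_integral_conformal(2)[OF cell_sets[OF B] d c inj_on_lift_cell[OF z] f]
      unfolding lift2_def[abs_def] .
  qed
  have "(\<integral>\<^sup>+x. f x * indicator (sector B) x \<partial>lebesgue)
      = (\<integral>\<^sup>+x. (\<Sum>z\<in>base_fibre. f x * indicator (lift2 z ` cell B) x) \<partial>lebesgue)"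
    unfolding sector_eq indicator_UN_disjoint[OF base_fibre_finite lift2_disjoint] sum_distrib_left ..
  also have "\<dots> = (\<Sum>z\<in>base_fibre. \<integral>\<^sup>+x. f x * indicator (lift2 z ` cell B) x \<partial>lebesgue)"
    using cf(2) by (intro nn_integral_sum borel_measurable_times_ennreal borel_measurable_indicator)
      (auto intro: measurable_completion)
  finally show ?thesis by (simp add: nn_integral_completion cf(1))
qed

lemma nn_integral_cell:
  fixes h :: "real^2 \<Rightarrow> real"
  assumes B: "B \<in> sets borel" and h: "continuous_on {x::real^2. x $ 1 \<in> I} h" "\<And>x. 0 \<le> h x"
  shows "(\<integral>\<^sup>+x. ennreal (h x) * indicator (cell B) x \<partial>lborel)
    = (\<integral>\<^sup>+s. ennreal (integral {0..2 * pi} (\<lambda>t. h (vector [s, t]))) * indicator (I \<inter> B) s \<partial>lborel)"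
   (is "?lhs = integral\<^sup>N lborel ?f")
   and "(\<lambda>s. ennreal (integral {0..2 * pi} (\<lambda>t. h (vector [s, t]))) * indicator (I \<inter> B) s) \<in> borel_measurable borel"
proof -
  have "(\<lambda>x. indicator (cell B) x *\<^sub>R h x) \<in> borel_measurable borel"
    by (intro borel_measurable_continuous_on_indicator cell_sets B continuous_on_subset[OF h(1)])
      (auto simp: cell_def)
  then have "(\<lambda>x. ennreal (indicator (cell B) x *\<^sub>R h x)) \<in> borel_measurable borel" by measurable
  also have "(\<lambda>x. ennreal (indicator (cell B) x *\<^sub>R h x)) = (\<lambda>x. ennreal (h x) * indicator (cell B) x)"
    by (auto simp: indicator_def)
  finally have meas: "(\<lambda>x. ennreal (h x) * indicator (cell B) x) \<in> borel_measurable borel" .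
  have inner: "(\<integral>\<^sup>+t. ennreal (h (vector [s, t])) * indicator (cell B) (vector [s, t]) \<partial>lborel) = ?f s" for s
  proof (cases "s \<in> I \<inter> B")
    case True
    have "continuous_on UNIV (\<lambda>t. h (vector [s, t]))"
    proof (rule continuous_on_compose2[OF h(1)])
      have eq: "vector [s, t] = of_complex (Complex s t)" for t by (simp add: of_complex_def)
      show "continuous_on UNIV (\<lambda>t::real. vector [s, t] :: real^2)"
        unfolding eq Complex_eq by (intro continuous_intros)
    qed (use True in auto)
    from nn_integral_half_open_continuous[OF this h(2), of "2 * pi"] True
    show ?thesis by (simp add: cell_def indicator_def of_bool_def cong: if_cong)
  qed (auto simp: cell_def indicator_def)
  show "?lhs = integral\<^sup>N lborel ?f"
    unfolding nn_integral_real2[OF meas] inner ..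
  show "?f \<in> borel_measurable borel"
    using borel_measurable_nn_integral_real2[OF meas] unfolding inner .
qed


text \<open>After substitution by the lifts the weighted mass becomes the unweighted mass of
  \<open>V\<close>, and the energy dominates that of the operator
  \<open>\<i> d/dt + \<alpha>\<close>. For each fixed \<open>s\<close> the inequality for the whole
  fibre applies; integrating over \<open>s\<close> finishes.\<close>

lemma sector_inequality:
  fixes v v1 v2 :: "real^2 \<Rightarrow> complex"
  assumes B: "B \<in> sets borel"
    and der: "\<And>x. (v has_derivative (\<lambda>h. (h $ 1) *\<^sub>R v1 x + (h $ 2) *\<^sub>R v2 x)) (at x)"
    and cont: "continuous_on UNIV v1" "continuous_on UNIV v2"
    and D0: "0 \<le> D"
    and D: "\<And>l. 0 < l \<Longrightarrow> l \<le> degree p \<Longrightarrow> D \<le> (dist_to_int (real l * \<alpha>) / real l)\<^sup>2"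
  shows "ennreal D * (\<integral>\<^sup>+x. ennreal (vortex_weight p v x) * indicator (sector B) x \<partial>lborel)
    \<le> (\<integral>\<^sup>+x. ennreal (vortex_energy p \<alpha> v v1 v2 x) * indicator (sector B) x \<partial>lborel)"
proof -
  define V where "V z x = v (lift2 z x)" for z x
  \<comment> \<open>The derivative of \<open>V\<close> in the second coordinate: there the lift
    moves in the direction \<open>\<i> * dlift\<close>, whose real and imaginary parts multiply the
    two partial derivatives of \<open>v\<close>.\<close>
  define V' where "V' z x = Re (\<i> * dlift z (to_complex x)) *\<^sub>R v1 (lift2 z x)
    + Im (\<i> * dlift z (to_complex x)) *\<^sub>R v2 (lift2 z x)" for z x
  define a where "a z s = integral {0..2 * pi} (\<lambda>t. (norm (V z (vector [s, t])))\<^sup>2)" for z s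
  define b where "b z s = integral {0..2 * pi} (\<lambda>t. (norm (\<i> * V' z (vector [s, t]) + \<alpha> * V z (vector [s, t])))\<^sup>2)" for z s
  have contv: "continuous_on UNIV v"
    using der has_derivative_continuous by (blast intro: continuous_at_imp_continuous_on)
  have meas: "v \<in> borel_measurable borel" "v1 \<in> borel_measurable borel" "v2 \<in> borel_measurable borel"
    using cont contv by (auto intro: borel_measurable_continuous_onI)
  have tc: "to_complex x \<in> strip" if "x $ 1 \<in> I" for x :: "real^2" using that by (simp add: strip_def to_complex_def)
  have c2: "continuous_on {x::real^2. x $ 1 \<in> I} (lift2 z)" if "z \<in> base_fibre" for z
    unfolding lift2_def
    by (intro continuous_intros continuous_on_compose2[OF continuous_on_lift[OF that]]) (auto simp: tc)
  have cd: "continuous_on {x::real^2. x $ 1 \<in> I} (\<lambda>x. dlift z (to_complex x))" if "z \<in> base_fibre" for z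
    by (intro continuous_on_compose2[OF continuous_on_dlift[OF that]] continuous_intros) (auto simp: tc)
  have cV: "continuous_on {x::real^2. x $ 1 \<in> I} (V z)" if "z \<in> base_fibre" for z
    unfolding V_def by (rule continuous_on_compose2[OF contv c2[OF that]]) auto
  have cV': "continuous_on {x::real^2. x $ 1 \<in> I} (V' z)" if "z \<in> base_fibre" for z
    unfolding V'_def
    by (intro continuous_intros cd that continuous_on_compose2[OF cont(1) c2[OF that]]
        continuous_on_compose2[OF cont(2) c2[OF that]]) auto
  have weight: "(cmod (dlift z (to_complex x)))\<^sup>2 * vortex_weight p v (lift2 z x) = (norm (V z x))\<^sup>2"
    if "z \<in> base_fibre" "x $ 1 \<in> I" for z and x :: "real^2"
  proof -
    have "cmod (dlift z (to_complex x)) * cmod (poly (pderiv p) (lift z (to_complex x)) / poly p (lift z (to_complex x))) = 1"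
      using dlift_log_derivative[OF that(1) tc[OF that(2)]] by (metis norm_mult norm_one)
    then show ?thesis
      by (simp add: vortex_weight_def V_def lift2_def power_mult_distrib[symmetric] mult.assoc[symmetric])
  qed
  have energy: "(norm (\<i> * V' z x + \<alpha> * V z x))\<^sup>2 \<le> (cmod (dlift z (to_complex x)))\<^sup>2 * vortex_energy p \<alpha> v v1 v2 (lift2 z x)"
    if "z \<in> base_fibre" "x $ 1 \<in> I" for z and x :: "real^2"
  proof -
    define l where "l = dlift z (to_complex x)"
    define q where "q = poly (pderiv p) (lift z (to_complex x)) / poly p (lift z (to_complex x))"
    define A where "A = vortex_field p \<alpha> (lift2 z x)"
    have lq: "l * q = 1" using dlift_log_derivative[OF that(1) tc[OF that(2)]] by (simp add: l_def q_def)
    have A: "A = \<alpha> * \<i> * cnj q" by (simp add: A_def vortex_field_def lift2_def q_def)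
    \<comment> \<open>The component of the field along the tangent \<open>\<i> * l\<close> is the
      constant \<alpha>, since \<open>arg p\<close> grows at unit rate in \<open>t\<close>.\<close>
    have "Re (\<i> * l) * Re A + Im (\<i> * l) * Im A = \<alpha> * Re (l * q)"
      by (simp add: A algebra_simps)
    then have "Re (\<i> * l) * Re A + Im (\<i> * l) * Im A = \<alpha>" by (simp add: lq)
    then have \<alpha>: "complex_of_real \<alpha> = of_real (Re (\<i> * l)) * of_real (Re A) + of_real (Im (\<i> * l)) * of_real (Im A)"
      by (metis of_real_add of_real_mult)
    have "\<i> * V' z x + \<alpha> * V z x = Re (\<i> * l) *\<^sub>R (\<i> * v1 (lift2 z x) + of_real (Re A) * v (lift2 z x))
       + Im (\<i> * l) *\<^sub>R (\<i> * v2 (lift2 z x) + of_real (Im A) * v (lift2 z x))"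
      unfolding V'_def V_def \<alpha> l_def[symmetric] scaleR_conv_of_real by (simp only: algebra_simps)
    also have "(norm \<dots>)\<^sup>2 \<le> ((Re (\<i> * l))\<^sup>2 + (Im (\<i> * l))\<^sup>2) * vortex_energy p \<alpha> v v1 v2 (lift2 z x)"
      unfolding vortex_energy_def A_def[symmetric] by (rule norm_scaleR_add_sq_le)
    also have "(Re (\<i> * l))\<^sup>2 + (Im (\<i> * l))\<^sup>2 = (cmod l)\<^sup>2"
      by (simp add: cmod_power2)
    finally show ?thesis by (simp add: l_def)
  qed
  have circle: "D * (\<Sum>z\<in>base_fibre. a z s) \<le> (\<Sum>z\<in>base_fibre. b z s)" if s: "s \<in> I" for s
  proof -
    have vec: "vector [s, t] = of_complex (of_real s + of_real t * \<i>)" for t :: real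
      by (simp add: of_complex_def)
    have tcv: "to_complex (vector [s, t]) = of_real s + of_real t * \<i>" for t :: real
      unfolding vec by simp
    have of_complex_nth: "of_complex w $ 1 = Re w" "of_complex w $ 2 = Im w" for w
      by (simp_all add: of_complex_def)
    have st: "of_real s + of_real t * \<i> \<in> strip" for t using s by (simp add: strip_def)
    have cvec: "continuous_on UNIV (\<lambda>t::real. vector [s, t] :: real^2)"
      unfolding vec by (intro continuous_intros)
    have lift2_shift: "lift2 z (vector [s, t + 2 * pi]) = lift2 (monodromy z) (vector [s, t])"
      if "z \<in> base_fibre" for z t
      using lift_period(2)[OF that st[of t]] unfolding vec by (simp add: lift2_def algebra_simps)
    have dlift_shift: "dlift z (of_real s + of_real (t + 2 * pi) * \<i>) = dlift (monodromy z) (of_real s + of_real t * \<i>)"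
      if "z \<in> base_fibre" for z t
    proof -
      have eq: "of_real s + of_real (t + 2 * pi) * \<i> = (of_real s + of_real t * \<i>) + 2 * of_real pi * \<i>"
        by (simp add: algebra_simps)
      show ?thesis using lift_period(2)[OF that st[of t]] unfolding eq by (simp add: dlift_def exp_add)
    qed
    have "D * (\<Sum>z\<in>base_fibre. integral {0..2 * pi} (\<lambda>t. (norm (V z (vector [s, t])))\<^sup>2))
      \<le> (\<Sum>z\<in>base_fibre. integral {0..2 * pi} (\<lambda>t. (norm (\<i> * V' z (vector [s, t]) + \<alpha> * V z (vector [s, t])))\<^sup>2))"
    proof (rule fibre_circle_inequality[where f = "\<lambda>z t. V z (vector [s, t])" and f' = "\<lambda>z t. V' z (vector [s, t])", OF _ _ _ _ D])
      fix z t assume z: "z \<in> base_fibre"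
      show "V z (vector [s, t + 2 * pi]) = V (monodromy z) (vector [s, t])"
        by (simp add: V_def lift2_shift[OF z])
      show "V' z (vector [s, t + 2 * pi]) = V' (monodromy z) (vector [s, t])"
        unfolding V'_def vec to_of_complex dlift_shift[OF z] lift2_shift[OF z, unfolded vec] ..
      show "continuous_on UNIV (\<lambda>t. V' z (vector [s, t]))"
        by (rule continuous_on_compose2[OF cV'[OF z] cvec]) (use s in auto)
      define l where "l = dlift z (of_real s + of_real t * \<i>)"
      have "((\<lambda>w. lift z (of_real s + w * \<i>)) has_field_derivative l * \<i>) (at (of_real t))"
        unfolding l_def
        by (rule DERIV_chain2[where f = "lift z" and g = "\<lambda>w. of_real s + w * \<i>", OF dlift[OF z st[of t]]])
          (auto intro!: derivative_eq_intros)
      from has_vector_derivative_real_field[OF this, of UNIV]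
      have "((\<lambda>t. lift z (of_real s + of_real t * \<i>)) has_vector_derivative \<i> * l) (at t)"
        by (simp add: mult.commute)
      from bounded_linear.has_vector_derivative[OF bounded_linear_of_complex this]
      have "((\<lambda>t. lift2 z (vector [s, t])) has_vector_derivative of_complex (\<i> * l)) (at t)"
        by (simp add: lift2_def vec)
      from vector_derivative_diff_chain_within[OF this has_derivative_at_withinI[OF der]]
      show "((\<lambda>t. V z (vector [s, t])) has_vector_derivative V' z (vector [s, t])) (at t)"
        by (simp add: V_def V'_def comp_def l_def tcv of_complex_nth)
    qed
    then show ?thesis by (simp add: a_def b_def)
  qed
  have sum_ennreal': "(\<Sum>z\<in>base_fibre. ennreal (c z s) * i) = ennreal (\<Sum>z\<in>base_fibre. c z s) * i"
    if "\<And>z. z \<in> base_fibre \<Longrightarrow> 0 \<le> c z s" for c :: "complex \<Rightarrow> real \<Rightarrow> real" and s i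
    using that by (simp add: sum_distrib_right[symmetric] sum_ennreal)
  \<comment> \<open>For a function that is not integrable the integral is 0 by convention, so the
    sign holds for every \<open>s\<close>, also outside \<open>I\<close>.\<close>
  have a0: "0 \<le> a z s" and b0: "0 \<le> b z s" for z s
    unfolding a_def b_def by (cases "(\<lambda>t. (norm (V z (vector [s, t])))\<^sup>2) integrable_on {0..2 * pi}";
      cases "(\<lambda>t. (norm (\<i> * V' z (vector [s, t]) + \<alpha> * V z (vector [s, t])))\<^sup>2) integrable_on {0..2 * pi}";
      simp add: Henstock_Kurzweil_Integration.integral_nonneg not_integrable_integral)+
  have "(\<integral>\<^sup>+x. ennreal (vortex_weight p v x) * indicator (sector B) x \<partial>lborel)
     = (\<Sum>z\<in>base_fibre. \<integral>\<^sup>+x. ennreal ((norm (V z x))\<^sup>2) * indicator (cell B) x \<partial>lborel)"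
    unfolding nn_integral_sector[OF B borel_measurable_vortex(2)[OF meas, THEN measurable_compose[OF _ measurable_ennreal]]]
    by (intro sum.cong nn_integral_cong refl)
      (auto simp: indicator_def cell_def weight[symmetric] ennreal_mult vortex_nonneg)
  also have "\<dots> = (\<Sum>z\<in>base_fibre. \<integral>\<^sup>+s. ennreal (a z s) * indicator (I \<inter> B) s \<partial>lborel)"
    unfolding a_def by (intro sum.cong refl nn_integral_cell(1) B) (auto intro!: continuous_intros cV)
  also have "\<dots> = (\<integral>\<^sup>+s. (\<Sum>z\<in>base_fibre. ennreal (a z s) * indicator (I \<inter> B) s) \<partial>lborel)"
    unfolding a_def by (subst nn_integral_sum) (auto intro!: nn_integral_cell(2) B continuous_intros cV)
  also have "\<dots> = (\<integral>\<^sup>+s. ennreal (\<Sum>z\<in>base_fibre. a z s) * indicator (I \<inter> B) s \<partial>lborel)"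
    using a0 by (simp add: sum_ennreal')
  finally have "ennreal D * (\<integral>\<^sup>+x. ennreal (vortex_weight p v x) * indicator (sector B) x \<partial>lborel)
     = (\<integral>\<^sup>+s. ennreal D * (ennreal (\<Sum>z\<in>base_fibre. a z s) * indicator (I \<inter> B) s) \<partial>lborel)"
  proof (simp, subst nn_integral_cmult)
    have "(\<lambda>s. \<Sum>z\<in>base_fibre. ennreal (a z s) * indicator (I \<inter> B) s) \<in> borel_measurable lborel"
      unfolding a_def by (intro borel_measurable_sum) (auto intro!: nn_integral_cell(2) B continuous_intros cV)
    then show "(\<lambda>s. ennreal (\<Sum>z\<in>base_fibre. a z s) * indicator (I \<inter> B) s) \<in> borel_measurable lborel"
      using a0 by (simp add: sum_ennreal')
  qed simp
  also have "\<dots> \<le> (\<integral>\<^sup>+s. ennreal (\<Sum>z\<in>base_fibre. b z s) * indicator (I \<inter> B) s \<partial>lborel)"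
    using circle D0
    by (intro nn_integral_mono) (auto simp: indicator_def ennreal_mult'[symmetric] intro!: ennreal_leI)
  also have "\<dots> = (\<integral>\<^sup>+s. (\<Sum>z\<in>base_fibre. ennreal (b z s) * indicator (I \<inter> B) s) \<partial>lborel)"
    using b0 by (simp add: sum_ennreal')
  also have "\<dots> = (\<Sum>z\<in>base_fibre. \<integral>\<^sup>+s. ennreal (b z s) * indicator (I \<inter> B) s \<partial>lborel)"
    unfolding b_def by (subst nn_integral_sum) (auto intro!: nn_integral_cell(2) B continuous_intros cV cV')
  also have "\<dots> = (\<Sum>z\<in>base_fibre. \<integral>\<^sup>+x. ennreal ((norm (\<i> * V' z x + \<alpha> * V z x))\<^sup>2) * indicator (cell B) x \<partial>lborel)"
    unfolding b_def by (intro sum.cong refl nn_integral_cell(1)[symmetric] B) (auto intro!: continuous_intros cV cV')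
  also have "\<dots> \<le> (\<integral>\<^sup>+x. ennreal (vortex_energy p \<alpha> v v1 v2 x) * indicator (sector B) x \<partial>lborel)"
    unfolding nn_integral_sector[OF B borel_measurable_vortex(1)[OF meas, THEN measurable_compose[OF _ measurable_ennreal]]]
    using energy
    by (intro sum_mono nn_integral_mono)
      (auto simp: indicator_def cell_def ennreal_mult''[symmetric] ennreal_mult'[symmetric] intro!: ennreal_leI)
  finally show ?thesis .
qed

end

section \<open>The vortex inequality in the plane\<close>

definition poly_sector :: "complex poly \<Rightarrow> real set \<Rightarrow> (real^2) set" where
  "poly_sector p B = {x. poly p (to_complex x) \<noteq> 0 \<and> ln (cmod (poly p (to_complex x))) \<in> B}"

lemma poly_sector_sets [measurable]:
  assumes [measurable]: "B \<in> sets borel" shows "poly_sector p B \<in> sets borel"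
proof -
  have [measurable]: "poly p \<in> borel_measurable borel"
    by (intro borel_measurable_continuous_onI continuous_intros)
  show ?thesis unfolding poly_sector_def by measurable
qed

text \<open>Removing the finitely many critical values of \<open>ln |p|\<close> leaves countably
  many open intervals, on each of which the regular case applies. The regions over them are disjoint
  and miss only a null set, so both integrals are sums over the intervals.\<close>

lemma poly_sector_inequality:
  fixes v v1 v2 :: "real^2 \<Rightarrow> complex"
  assumes deg: "0 < degree p" and B: "B \<in> sets borel"
    and der: "\<And>x. (v has_derivative (\<lambda>h. (h $ 1) *\<^sub>R v1 x + (h $ 2) *\<^sub>R v2 x)) (at x)"
    and cont: "continuous_on UNIV v1" "continuous_on UNIV v2"
    and D0: "0 \<le> D"
    and D: "\<And>l. 0 < l \<Longrightarrow> l \<le> degree p \<Longrightarrow> D \<le> (dist_to_int (real l * \<alpha>) / real l)\<^sup>2"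
  shows "ennreal D * (\<integral>\<^sup>+x. ennreal (vortex_weight p v x) * indicator (poly_sector p B) x \<partial>lborel)
    \<le> (\<integral>\<^sup>+x. ennreal (vortex_energy p \<alpha> v v1 v2 x) * indicator (poly_sector p B) x \<partial>lborel)"
proof -
  \<comment> \<open>A multiple root of \<open>p\<close> contributes the meaningless value
    \<open>ln 0\<close>. It only excludes one level more, and the set stays finite.\<close>
  define crit where "crit = (\<lambda>z. ln (cmod (poly p z))) ` {z. poly (pderiv p) z = 0}"
  define \<C> where "\<C> = components (- crit)"
  have "pderiv p \<noteq> 0" using deg by (simp add: pderiv_eq_0_iff)
  then have fin: "finite crit" unfolding crit_def by (intro finite_imageI poly_roots_finite)
  then have op: "open (- crit)" using finite_imp_closed by blast
  have count: "countable \<C>" unfolding \<C>_def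
    using op pairwise_disjoint_components by (intro countable_disjoint_open_subsets) (auto intro: open_components simp: pairwise_def disjnt_def)
  have U: "\<Union>\<C> = - crit" unfolding \<C>_def by (rule Union_components)
  have ann: "regular_annulus p I (SOME t. t \<in> I)" and opI: "open I" if I: "I \<in> \<C>" for I
  proof -
    show "open I" using I op open_components unfolding \<C>_def by blast
    have "connected I" using I in_components_connected unfolding \<C>_def by blast
    then have "convex I" using is_interval_connected_1 is_interval_convex_1 by blast
    moreover have "I \<noteq> {}" using I in_components_nonempty unfolding \<C>_def by blast
    moreover have "I \<subseteq> - crit" using I in_components_subset unfolding \<C>_def by blast
    ultimately show "regular_annulus p I (SOME t. t \<in> I)"
      using deg \<open>open I\<close> by unfold_locales (auto simp: crit_def some_in_eq)
  qed
  have meas: "v \<in> borel_measurable borel" "v1 \<in> borel_measurable borel" "v2 \<in> borel_measurable borel"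
    using der has_derivative_continuous cont
    by (auto intro!: borel_measurable_continuous_onI continuous_at_imp_continuous_on) blast
  note meas' = borel_measurable_vortex[OF meas]
  have sec: "regular_annulus.sector p I B = poly_sector p (I \<inter> B)" if "I \<in> \<C>" for I
    using regular_annulus.sector_def[OF ann[OF that]] by (simp add: poly_sector_def)
  have "AE x in lborel. \<forall>k\<in>crit. cmod (poly p (to_complex x)) \<noteq> exp k"
    using fin AE_poly_cmod_neq[OF deg] by (intro AE_finite_allI) auto
  then have AE: "AE x in lborel. x \<in> poly_sector p B \<longleftrightarrow> x \<in> (\<Union>I\<in>\<C>. poly_sector p (I \<inter> B))"
  proof eventually_elim
    case (elim x)
    show ?case
    proof
      assume x: "x \<in> poly_sector p B"
      then have "ln (cmod (poly p (to_complex x))) \<notin> crit"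
        using elim by (force simp: poly_sector_def)
      then obtain I where "I \<in> \<C>" "ln (cmod (poly p (to_complex x))) \<in> I" using U by blast
      then show "x \<in> (\<Union>I\<in>\<C>. poly_sector p (I \<inter> B))" using x by (auto simp: poly_sector_def)
    qed (auto simp: poly_sector_def)
  qed
  have split: "(\<integral>\<^sup>+x. f x * indicator (poly_sector p B) x \<partial>lborel)
      = (\<integral>\<^sup>+I. (\<integral>\<^sup>+x. f x * indicator (poly_sector p (I \<inter> B)) x \<partial>lborel) \<partial>count_space \<C>)"
    if [measurable]: "f \<in> borel_measurable borel" for f :: "real^2 \<Rightarrow> ennreal"
  proof -
    have sets: "poly_sector p (I \<inter> B) \<in> sets borel" if "I \<in> \<C>" for I
      using opI[OF that] B by (intro poly_sector_sets) auto
    have "(\<integral>\<^sup>+x. f x * indicator (poly_sector p B) x \<partial>lborel)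
      = (\<integral>\<^sup>+x. f x * indicator (\<Union>I\<in>\<C>. poly_sector p (I \<inter> B)) x \<partial>lborel)"
      by (rule nn_integral_cong_AE) (use AE in \<open>eventually_elim, auto simp: indicator_def\<close>)
    also have "\<dots> = emeasure (density lborel f) (\<Union>I\<in>\<C>. poly_sector p (I \<inter> B))"
      using sets count by (subst emeasure_density) (auto intro!: sets.countable_UN')
    also have "\<dots> = (\<integral>\<^sup>+I. emeasure (density lborel f) (poly_sector p (I \<inter> B)) \<partial>count_space \<C>)"
    proof (rule emeasure_UN_countable[OF _ count])
      show "disjoint_family_on (\<lambda>I. poly_sector p (I \<inter> B)) \<C>"
        unfolding disjoint_family_on_def
      proof (intro ballI impI)
        fix I J assume IJ: "I \<in> \<C>" "J \<in> \<C>" "I \<noteq> J"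
        then have "I \<inter> J = {}" using pairwise_disjoint_components[of "- crit"]
          unfolding \<C>_def pairwise_def by blast
        then show "poly_sector p (I \<inter> B) \<inter> poly_sector p (J \<inter> B) = {}" by (auto simp: poly_sector_def)
      qed
    qed (use sets in auto)
    also have "\<dots> = (\<integral>\<^sup>+I. (\<integral>\<^sup>+x. f x * indicator (poly_sector p (I \<inter> B)) x \<partial>lborel) \<partial>count_space \<C>)"
      using sets by (intro nn_integral_cong) (auto simp: emeasure_density)
    finally show ?thesis .
  qed
  have "ennreal D * (\<integral>\<^sup>+x. ennreal (vortex_weight p v x) * indicator (poly_sector p B) x \<partial>lborel)
    = (\<integral>\<^sup>+I. ennreal D * (\<integral>\<^sup>+x. ennreal (vortex_weight p v x) * indicator (poly_sector p (I \<inter> B)) x \<partial>lborel) \<partial>count_space \<C>)"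
    using meas' by (subst split) (auto simp: nn_integral_cmult)
  also have "\<dots> \<le> (\<integral>\<^sup>+I. (\<integral>\<^sup>+x. ennreal (vortex_energy p \<alpha> v v1 v2 x) * indicator (poly_sector p (I \<inter> B)) x \<partial>lborel) \<partial>count_space \<C>)"
    using regular_annulus.sector_inequality[OF ann B der cont D0 D]
    by (intro nn_integral_mono) (simp add: sec)
  also have "\<dots> = (\<integral>\<^sup>+x. ennreal (vortex_energy p \<alpha> v v1 v2 x) * indicator (poly_sector p B) x \<partial>lborel)"
    using meas' by (subst split) auto
  finally show ?thesis .
qed

section \<open>From C^1 functions to their limits in square mean\<close>

lemma norm_add_sq_le:
  fixes a b :: "'a::real_normed_vector"
  assumes "0 < \<delta>"
  shows "(norm (a + b))\<^sup>2 \<le> (1 + \<delta>) * (norm a)\<^sup>2 + (1 + 1 / \<delta>) * (norm b)\<^sup>2"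
proof -
  have "(norm (a + b))\<^sup>2 \<le> (norm a + norm b)\<^sup>2" by (intro power_mono norm_triangle_ineq) auto
  also have "\<dots> \<le> (norm a)\<^sup>2 + (norm b)\<^sup>2 + (\<delta> * (norm a)\<^sup>2 + 1 / \<delta> * (norm b)\<^sup>2)"
  proof -
    have "0 \<le> (\<delta> * norm a - norm b)\<^sup>2 / \<delta>" using assms by simp
    also have "\<dots> = \<delta> * (norm a)\<^sup>2 + 1 / \<delta> * (norm b)\<^sup>2 - 2 * norm a * norm b"
      using assms by (simp add: power2_eq_square field_simps)
    finally show ?thesis by (simp add: power2_sum)
  qed
  finally show ?thesis by (simp add: algebra_simps)
qed

text \<open>Errors are absorbed with a factor \<open>1 + \<delta>\<close> once for the weight and
  once for the energy. Letting \<delta> tend to 0 afterwards leaves the constant in the inequality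
  unchanged.\<close>

lemma ennreal_le_of_perturbation:
  assumes "\<And>\<delta>. 0 < \<delta> \<Longrightarrow> x \<le> ennreal ((1 + \<delta>)\<^sup>2) * y"
  shows "x \<le> y"
proof (rule ennreal_le_epsilon)
  fix e :: real assume y: "y < top" and e: "0 < e"
  then obtain r where r: "y = ennreal r" "0 \<le> r" by (cases y) auto
  \<comment> \<open>For \<open>\<delta> \<le> 1\<close> one has
    \<open>(1 + \<delta>)^2 * r \<le> r + 3 * \<delta> * r\<close>; the 1 in the denominator
    provides for \<open>r = 0\<close>.\<close>
  define \<delta> where "\<delta> = min 1 (e / (3 * r + 1))"
  have "\<delta> \<le> e / (3 * r + 1)" by (simp add: \<delta>_def)
  then have "\<delta> * (3 * r + 1) \<le> e" using r by (simp add: pos_le_divide_eq)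
  then have d: "0 < \<delta>" "\<delta> \<le> 1" "\<delta> * (3 * r + 1) \<le> e" using e r
    by (auto simp: \<delta>_def)
  have "\<delta> * (\<delta> * r) \<le> 1 * (\<delta> * r)" using d r by (intro mult_right_mono) auto
  moreover have "(1 + \<delta>)\<^sup>2 * r = r + 2 * (\<delta> * r) + \<delta> * (\<delta> * r)"
    by (simp add: power2_eq_square algebra_simps)
  moreover have "\<delta> * (3 * r + 1) = 3 * (\<delta> * r) + \<delta>" by (simp add: algebra_simps)
  ultimately have "(1 + \<delta>)\<^sup>2 * r \<le> r + e" using d by linarith
  then have "ennreal ((1 + \<delta>)\<^sup>2) * y \<le> ennreal (r + e)"
    using r by (simp add: ennreal_mult[symmetric] ennreal_leI)
  then show "x \<le> y + ennreal e" using assms[OF d(1)] r e by (simp add: order_trans)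
qed

text \<open>A nonconstant polynomial tends to infinity, so the region is compact, and the lower
  bound on \<open>|p|\<close> keeps it away from the zeros.\<close>

lemma log_derivative_bounded_on_sector:
  fixes p :: "complex poly"
  assumes deg: "0 < degree p"
  obtains K where "0 \<le> K" "\<And>x. x \<in> poly_sector p {c..d} \<Longrightarrow>
    cmod (poly (pderiv p) (to_complex x) / poly p (to_complex x)) \<le> K"
proof -
  define C where "C = {z. exp c \<le> cmod (poly p z) \<and> cmod (poly p z) \<le> exp d}"
  have "closed C"
    unfolding C_def Collect_conj_eq by (intro closed_Int closed_Collect_le continuous_intros)
  moreover have "bounded C"
  proof -
    obtain a q where p: "p = pCons a q" by (cases p)
    then have "q \<noteq> 0" using deg by auto
    from poly_infinity[OF this, of "exp d + 1" a] obtain r where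
      r: "\<And>z. r \<le> cmod z \<Longrightarrow> exp d + 1 \<le> cmod (poly p z)" by (auto simp: p)
    have "cmod z \<le> r" if "z \<in> C" for z
      using that r[of z] by (force simp: C_def)
    then show ?thesis by (auto simp: bounded_iff)
  qed
  ultimately have "compact C" by (simp add: compact_eq_bounded_closed)
  moreover have "continuous_on C (\<lambda>z. poly (pderiv p) z / poly p z)"
    by (intro continuous_intros) (auto simp: C_def)
  ultimately have "bounded ((\<lambda>z. poly (pderiv p) z / poly p z) ` C)"
    by (intro compact_imp_bounded compact_continuous_image)
  then obtain K where K: "\<And>z. z \<in> C \<Longrightarrow> cmod (poly (pderiv p) z / poly p z) \<le> K"
    unfolding bounded_iff by blast
  show ?thesis
  proof (rule that[of "max 0 K"])
    fix x assume x: "x \<in> poly_sector p {c..d}"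
    define t where "t = ln (cmod (poly p (to_complex x)))"
    have "cmod (poly p (to_complex x)) = exp t" "c \<le> t" "t \<le> d"
      using x by (simp_all add: t_def poly_sector_def)
    then have "to_complex x \<in> C" by (simp add: C_def)
    from K[OF this] show "cmod (poly (pderiv p) (to_complex x) / poly p (to_complex x)) \<le> max 0 K" by simp
  qed simp
qed

text \<open>Here \<open>w1\<close> and \<open>w2\<close> play the role of weak partial derivatives.
  The definition speaks only of differences in square mean and therefore passes to slices by Fubini,
  without test functions.\<close>

definition C1_approximable :: "(real^2 \<Rightarrow> complex) \<Rightarrow> (real^2 \<Rightarrow> complex) \<Rightarrow> (real^2 \<Rightarrow> complex) \<Rightarrow> bool" where
  "C1_approximable v w1 w2 \<longleftrightarrow> (\<forall>\<epsilon>>0. \<exists>u u1 u2.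
     (\<forall>x. (u has_derivative (\<lambda>h. (h $ 1) *\<^sub>R u1 x + (h $ 2) *\<^sub>R u2 x)) (at x)) \<and>
     continuous_on UNIV u1 \<and> continuous_on UNIV u2 \<and>
     (\<integral>\<^sup>+x. ennreal ((norm (u x - v x))\<^sup>2 + (norm (u1 x - w1 x))\<^sup>2 + (norm (u2 x - w2 x))\<^sup>2) \<partial>lborel) < ennreal \<epsilon>)"

text \<open>On a region \<open>c \<le> ln |p| \<le> d\<close> both field and weight are bounded by a
  multiple of \<open>K\<close>, so closeness in square mean controls the errors of both sides. The
  full inequality follows by monotone convergence.\<close>

lemma vortex_inequality:
  fixes v w1 w2 :: "real^2 \<Rightarrow> complex"
  assumes deg: "0 < degree p"
    and meas [measurable]: "v \<in> borel_measurable borel" "w1 \<in> borel_measurable borel" "w2 \<in> borel_measurable borel"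
    and approx: "C1_approximable v w1 w2"
    and D0: "0 \<le> D"
    and D: "\<And>l. 0 < l \<Longrightarrow> l \<le> degree p \<Longrightarrow> D \<le> (dist_to_int (real l * \<alpha>) / real l)\<^sup>2"
  shows "ennreal D * (\<integral>\<^sup>+x. ennreal (vortex_weight p v x) \<partial>lborel)
    \<le> (\<integral>\<^sup>+x. ennreal (vortex_energy p \<alpha> v w1 w2 x) \<partial>lborel)"
proof -
  note [measurable] = borel_measurable_vortex[OF meas]
  have bound: "ennreal D * (\<integral>\<^sup>+x. ennreal (vortex_weight p v x) * indicator (poly_sector p {c..d}) x \<partial>lborel)
    \<le> (\<integral>\<^sup>+x. ennreal (vortex_energy p \<alpha> v w1 w2 x) \<partial>lborel)" (is "_ * ?W \<le> ?E") for c d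
  proof (rule ennreal_le_of_perturbation, rule ennreal_le_epsilon)
    fix \<delta> e :: real assume \<delta>: "0 < \<delta>" and e: "0 < e"
    obtain K where K: "0 \<le> K" "\<And>x. x \<in> poly_sector p {c..d} \<Longrightarrow>
        cmod (poly (pderiv p) (to_complex x) / poly p (to_complex x)) \<le> K"
      using log_derivative_bounded_on_sector[OF deg] by metis
    \<comment> \<open>The total coefficient with which the squared distance \<open>G\<close> enters
      once the errors of weight and energy are combined; a distance below \<open>e / C\<close> makes
      the total error at most \<open>e\<close>.\<close>
    define C where "C = D * ((1 + 1 / \<delta>) * K\<^sup>2) + (1 + \<delta>) * ((1 + 1 / \<delta>) * (2 * (1 + \<alpha>\<^sup>2 * K\<^sup>2)))"
    have "0 < 1 + 1 / \<delta>" "0 < 1 + \<alpha>\<^sup>2 * K\<^sup>2" using \<delta> by (simp_all add: add_pos_nonneg)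
    moreover have "0 < 1 + \<delta>" using \<delta> by simp
    ultimately have "0 < (1 + \<delta>) * ((1 + 1 / \<delta>) * (2 * (1 + \<alpha>\<^sup>2 * K\<^sup>2)))"
      by (simp only: mult_pos_pos zero_less_numeral)
    moreover have "0 \<le> D * ((1 + 1 / \<delta>) * K\<^sup>2)" using \<delta> D0 by simp
    ultimately have C: "0 < C" unfolding C_def by linarith
    obtain u u1 u2 where der: "\<And>x. (u has_derivative (\<lambda>h. (h $ 1) *\<^sub>R u1 x + (h $ 2) *\<^sub>R u2 x)) (at x)"
      and cont: "continuous_on UNIV u1" "continuous_on UNIV u2"
      and less: "(\<integral>\<^sup>+x. ennreal ((norm (u x - v x))\<^sup>2 + (norm (u1 x - w1 x))\<^sup>2 + (norm (u2 x - w2 x))\<^sup>2) \<partial>lborel) < ennreal (e / C)"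
      using approx C e unfolding C1_approximable_def by (meson divide_pos_pos)
    have mu [measurable]: "u \<in> borel_measurable borel" "u1 \<in> borel_measurable borel" "u2 \<in> borel_measurable borel"
      using der has_derivative_continuous cont
      by (auto intro!: borel_measurable_continuous_onI continuous_at_imp_continuous_on) blast
    note [measurable] = borel_measurable_vortex[OF mu]
    define S where "S = poly_sector p {c..d}"
    have [measurable]: "S \<in> sets borel" unfolding S_def by measurable
    define g where "g x = (norm (u x - v x))\<^sup>2 + (norm (u1 x - w1 x))\<^sup>2 + (norm (u2 x - w2 x))\<^sup>2" for x
    have g0: "0 \<le> g x" for x by (simp add: g_def)
    have [measurable]: "g \<in> borel_measurable borel" unfolding g_def by measurable
    have pw: "vortex_weight p v x \<le> (1 + \<delta>) * vortex_weight p u x + (1 + 1 / \<delta>) * K\<^sup>2 * g x" if "x \<in> S" for x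
    proof -
      define q where "q = cmod (poly (pderiv p) (to_complex x) / poly p (to_complex x))"
      have q: "0 \<le> q" "q \<le> K" using K(2) that by (auto simp: q_def S_def)
      have "(norm (v x))\<^sup>2 \<le> (1 + \<delta>) * (norm (u x))\<^sup>2 + (1 + 1 / \<delta>) * (norm (u x - v x))\<^sup>2"
        using norm_add_sq_le[OF \<delta>, of "u x" "v x - u x"] by (simp add: norm_minus_commute)
      from mult_left_mono[OF this, of "q\<^sup>2"]
      have "vortex_weight p v x \<le> (1 + \<delta>) * vortex_weight p u x + (1 + 1 / \<delta>) * (q\<^sup>2 * (norm (u x - v x))\<^sup>2)"
        by (simp add: vortex_weight_def q_def[symmetric] algebra_simps)
      moreover have "q\<^sup>2 * (norm (u x - v x))\<^sup>2 \<le> K\<^sup>2 * g x"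
        using q by (intro mult_mono power_mono) (auto simp: g_def)
      then have "(1 + 1 / \<delta>) * (q\<^sup>2 * (norm (u x - v x))\<^sup>2) \<le> (1 + 1 / \<delta>) * (K\<^sup>2 * g x)"
        using \<delta> by (intro mult_left_mono) auto
      ultimately show ?thesis by (simp add: mult.assoc)
    qed
    have pe: "vortex_energy p \<alpha> u u1 u2 x \<le> (1 + \<delta>) * vortex_energy p \<alpha> v w1 w2 x + (1 + 1 / \<delta>) * (2 * (1 + \<alpha>\<^sup>2 * K\<^sup>2)) * g x"
      if "x \<in> S" for x
    proof -
      define A where "A = vortex_field p \<alpha> x"
      have "cmod A \<le> \<bar>\<alpha>\<bar> * K"
        using mult_left_mono[OF K(2)[of x], of "\<bar>\<alpha>\<bar>"] that
        by (simp add: A_def vortex_field_def norm_mult norm_divide S_def)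
      then have "(cmod A)\<^sup>2 \<le> (\<bar>\<alpha>\<bar> * K)\<^sup>2" by (intro power_mono) auto
      then have A: "(Re A)\<^sup>2 + (Im A)\<^sup>2 \<le> \<alpha>\<^sup>2 * K\<^sup>2" by (simp add: cmod_power2 power_mult_distrib)
      \<comment> \<open>One component of the magnetic gradient. The parameter \<delta> separates the
        limit from the error, and a factor 2 splits the error into that of the derivative and that
        of the function.\<close>
      have one: "(norm (\<i> * a' + of_real r * b'))\<^sup>2 \<le> (1 + \<delta>) * (norm (\<i> * a + of_real r * b))\<^sup>2
          + (1 + 1 / \<delta>) * (2 * (norm (a' - a))\<^sup>2 + 2 * (r\<^sup>2 * (norm (b' - b))\<^sup>2))" for a a' b b' :: complex and r :: real
      proof -
        have "(norm (\<i> * a' + of_real r * b'))\<^sup>2 \<le> (1 + \<delta>) * (norm (\<i> * a + of_real r * b))\<^sup>2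
          + (1 + 1 / \<delta>) * (norm (\<i> * (a' - a) + of_real r * (b' - b)))\<^sup>2"
          using norm_add_sq_le[OF \<delta>, of "\<i> * a + of_real r * b" "\<i> * (a' - a) + of_real r * (b' - b)"]
          by (simp add: algebra_simps)
        moreover have "(norm (\<i> * (a' - a) + of_real r * (b' - b)))\<^sup>2 \<le> 2 * (norm (a' - a))\<^sup>2 + 2 * (r\<^sup>2 * (norm (b' - b))\<^sup>2)"
          using norm_add_sq_le[of 1 "\<i> * (a' - a)" "of_real r * (b' - b)"]
          by (simp add: norm_mult power_mult_distrib)
        then have "(1 + 1 / \<delta>) * (norm (\<i> * (a' - a) + of_real r * (b' - b)))\<^sup>2 \<le> (1 + 1 / \<delta>) * (2 * (norm (a' - a))\<^sup>2 + 2 * (r\<^sup>2 * (norm (b' - b))\<^sup>2))"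
          using \<delta> by (intro mult_left_mono) auto
        ultimately show ?thesis by linarith
      qed
      define nu where "nu = (norm (u x - v x))\<^sup>2"
      define n1 where "n1 = (norm (u1 x - w1 x))\<^sup>2"
      define n2 where "n2 = (norm (u2 x - w2 x))\<^sup>2"
      have nn: "0 \<le> nu" "0 \<le> n1" "0 \<le> n2" by (auto simp: nu_def n1_def n2_def)
      have "vortex_energy p \<alpha> u u1 u2 x \<le> (1 + \<delta>) * vortex_energy p \<alpha> v w1 w2 x
         + (1 + 1 / \<delta>) * (2 * n1 + 2 * n2 + 2 * (((Re A)\<^sup>2 + (Im A)\<^sup>2) * nu))"
        using add_mono[OF one[of "u1 x" "Re A" "u x" "w1 x" "v x"] one[of "u2 x" "Im A" "u x" "w2 x" "v x"]]
        unfolding vortex_energy_def A_def[symmetric] n1_def[symmetric] n2_def[symmetric] nu_def[symmetric]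
        by (simp add: algebra_simps)
      moreover have "2 * n1 + 2 * n2 + 2 * (((Re A)\<^sup>2 + (Im A)\<^sup>2) * nu) \<le> 2 * (1 + \<alpha>\<^sup>2 * K\<^sup>2) * g x"
      proof -
        have "((Re A)\<^sup>2 + (Im A)\<^sup>2) * nu \<le> \<alpha>\<^sup>2 * K\<^sup>2 * nu" using A nn by (intro mult_right_mono) auto
        moreover have "0 \<le> \<alpha>\<^sup>2 * K\<^sup>2 * n1" "0 \<le> \<alpha>\<^sup>2 * K\<^sup>2 * n2" using nn by auto
        moreover have "2 * (1 + \<alpha>\<^sup>2 * K\<^sup>2) * g x
            = 2 * (nu + n1 + n2) + 2 * (\<alpha>\<^sup>2 * K\<^sup>2 * nu) + 2 * (\<alpha>\<^sup>2 * K\<^sup>2 * n1) + 2 * (\<alpha>\<^sup>2 * K\<^sup>2 * n2)"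
          unfolding g_def nu_def[symmetric] n1_def[symmetric] n2_def[symmetric] by (simp add: algebra_simps)
        moreover have "2 * n1 + 2 * n2 + 2 * Y \<le> Z" if "Y \<le> k" "0 \<le> k1" "0 \<le> k2"
          "Z = 2 * (nu + n1 + n2) + 2 * k + 2 * k1 + 2 * k2" for Y Z k k1 k2 :: real
          unfolding that(4) using that(1-3) nn by (simp add: distrib_left)
        ultimately show ?thesis by blast
      qed
      then have "(1 + 1 / \<delta>) * (2 * n1 + 2 * n2 + 2 * (((Re A)\<^sup>2 + (Im A)\<^sup>2) * nu)) \<le> (1 + 1 / \<delta>) * (2 * (1 + \<alpha>\<^sup>2 * K\<^sup>2) * g x)"
        using \<delta> by (intro mult_left_mono) auto
      ultimately show ?thesis by (simp add: mult.assoc)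
    qed
    have lin: "(\<integral>\<^sup>+x. ennreal (a * f x + b * g x) * indicator S x \<partial>lborel)
       \<le> ennreal a * (\<integral>\<^sup>+x. ennreal (f x) * indicator S x \<partial>lborel) + ennreal b * (\<integral>\<^sup>+x. ennreal (g x) \<partial>lborel)"
      if [measurable]: "f \<in> borel_measurable borel" and "0 \<le> a" "0 \<le> b" "\<And>x. 0 \<le> f x" for a b f
    proof -
      have "(\<integral>\<^sup>+x. ennreal (a * f x + b * g x) * indicator S x \<partial>lborel)
        \<le> (\<integral>\<^sup>+x. ennreal a * (ennreal (f x) * indicator S x) + ennreal b * ennreal (g x) \<partial>lborel)"
        using that(2-4) g0
        by (intro nn_integral_mono) (auto simp: indicator_def ennreal_plus ennreal_mult)
      also have "\<dots> = ennreal a * (\<integral>\<^sup>+x. ennreal (f x) * indicator S x \<partial>lborel) + ennreal b * (\<integral>\<^sup>+x. ennreal (g x) \<partial>lborel)"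
        by (simp add: nn_integral_add nn_integral_cmult)
      finally show ?thesis .
    qed
    define G where "G = (\<integral>\<^sup>+x. ennreal (g x) \<partial>lborel)"
    define Wu where "Wu = (\<integral>\<^sup>+x. ennreal (vortex_weight p u x) * indicator S x \<partial>lborel)"
    define Eu where "Eu = (\<integral>\<^sup>+x. ennreal (vortex_energy p \<alpha> u u1 u2 x) * indicator S x \<partial>lborel)"
    define E where "E = (\<integral>\<^sup>+x. ennreal (vortex_energy p \<alpha> v w1 w2 x) * indicator S x \<partial>lborel)"
    have "?W \<le> (\<integral>\<^sup>+x. ennreal ((1 + \<delta>) * vortex_weight p u x + (1 + 1 / \<delta>) * K\<^sup>2 * g x) * indicator S x \<partial>lborel)"
      using pw by (intro nn_integral_mono) (auto simp: S_def[symmetric] indicator_def intro: ennreal_leI)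
    also have "\<dots> \<le> ennreal (1 + \<delta>) * Wu + ennreal ((1 + 1 / \<delta>) * K\<^sup>2) * G"
      unfolding Wu_def G_def using \<delta> by (intro lin) (auto simp: vortex_nonneg)
    finally have W: "?W \<le> ennreal (1 + \<delta>) * Wu + ennreal ((1 + 1 / \<delta>) * K\<^sup>2) * G" .
    have "Eu \<le> (\<integral>\<^sup>+x. ennreal ((1 + \<delta>) * vortex_energy p \<alpha> v w1 w2 x + (1 + 1 / \<delta>) * (2 * (1 + \<alpha>\<^sup>2 * K\<^sup>2)) * g x) * indicator S x \<partial>lborel)"
      unfolding Eu_def using pe by (intro nn_integral_mono) (auto simp: indicator_def intro: ennreal_leI)
    also have "\<dots> \<le> ennreal (1 + \<delta>) * E + ennreal ((1 + 1 / \<delta>) * (2 * (1 + \<alpha>\<^sup>2 * K\<^sup>2))) * G"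
      unfolding E_def G_def using \<delta> by (intro lin) (auto simp: vortex_nonneg)
    finally have Eu: "Eu \<le> ennreal (1 + \<delta>) * E + ennreal ((1 + 1 / \<delta>) * (2 * (1 + \<alpha>\<^sup>2 * K\<^sup>2))) * G" .
    have "ennreal D * Wu \<le> Eu"
      unfolding Wu_def Eu_def S_def by (rule poly_sector_inequality[OF deg _ der cont D0 D]) auto
    have "ennreal D * ?W \<le> ennreal D * (ennreal (1 + \<delta>) * Wu + ennreal ((1 + 1 / \<delta>) * K\<^sup>2) * G)"
      by (intro mult_left_mono W) auto
    also have "\<dots> = ennreal (1 + \<delta>) * (ennreal D * Wu) + ennreal D * (ennreal ((1 + 1 / \<delta>) * K\<^sup>2) * G)"
      by (simp add: algebra_simps)
    also have "\<dots> \<le> ennreal (1 + \<delta>) * (ennreal (1 + \<delta>) * E + ennreal ((1 + 1 / \<delta>) * (2 * (1 + \<alpha>\<^sup>2 * K\<^sup>2))) * G)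
        + ennreal D * (ennreal ((1 + 1 / \<delta>) * K\<^sup>2) * G)"
      using \<open>ennreal D * Wu \<le> Eu\<close> Eu by (intro add_mono mult_left_mono order_refl) auto
    also have "\<dots> = (ennreal (1 + \<delta>) * ennreal (1 + \<delta>)) * E
        + (ennreal (1 + \<delta>) * ennreal ((1 + 1 / \<delta>) * (2 * (1 + \<alpha>\<^sup>2 * K\<^sup>2))) + ennreal D * ennreal ((1 + 1 / \<delta>) * K\<^sup>2)) * G"
      by (simp add: algebra_simps)
    also have "ennreal (1 + \<delta>) * ennreal (1 + \<delta>) = ennreal ((1 + \<delta>)\<^sup>2)"
      unfolding power2_eq_square using \<delta> by (intro ennreal_mult[symmetric]) auto
    also have "ennreal (1 + \<delta>) * ennreal ((1 + 1 / \<delta>) * (2 * (1 + \<alpha>\<^sup>2 * K\<^sup>2))) + ennreal D * ennreal ((1 + 1 / \<delta>) * K\<^sup>2) = ennreal C"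
      unfolding C_def using \<delta> D0
      by (subst add.commute, subst ennreal_plus) (auto simp: ennreal_mult)
    also have "ennreal ((1 + \<delta>)\<^sup>2) * E + ennreal C * G \<le> ennreal ((1 + \<delta>)\<^sup>2) * ?E + ennreal C * ennreal (e / C)"
    proof (intro add_mono mult_left_mono)
      show "E \<le> ?E" unfolding E_def by (intro nn_integral_mono) (auto simp: indicator_def)
      show "G \<le> ennreal (e / C)" using less by (simp add: G_def g_def)
    qed auto
    also have "ennreal C * ennreal (e / C) = ennreal e"
      using C e by (simp add: ennreal_mult[symmetric])
    finally show "ennreal D * ?W \<le> ennreal ((1 + \<delta>)\<^sup>2) * ?E + ennreal e" .
  qed
  \<comment> \<open>The regions exhaust the complement of the zeros of \<open>p\<close>; at the
    zeros the weight is 0 because of the division by 0.\<close>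
  define f where "f n x = ennreal (vortex_weight p v x) * indicator (poly_sector p {- real n..real n}) x" for n x
  have "(\<integral>\<^sup>+x. ennreal (vortex_weight p v x) \<partial>lborel) = (\<integral>\<^sup>+x. (SUP n. f n x) \<partial>lborel)"
  proof (rule nn_integral_cong)
    fix x
    show "ennreal (vortex_weight p v x) = (SUP n. f n x)"
    proof (cases "poly p (to_complex x) = 0")
      case True
      then show ?thesis by (simp add: f_def vortex_weight_def)
    next
      case False
      obtain n where "\<bar>ln (cmod (poly p (to_complex x)))\<bar> \<le> real n" using real_arch_simple by blast
      then have "x \<in> poly_sector p {- real n..real n}" using False by (auto simp: poly_sector_def)
      then have "ennreal (vortex_weight p v x) = f n x" by (simp add: f_def)
      then show ?thesis
        by (intro antisym) (auto intro!: SUP_upper2[of n] SUP_least simp: f_def indicator_def)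
    qed
  qed
  also have "\<dots> = (SUP n. \<integral>\<^sup>+x. f n x \<partial>lborel)"
  proof (rule nn_integral_monotone_convergence_SUP)
    show "incseq f"
      by (auto simp: incseq_def le_fun_def f_def indicator_def poly_sector_def)
    show "f n \<in> borel_measurable lborel" for n unfolding f_def by measurable
  qed
  finally have "ennreal D * (\<integral>\<^sup>+x. ennreal (vortex_weight p v x) \<partial>lborel) = (SUP n. ennreal D * (\<integral>\<^sup>+x. f n x \<partial>lborel))"
    by (simp add: SUP_mult_left_ennreal)
  also have "\<dots> \<le> (\<integral>\<^sup>+x. ennreal (vortex_energy p \<alpha> v w1 w2 x) \<partial>lborel)"
    unfolding f_def by (intro SUP_least bound)
  finally show ?thesis .
qed

section \<open>Mollifiers\<close>

text \<open>The case \<open>k = 0\<close> is the usual smooth function that is flat at the origin.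
  The factor \<open>inverse t ^ k\<close> makes the family closed under differentiation up to linear
  combinations.\<close>

definition flat_exp :: "nat \<Rightarrow> real \<Rightarrow> real" where
  "flat_exp k t = (if 0 < t then inverse t ^ k / exp (inverse t) else 0)"

lemma flat_exp_tendsto_0: "(flat_exp k \<longlongrightarrow> 0) (at 0)"
proof (rule filterlim_split_at_real)
  have "((\<lambda>t. inverse t ^ k / exp (inverse t)) \<longlongrightarrow> 0) (at_right (0::real))"
    by (rule filterlim_compose[OF tendsto_power_div_exp_0 filterlim_inverse_at_top_right])
  then show "(flat_exp k \<longlongrightarrow> 0) (at_right 0)"
    by (rule Lim_transform_eventually)
      (auto simp: flat_exp_def eventually_at_right_less intro!: eventually_mono[OF eventually_at_right_less[of 0]])
  have "\<forall>\<^sub>F t in at_left 0. 0 = flat_exp k t"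
    by (rule eventually_mono[OF eventually_at_left_real[of "-1" 0]]) (auto simp: flat_exp_def)
  then show "(flat_exp k \<longlongrightarrow> 0) (at_left 0)"
    by (rule Lim_transform_eventually[OF tendsto_const])
qed

lemma flat_exp_derivative:
  "(flat_exp k has_real_derivative flat_exp (k + 2) t - real k * flat_exp (k + 1) t) (at t)"
proof -
  consider "t < 0" | "t = 0" | "0 < t" by linarith
  then show ?thesis
  proof cases
    case 1
    then have ev: "\<forall>\<^sub>F s in nhds t. flat_exp k s = 0"
      by (auto intro!: eventually_mono[OF eventually_nhds_in_open[of "{..<0}"]] simp: flat_exp_def)
    have "(flat_exp k has_real_derivative 0) (at t)"
      by (subst DERIV_cong_ev[OF refl ev refl]) simp
    moreover have "flat_exp (k + 2) t - real k * flat_exp (k + 1) t = 0"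
      using 1 by (simp add: flat_exp_def)
    ultimately show ?thesis by (simp only:)
  next
    case 2
    have zero: "flat_exp j 0 = 0" for j by (simp add: flat_exp_def)
    \<comment> \<open>Division by \<open>h\<close> raises the exponent by one, so the difference
      quotient at 0 is itself a member of the family and tends to 0.\<close>
    have "(flat_exp k (0 + h) - flat_exp k 0) / h = flat_exp (k + 1) h" for h
      by (simp add: flat_exp_def field_simps)
    then show ?thesis
      unfolding 2 DERIV_def using flat_exp_tendsto_0[of "k + 1"] by (simp only: zero mult_zero_right diff_zero)
  next
    case 3
    then have ev: "\<forall>\<^sub>F s in nhds t. flat_exp k s = inverse s ^ k * exp (- inverse s)"
      by (auto intro!: eventually_mono[OF eventually_nhds_in_open[of "{0<..}"]] simp: flat_exp_def exp_minus divide_inverse)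
    have "((\<lambda>s. inverse s ^ k * exp (- inverse s)) has_real_derivative
       real k * (- (inverse t * inverse t)) * inverse t ^ (k - 1) * exp (- inverse t)
         + exp (- inverse t) * (inverse t * inverse t) * inverse t ^ k) (at t)"
      using 3 by (auto intro!: derivative_eq_intros simp: algebra_simps)
    also have "real k * (- (inverse t * inverse t)) * inverse t ^ (k - 1) * exp (- inverse t)
         + exp (- inverse t) * (inverse t * inverse t) * inverse t ^ k
      = flat_exp (k + 2) t - real k * flat_exp (k + 1) t"
      using 3 by (cases k) (simp_all add: flat_exp_def exp_minus divide_inverse algebra_simps)
    finally have "((\<lambda>s. inverse s ^ k * exp (- inverse s)) has_real_derivative
       flat_exp (k + 2) t - real k * flat_exp (k + 1) t) (at t)" .
    then show ?thesis by (subst DERIV_cong_ev[OF refl ev refl])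
  qed
qed

text \<open>A class of functions that contains the mollifiers and is closed under directional derivatives,
  so that all its members are smooth.\<close>

inductive_set smooth_algebra :: "('a::euclidean_space \<Rightarrow> real) set" where
  const: "(\<lambda>x. c) \<in> smooth_algebra"
| inner: "(\<lambda>x. x \<bullet> b) \<in> smooth_algebra"
| add: "f \<in> smooth_algebra \<Longrightarrow> g \<in> smooth_algebra \<Longrightarrow> (\<lambda>x. f x + g x) \<in> smooth_algebra"
| mult: "f \<in> smooth_algebra \<Longrightarrow> g \<in> smooth_algebra \<Longrightarrow> (\<lambda>x. f x * g x) \<in> smooth_algebra"
| flat_exp: "f \<in> smooth_algebra \<Longrightarrow> (\<lambda>x. flat_exp k (f x)) \<in> smooth_algebra"

lemma smooth_algebra_derivative:
  "f \<in> smooth_algebra \<Longrightarrow> \<exists>f'. (\<forall>x. (f has_derivative f' x) (at x)) \<and> (\<forall>v. (\<lambda>x. f' x v) \<in> smooth_algebra)"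
proof (induction rule: smooth_algebra.induct)
  case (const c)
  show ?case
    by (rule exI[of _ "\<lambda>_ _. 0"]) (auto intro: smooth_algebra.const)
next
  case (inner b)
  show ?case
    by (rule exI[of _ "\<lambda>_ v. v \<bullet> b"]) (auto intro!: smooth_algebra.const derivative_eq_intros)
next
  case (add f g)
  then obtain f' g' where "\<forall>x. (f has_derivative f' x) (at x)" "\<forall>v. (\<lambda>x. f' x v) \<in> smooth_algebra"
    "\<forall>x. (g has_derivative g' x) (at x)" "\<forall>v. (\<lambda>x. g' x v) \<in> smooth_algebra" by blast
  then show ?case
    by (intro exI[of _ "\<lambda>x v. f' x v + g' x v"]) (auto intro!: smooth_algebra.add has_derivative_add)
next
  case (mult f g)
  then obtain f' g' where "\<forall>x. (f has_derivative f' x) (at x)" "\<forall>v. (\<lambda>x. f' x v) \<in> smooth_algebra"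
    "\<forall>x. (g has_derivative g' x) (at x)" "\<forall>v. (\<lambda>x. g' x v) \<in> smooth_algebra" by blast
  with mult.hyps show ?case
    by (intro exI[of _ "\<lambda>x v. f x * g' x v + f' x v * g x"])
      (auto intro!: smooth_algebra.add smooth_algebra.mult has_derivative_mult)
next
  case (flat_exp f k)
  then obtain f' where f': "\<forall>x. (f has_derivative f' x) (at x)" "\<forall>v. (\<lambda>x. f' x v) \<in> smooth_algebra" by blast
  define d where "d x = flat_exp (k + 2) (f x) + (- real k) * flat_exp (k + 1) (f x)" for x
  have "((\<lambda>x. flat_exp k (f x)) has_derivative (\<lambda>v. d x * f' x v)) (at x)" for x
    using has_derivative_compose[OF f'(1)[rule_format] flat_exp_derivative[unfolded has_field_derivative_def]]
    by (simp add: d_def)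
  moreover have "(\<lambda>x. d x * f' x v) \<in> smooth_algebra" for v
    unfolding d_def using flat_exp.hyps f'(2)
    by (intro smooth_algebra.mult smooth_algebra.add smooth_algebra.const smooth_algebra.flat_exp) auto
  ultimately show ?case by (intro exI[of _ "\<lambda>x v. d x * f' x v"]) simp
qed

lemma smooth_algebra_continuous: "f \<in> smooth_algebra \<Longrightarrow> continuous_on UNIV f"
  using smooth_algebra_derivative has_derivative_continuous
  by (blast intro: continuous_at_imp_continuous_on)

lemma smooth_algebra_C_k: "f \<in> smooth_algebra \<Longrightarrow> C_k n f"
proof (induction n arbitrary: f)
  case 0
  then show ?case by (simp add: smooth_algebra_continuous)
next
  case (Suc n)
  then obtain f' where f': "\<forall>x. (f has_derivative f' x) (at x)" "\<forall>v. (\<lambda>x. f' x v) \<in> smooth_algebra"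
    using smooth_algebra_derivative by blast
  then have "frechet_derivative f (at x) = f' x" for x
    using frechet_derivative_at by metis
  with f' Suc.IH show ?case by (auto simp: differentiable_def)
qed

lemma smooth_algebra_sum:
  "finite A \<Longrightarrow> (\<And>i. i \<in> A \<Longrightarrow> f i \<in> smooth_algebra) \<Longrightarrow> (\<lambda>x. \<Sum>i\<in>A. f i x) \<in> smooth_algebra"
  by (induction A rule: finite_induct) (auto intro: smooth_algebra.intros)

definition bump_mass :: "real \<Rightarrow> 'a::euclidean_space itself \<Rightarrow> real" where
  "bump_mass \<epsilon> _ = (LINT x|lborel. flat_exp 0 (\<epsilon>\<^sup>2 - (x::'a) \<bullet> x))"

definition mollifier :: "real \<Rightarrow> 'a::euclidean_space \<Rightarrow> real" where
  "mollifier \<epsilon> x = flat_exp 0 (\<epsilon>\<^sup>2 - x \<bullet> x) / bump_mass \<epsilon> TYPE('a)"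

text \<open>The squared distance is expanded into coordinates, which are among the generators of the
  class.\<close>

lemma translated_mollifier_smooth: "(\<lambda>x. mollifier \<epsilon> (y - x)) \<in> smooth_algebra"
proof -
  have "(y - x) \<bullet> (y - x) = (\<Sum>b\<in>Basis. (y \<bullet> b + (- 1) * (x \<bullet> b)) * (y \<bullet> b + (- 1) * (x \<bullet> b)))" for x
    by (subst euclidean_inner) (simp add: inner_diff_left)
  then have eq: "mollifier \<epsilon> (y - x) = inverse (bump_mass \<epsilon> TYPE('a)) * flat_exp 0 (\<epsilon>\<^sup>2 + (- 1) *
     (\<Sum>b\<in>Basis. (y \<bullet> b + (- 1) * (x \<bullet> b)) * (y \<bullet> b + (- 1) * (x \<bullet> b))))" for x
    by (simp add: mollifier_def divide_inverse mult.commute)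
  show ?thesis
    unfolding eq by (intro smooth_algebra.intros smooth_algebra_sum) auto
qed

lemma mollifier_smooth: "mollifier \<epsilon> \<in> smooth_algebra"
proof -
  have "mollifier \<epsilon> (0 - x) = mollifier \<epsilon> x" for x :: 'a by (simp add: mollifier_def)
  then show ?thesis using translated_mollifier_smooth[of \<epsilon> "0 :: 'a"] by simp
qed

lemma bump_pos_iff: "0 < \<epsilon> \<Longrightarrow> 0 < flat_exp 0 (\<epsilon>\<^sup>2 - x \<bullet> x) \<longleftrightarrow> norm x < \<epsilon>"
proof -
  assume "0 < \<epsilon>"
  then have "(norm x)\<^sup>2 < \<epsilon>\<^sup>2 \<longleftrightarrow> norm x < \<epsilon>"
    by (auto intro: power_strict_mono power2_less_imp_less)
  then show ?thesis by (simp add: flat_exp_def power2_norm_eq_inner)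
qed

lemma bump_nonneg: "0 \<le> flat_exp k t"
  by (simp add: flat_exp_def)

lemma integrable_bump: "integrable lborel (\<lambda>x::'a::euclidean_space. flat_exp 0 (\<epsilon>\<^sup>2 - x \<bullet> x))"
proof -
  have cont: "continuous_on UNIV (\<lambda>x::'a. flat_exp 0 (\<epsilon>\<^sup>2 - x \<bullet> x))"
  proof -
    have "continuous_on UNIV (flat_exp 0)"
      using flat_exp_derivative DERIV_isCont by (blast intro: continuous_at_imp_continuous_on)
    then show ?thesis by (rule continuous_on_compose2) (auto intro!: continuous_intros)
  qed
  have "integrable lborel (\<lambda>x::'a. indicator (cball 0 \<bar>\<epsilon>\<bar>) x *\<^sub>R flat_exp 0 (\<epsilon>\<^sup>2 - x \<bullet> x))"
    using cont by (intro borel_integrable_compact) (auto intro: continuous_on_subset)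
  also have "(\<lambda>x::'a. indicator (cball 0 \<bar>\<epsilon>\<bar>) x *\<^sub>R flat_exp 0 (\<epsilon>\<^sup>2 - x \<bullet> x)) = (\<lambda>x. flat_exp 0 (\<epsilon>\<^sup>2 - x \<bullet> x))"
  proof
    fix x :: 'a
    have "flat_exp 0 (\<epsilon>\<^sup>2 - x \<bullet> x) = 0" if "\<bar>\<epsilon>\<bar> < norm x"
      using power_mono[OF less_imp_le[OF that], of 2] by (simp add: flat_exp_def power2_norm_eq_inner)
    then show "indicator (cball 0 \<bar>\<epsilon>\<bar>) x *\<^sub>R flat_exp 0 (\<epsilon>\<^sup>2 - x \<bullet> x) = flat_exp 0 (\<epsilon>\<^sup>2 - x \<bullet> x)"
      by (auto simp: indicator_def not_le)
  qed
  finally show ?thesis .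
qed

lemma bump_mass_pos:
  assumes "0 < \<epsilon>"
  shows "0 < bump_mass \<epsilon> TYPE('a::euclidean_space)"
proof (rule ccontr)
  assume "\<not> 0 < bump_mass \<epsilon> TYPE('a)"
  moreover have "0 \<le> bump_mass \<epsilon> TYPE('a)"
    unfolding bump_mass_def by (intro integral_nonneg_AE) (auto simp: bump_nonneg)
  ultimately have "(LINT x|lborel. flat_exp 0 (\<epsilon>\<^sup>2 - (x::'a) \<bullet> x)) = 0" by (simp add: bump_mass_def)
  then have "AE x::'a in lborel. flat_exp 0 (\<epsilon>\<^sup>2 - x \<bullet> x) = 0"
    using integral_nonneg_eq_0_iff_AE[OF integrable_bump[of \<epsilon>, where 'a = 'a]] by (simp add: bump_nonneg)
  then have "AE x::'a in lborel. x \<notin> ball 0 \<epsilon>"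
    by eventually_elim (use bump_pos_iff[OF assms] in \<open>force\<close>)
  then have "ball (0::'a) \<epsilon> \<in> null_sets lborel" by (subst AE_iff_null_sets) auto
  then have "negligible (ball (0::'a) \<epsilon>)"
    by (simp add: negligible_iff_null_sets null_sets_completionI)
  then show False using open_not_negligible[of "ball (0::'a) \<epsilon>"] assms by simp
qed

lemma mollifier_nonneg: "0 < \<epsilon> \<Longrightarrow> 0 \<le> mollifier \<epsilon> (x::'a::euclidean_space)"
  using bump_mass_pos[of \<epsilon>, where 'a = 'a] by (simp add: mollifier_def bump_nonneg)

lemma mollifier_eq_0: "0 < \<epsilon> \<Longrightarrow> \<epsilon> \<le> norm x \<Longrightarrow> mollifier \<epsilon> (x::'a::euclidean_space) = 0"
  using bump_pos_iff[of \<epsilon> x] bump_nonneg[of 0 "\<epsilon>\<^sup>2 - x \<bullet> x"] by (simp add: mollifier_def)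

lemma integrable_mollifier: "integrable lborel (mollifier \<epsilon> :: 'a::euclidean_space \<Rightarrow> real)"
  unfolding mollifier_def[abs_def] by (rule integrable_divide_zero, rule integrable_bump)

lemma integral_mollifier: "0 < \<epsilon> \<Longrightarrow> (LINT x|lborel. mollifier \<epsilon> (x::'a::euclidean_space)) = 1"
  using bump_mass_pos[of \<epsilon>, where 'a = 'a] by (simp add: mollifier_def bump_mass_def)

lemma translated_mollifier_test_function:
  fixes y :: "'a::euclidean_space"
  assumes "0 < \<epsilon>"
  shows "(\<lambda>x. mollifier \<epsilon> (y - x)) \<in> test_functions"
proof -
  have "{x. mollifier \<epsilon> (y - x) \<noteq> 0} \<subseteq> cball y \<epsilon>"
    using mollifier_eq_0[OF assms, of "y - _"] by (force simp: dist_norm)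
  then have "bounded {x. mollifier \<epsilon> (y - x) \<noteq> 0}" using bounded_subset by blast
  then show ?thesis
    using smooth_algebra_C_k[OF translated_mollifier_smooth[of \<epsilon> y]] by (simp add: test_functions_def)
qed

section \<open>Convolution\<close>

text \<open>Borel representatives are used from here on, so that convolutions and Fubini take place
  over \<open>lborel\<close>.\<close>

definition locint :: "('a::euclidean_space \<Rightarrow> complex) \<Rightarrow> bool" where
  "locint f \<longleftrightarrow> f \<in> borel_measurable borel \<and> (\<forall>r. integrable lborel (\<lambda>x. indicator (cball 0 r) x *\<^sub>R f x))"

definition conv :: "('a::euclidean_space \<Rightarrow> real) \<Rightarrow> ('a \<Rightarrow> complex) \<Rightarrow> 'a \<Rightarrow> complex" where
  "conv k f y = (LINT x|lborel. k (y - x) *\<^sub>R f x)"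

lemma locint_measurable: "locint f \<Longrightarrow> f \<in> borel_measurable borel"
  by (simp add: locint_def)

text \<open>Dominating function for every kernel that is bounded by \<open>M\<close> and supported in the ball of
  radius \<open>R\<close>, locally uniformly in the base point.\<close>

definition majorant :: "real \<Rightarrow> real \<Rightarrow> ('a::euclidean_space \<Rightarrow> complex) \<Rightarrow> 'a \<Rightarrow> real" where
  "majorant M R f x = M * norm (indicator (cball 0 R) x *\<^sub>R f x)"

lemma integrable_majorant: "locint f \<Longrightarrow> integrable lborel (majorant M R f)"
  unfolding majorant_def locint_def by (intro integrable_mult_right integrable_norm) blast

lemma norm_le_majorant:
  assumes "\<bar>c\<bar> \<le> M" "R < norm (y - x) \<Longrightarrow> c = 0" "norm y + R \<le> S"
  shows "norm (c *\<^sub>R f x) \<le> majorant M S f x"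
proof (cases "R < norm (y - x)")
  case True
  then have "c = 0" using assms by simp
  moreover have "0 \<le> M" using assms by simp
  ultimately show ?thesis by (simp add: majorant_def)
next
  case False
  have "norm x \<le> norm y + norm (y - x)" using norm_triangle_ineq4[of y "y - x"] by simp
  then have "x \<in> cball 0 S" using False assms(3) by simp
  then show ?thesis using assms(1) by (simp add: majorant_def mult_right_mono)
qed

lemma borel_measurable_translate:
  fixes k :: "'a::euclidean_space \<Rightarrow> real"
  assumes "continuous_on UNIV k"
  shows "(\<lambda>x. k (y - x)) \<in> borel_measurable borel"
  by (intro borel_measurable_continuous_onI continuous_on_compose2[OF assms] continuous_intros) auto

lemma integrable_conv:
  assumes f: "locint f" and k: "continuous_on UNIV k" "\<And>z. \<bar>k z\<bar> \<le> M" "\<And>z. R < norm z \<Longrightarrow> k z = 0"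
  shows "integrable lborel (\<lambda>x. k (y - x) *\<^sub>R f x)"
proof (rule Bochner_Integration.integrable_bound[OF integrable_majorant[OF f]])
  show "(\<lambda>x. k (y - x) *\<^sub>R f x) \<in> borel_measurable lborel"
    using borel_measurable_translate[OF k(1)] locint_measurable[OF f] by simp
  show "AE x in lborel. norm (k (y - x) *\<^sub>R f x) \<le> norm (majorant M (norm y + R) f x)"
  proof (rule AE_I2)
    fix x
    have "norm (k (y - x) *\<^sub>R f x) \<le> majorant M (norm y + R) f x"
      by (rule norm_le_majorant[where R = R and y = y]) (use k in auto)
    also have "\<dots> \<le> norm (majorant M (norm y + R) f x)" by simp
    finally show "norm (k (y - x) *\<^sub>R f x) \<le> norm (majorant M (norm y + R) f x)" .
  qed
qed

text \<open>As \<open>f\<close> is integrable on balls only, a common bound for the kernels must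
  come with a common bounded support.\<close>

lemma conv_tendsto:
  fixes g :: "nat \<Rightarrow> 'a::euclidean_space \<Rightarrow> real"
  assumes f: "locint f" and g: "\<And>n. g n \<in> borel_measurable borel"
    and lim: "\<And>x. (\<lambda>n. g n x) \<longlonglongrightarrow> G x" and G: "G \<in> borel_measurable borel"
    and bound: "\<And>n x. \<bar>g n x\<bar> \<le> M" and supp: "\<And>n x. S < norm x \<Longrightarrow> g n x = 0"
  shows "(\<lambda>n. LINT x|lborel. g n x *\<^sub>R f x) \<longlonglongrightarrow> (LINT x|lborel. G x *\<^sub>R f x)"
proof (rule integral_dominated_convergence[OF _ _ integrable_majorant[OF f, of M S]])
  show "(\<lambda>x. G x *\<^sub>R f x) \<in> borel_measurable lborel" "(\<lambda>x. g n x *\<^sub>R f x) \<in> borel_measurable lborel" for n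
    using G g locint_measurable[OF f] by simp_all
  show "AE x in lborel. (\<lambda>n. g n x *\<^sub>R f x) \<longlonglongrightarrow> G x *\<^sub>R f x"
    by (intro AE_I2 tendsto_intros lim)
  show "AE x in lborel. norm (g n x *\<^sub>R f x) \<le> majorant M S f x" for n
    by (intro AE_I2 norm_le_majorant[where R = S and y = 0]) (use bound supp in auto)
qed

lemma continuous_on_conv:
  assumes f: "locint f" and k: "continuous_on UNIV k" "\<And>z. \<bar>k z\<bar> \<le> M" "\<And>z. R < norm z \<Longrightarrow> k z = 0"
  shows "continuous_on UNIV (conv k f)"
  unfolding continuous_on_sequentially
proof safe
  fix y :: "nat \<Rightarrow> 'a" and l assume lim: "y \<longlonglongrightarrow> l"
  then have "Bseq y" by (intro convergent_imp_Bseq convergentI)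
  then obtain B where B: "\<And>n. norm (y n) \<le> B" unfolding Bseq_def by blast
  have "(\<lambda>n. LINT x|lborel. k (y n - x) *\<^sub>R f x) \<longlonglongrightarrow> (LINT x|lborel. k (l - x) *\<^sub>R f x)"
  proof (rule conv_tendsto[OF f, where M = M and S = "B + R"])
    show "(\<lambda>n. k (y n - x)) \<longlonglongrightarrow> k (l - x)" for x
      by (rule continuous_on_tendsto_compose[OF k(1)]) (auto intro!: tendsto_intros lim)
    show "k (y n - x) = 0" if "B + R < norm x" for n x
    proof (rule k(3))
      show "R < norm (y n - x)" using norm_triangle_ineq2[of x "y n"] B[of n] that
        by (simp add: norm_minus_commute)
    qed
  qed (use k borel_measurable_translate in auto)
  then show "(conv k f \<circ> y) \<longlonglongrightarrow> conv k f l" by (simp add: conv_def comp_def)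
qed

text \<open>The remainder of the first-order expansion of the kernel, divided by
  \<open>norm h\<close>, tends to 0 pointwise and is bounded by \<open>2 * L\<close> on a common
  bounded support, so dominated convergence applies along every sequence of increments.\<close>

lemma has_derivative_conv:
  fixes k :: "'a::euclidean_space \<Rightarrow> real" and k' :: "'a \<Rightarrow> 'a \<Rightarrow> real"
  assumes f: "locint f"
    and der: "\<And>z. (k has_derivative k' z) (at z)"
    and k': "\<And>b. continuous_on UNIV (\<lambda>z. k' z b)" "\<And>b z. b \<in> Basis \<Longrightarrow> \<bar>k' z b\<bar> \<le> M"
    and supp: "\<And>z. R < norm z \<Longrightarrow> k z = 0" "\<And>z b. R < norm z \<Longrightarrow> k' z b = 0"
    and M: "0 \<le> M" "\<And>z. \<bar>k z\<bar> \<le> M" and R: "0 \<le> R"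
  shows "(conv k f has_derivative (\<lambda>h. \<Sum>b\<in>Basis. (h \<bullet> b) *\<^sub>R conv (\<lambda>z. k' z b) f y)) (at y)"
proof -
  \<comment> \<open>Bounds for the partial derivatives in the basis directions add up to a bound for
    the differential, and so to a Lipschitz constant for \<open>k\<close>.\<close>
  define L where "L = real DIM('a) * M"
  have L: "0 \<le> L" using M by (simp add: L_def)
  have contk: "continuous_on UNIV k"
    using der has_derivative_continuous by (blast intro: continuous_at_imp_continuous_on)
  have lin: "linear (k' z)" for z using der by (rule has_derivative_linear)
  have k'_sum: "k' z h = (\<Sum>b\<in>Basis. (h \<bullet> b) * k' z b)" for z h
  proof -
    have "k' z h = k' z (\<Sum>b\<in>Basis. (h \<bullet> b) *\<^sub>R b)" by (simp add: euclidean_representation)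
    also have "\<dots> = (\<Sum>b\<in>Basis. (h \<bullet> b) * k' z b)"
      unfolding linear_sum[OF lin] linear_scale[OF lin] real_scaleR_def ..
    finally show ?thesis .
  qed
  have k'_bound: "\<bar>k' z h\<bar> \<le> L * norm h" for z h
  proof -
    have "\<bar>k' z h\<bar> \<le> (\<Sum>b\<in>Basis. \<bar>(h \<bullet> b) * k' z b\<bar>)"
      by (subst k'_sum) (rule sum_abs)
    also have "\<dots> \<le> (\<Sum>b\<in>(Basis::'a set). norm h * M)"
      unfolding abs_mult using k'(2) by (intro sum_mono mult_mono) (simp_all add: Basis_le_norm)
    finally show ?thesis by (simp add: L_def mult_ac)
  qed
  have lip: "\<bar>k (z + h) - k z\<bar> \<le> L * norm h" for z h
  proof -
    have "norm (k (z + h) - k z) \<le> L * norm (z + h - z)"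
    proof (rule differentiable_bound[of UNIV k k'])
      show "onorm (k' x) \<le> L" for x
        by (rule onorm_le) (simp only: real_norm_def k'_bound)
    qed (use der has_derivative_at_withinI in auto)
    then show ?thesis by simp
  qed
  have int: "integrable lborel (\<lambda>x. k (y - x) *\<^sub>R f x)" for y
    by (rule integrable_conv[OF f contk M(2) supp(1)])
  have int': "integrable lborel (\<lambda>x. k' (y - x) b *\<^sub>R f x)" for y b
  proof (rule integrable_conv[OF f k'(1) _ supp(2)])
    show "\<bar>k' z b\<bar> \<le> L * norm b" for z by (rule k'_bound)
  qed
  have lincomb: "(\<Sum>b\<in>Basis. (h \<bullet> b) *\<^sub>R conv (\<lambda>z. k' z b) f y) = (LINT x|lborel. k' (y - x) h *\<^sub>R f x)" for h
  proof -
    have "(LINT x|lborel. k' (y - x) h *\<^sub>R f x) = (LINT x|lborel. (\<Sum>b\<in>Basis. (h \<bullet> b) *\<^sub>R (k' (y - x) b *\<^sub>R f x)))"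
      by (simp add: k'_sum[of _ h] scaleR_sum_left)
    also have "\<dots> = (\<Sum>b\<in>Basis. LINT x|lborel. (h \<bullet> b) *\<^sub>R (k' (y - x) b *\<^sub>R f x))"
      by (intro Bochner_Integration.integral_sum integrable_scaleR_right int')
    finally show ?thesis by (simp only: conv_def integral_scaleR_right)
  qed
  show ?thesis
    unfolding lincomb has_derivative_at
  proof
    show "bounded_linear (\<lambda>h. LINT x|lborel. k' (y - x) h *\<^sub>R f x)"
      unfolding lincomb[symmetric]
      by (intro bounded_linear_sum bounded_linear_scaleR_const bounded_linear_inner_left)
    show "(\<lambda>h. norm (conv k f (y + h) - conv k f y - (LINT x|lborel. k' (y - x) h *\<^sub>R f x)) / norm h) \<midarrow>0\<rightarrow> 0"
      unfolding tendsto_at_iff_sequentially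
    proof safe
      fix h :: "nat \<Rightarrow> 'a" assume h: "\<forall>n. h n \<in> UNIV - {0}" and lim: "h \<longlonglongrightarrow> 0"
      then have "Bseq h" by (intro convergent_imp_Bseq convergentI)
      then obtain B where B: "\<And>n. norm (h n) \<le> B" unfolding Bseq_def by blast
      then have B0: "0 \<le> B" by (meson norm_ge_zero order_trans)
      define g where "g n x = (k (y + h n - x) - k (y - x) - k' (y - x) (h n)) / norm (h n)" for n x
      have "(\<lambda>n. LINT x|lborel. g n x *\<^sub>R f x) \<longlonglongrightarrow> (LINT x|lborel. 0 *\<^sub>R f x)"
      proof (rule conv_tendsto[OF f, where M = "2 * L" and S = "norm y + B + R"])
        show "g n \<in> borel_measurable borel" for n
          unfolding g_def using borel_measurable_translate[OF contk] borel_measurable_translate[OF k'(1)]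
          by (intro borel_measurable_divide borel_measurable_diff) auto
        show "(\<lambda>n. g n x) \<longlonglongrightarrow> 0" for x
        proof -
          have "(\<lambda>h. norm (k (y - x + h) - k (y - x) - k' (y - x) h) / norm h) \<midarrow>0\<rightarrow> 0"
            using der[of "y - x"] unfolding has_derivative_at by blast
          then have "(\<lambda>n. norm (k (y - x + h n) - k (y - x) - k' (y - x) (h n)) / norm (h n)) \<longlonglongrightarrow> 0"
            using h lim unfolding tendsto_at_iff_sequentially comp_def by blast
          then have "(\<lambda>n. norm (g n x)) \<longlonglongrightarrow> 0" by (simp add: g_def algebra_simps)
          then show ?thesis by (rule tendsto_norm_zero_cancel)
        qed
        show "\<bar>g n x\<bar> \<le> 2 * L" for n x
        proof -
          have "\<bar>k (y + h n - x) - k (y - x) - k' (y - x) (h n)\<bar> \<le> 2 * L * norm (h n)"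
            using lip[of "y - x" "h n"] k'_bound[of "y - x" "h n"] by (simp add: algebra_simps)
          then show ?thesis using h by (simp add: g_def pos_divide_le_eq)
        qed
        show "g n x = 0" if "norm y + B + R < norm x" for n x
        proof -
          have "R < norm (y + h n - x)" "R < norm (y - x)"
            using that B[of n] B0 norm_triangle_ineq2[of x "y + h n"] norm_triangle_ineq2[of x y]
              norm_triangle_ineq[of y "h n"] by (simp_all add: norm_minus_commute)
          then show ?thesis using supp by (simp add: g_def)
        qed
      qed auto
      then have "(\<lambda>n. norm (LINT x|lborel. g n x *\<^sub>R f x)) \<longlonglongrightarrow> 0" by (simp add: tendsto_norm_zero)
      moreover have "norm (LINT x|lborel. g n x *\<^sub>R f x)
        = norm (conv k f (y + h n) - conv k f y - (LINT x|lborel. k' (y - x) (h n) *\<^sub>R f x)) / norm (h n)" for n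
      proof -
        have "(LINT x|lborel. g n x *\<^sub>R f x) = (LINT x|lborel. (1 / norm (h n)) *\<^sub>R
            (k (y + h n - x) *\<^sub>R f x - k (y - x) *\<^sub>R f x - k' (y - x) (h n) *\<^sub>R f x))"
          by (intro Bochner_Integration.integral_cong refl)
            (simp add: g_def scaleR_diff_left[symmetric] divide_inverse mult.commute)
        also have "\<dots> = (1 / norm (h n)) *\<^sub>R (conv k f (y + h n) - conv k f y - (LINT x|lborel. k' (y - x) (h n) *\<^sub>R f x))"
          unfolding conv_def
          by (simp only: integral_scaleR_right Bochner_Integration.integral_diff[OF int int]
              Bochner_Integration.integral_diff[OF Bochner_Integration.integrable_diff[OF int int] int'])
        finally show ?thesis by simp
      qed
      ultimately show "((\<lambda>h. norm (conv k f (y + h) - conv k f y - (LINT x|lborel. k' (y - x) h *\<^sub>R f x)) / norm h) \<circ> h) \<longlonglongrightarrow> 0"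
        by (simp add: comp_def)
    qed
  qed
qed

section \<open>Mollification in square mean\<close>

definition sq_int :: "('a::euclidean_space \<Rightarrow> complex) \<Rightarrow> bool" where
  "sq_int f \<longleftrightarrow> f \<in> borel_measurable borel \<and> (\<integral>\<^sup>+x. ennreal ((norm (f x))\<^sup>2) \<partial>lborel) < \<infinity>"

lemma norm_add_sq_le2: "(norm (a + b))\<^sup>2 \<le> 2 * (norm a)\<^sup>2 + 2 * (norm (b::'a::real_normed_vector))\<^sup>2"
  using norm_add_sq_le[of 1 a b] by simp

lemma nn_integral_sq_add_le:
  fixes f g :: "'a::euclidean_space \<Rightarrow> complex"
  assumes [measurable]: "f \<in> borel_measurable borel" "g \<in> borel_measurable borel"
  shows "(\<integral>\<^sup>+x. ennreal ((norm (f x + g x))\<^sup>2) \<partial>lborel)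
    \<le> 2 * (\<integral>\<^sup>+x. ennreal ((norm (f x))\<^sup>2) \<partial>lborel) + 2 * (\<integral>\<^sup>+x. ennreal ((norm (g x))\<^sup>2) \<partial>lborel)"
proof -
  have "(\<integral>\<^sup>+x. ennreal ((norm (f x + g x))\<^sup>2) \<partial>lborel)
    \<le> (\<integral>\<^sup>+x. 2 * ennreal ((norm (f x))\<^sup>2) + 2 * ennreal ((norm (g x))\<^sup>2) \<partial>lborel)"
  proof (rule nn_integral_mono)
    fix x
    have "ennreal ((norm (f x + g x))\<^sup>2) \<le> ennreal (2 * (norm (f x))\<^sup>2 + 2 * (norm (g x))\<^sup>2)"
      by (intro ennreal_leI norm_add_sq_le2)
    then show "ennreal ((norm (f x + g x))\<^sup>2) \<le> 2 * ennreal ((norm (f x))\<^sup>2) + 2 * ennreal ((norm (g x))\<^sup>2)"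
      by (simp add: ennreal_plus ennreal_mult)
  qed
  also have "\<dots> = 2 * (\<integral>\<^sup>+x. ennreal ((norm (f x))\<^sup>2) \<partial>lborel) + 2 * (\<integral>\<^sup>+x. ennreal ((norm (g x))\<^sup>2) \<partial>lborel)"
    by (simp add: nn_integral_add nn_integral_cmult)
  finally show ?thesis .
qed

lemma sq_int_diff:
  assumes "sq_int f" "sq_int g"
  shows "sq_int (\<lambda>x. f x - g x)"
proof -
  have [measurable]: "f \<in> borel_measurable borel" "g \<in> borel_measurable borel"
    using assms by (auto simp: sq_int_def)
  have "(\<integral>\<^sup>+x. ennreal ((norm (f x + - g x))\<^sup>2) \<partial>lborel)
    \<le> 2 * (\<integral>\<^sup>+x. ennreal ((norm (f x))\<^sup>2) \<partial>lborel) + 2 * (\<integral>\<^sup>+x. ennreal ((norm (- g x))\<^sup>2) \<partial>lborel)"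
    by (rule nn_integral_sq_add_le) auto
  also have "\<dots> < \<infinity>" using assms by (simp add: sq_int_def ennreal_mult_less_top)
  finally show ?thesis by (simp add: sq_int_def)
qed

lemma sq_int_integrable: "sq_int f \<Longrightarrow> integrable lborel (\<lambda>x. (norm (f x))\<^sup>2)"
  unfolding sq_int_def by (intro integrableI_nonneg) auto

text \<open>On a ball \<open>norm f \<le> 1 + (norm f)^2\<close>, and the ball has finite
  measure.\<close>

lemma sq_int_locint:
  assumes "sq_int f"
  shows "locint f"
  unfolding locint_def
proof (intro conjI allI)
  show [measurable]: "f \<in> borel_measurable borel" using assms by (simp add: sq_int_def)
  fix r
  show "integrable lborel (\<lambda>x. indicator (cball 0 r) x *\<^sub>R f x)"
  proof (rule Bochner_Integration.integrable_bound)
    show "integrable lborel (\<lambda>x. indicator (cball 0 r) x + (norm (f x))\<^sup>2)"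
      using emeasure_lborel_cball_finite[of 0 r]
      by (intro Bochner_Integration.integrable_add sq_int_integrable assms integrable_real_indicator)
        auto
    show "AE x in lborel. norm (indicator (cball 0 r) x *\<^sub>R f x) \<le> norm (indicator (cball 0 r) x + (norm (f x))\<^sup>2)"
    proof (rule AE_I2)
      fix x
      have "2 * norm (f x) \<le> (norm (f x))\<^sup>2 + 1"
        using zero_le_power2[of "norm (f x) - 1"] by (simp add: power2_diff)
      then have "norm (f x) \<le> 1 + (norm (f x))\<^sup>2" using zero_le_power2[of "norm (f x)"] by linarith
      then show "norm (indicator (cball 0 r) x *\<^sub>R f x) \<le> norm (indicator (cball 0 r) x + (norm (f x))\<^sup>2)"
        by (simp add: indicator_def)
    qed
  qed (intro borel_measurable_scaleR borel_measurable_indicator; simp)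
qed

lemma lborel_reflect: "(lborel :: 'a::euclidean_space measure) = distr lborel borel (\<lambda>x. y - x)"
  using lborel_affine[of "-1" y] by (simp add: density_1)

lemma translated_mollifier:
  fixes y :: "'a::euclidean_space"
  assumes "0 < \<epsilon>"
  shows "integrable lborel (\<lambda>x. mollifier \<epsilon> (y - x))" "(LINT x|lborel. mollifier \<epsilon> (y - x)) = 1"
    "(\<integral>\<^sup>+x. ennreal (mollifier \<epsilon> (y - x)) \<partial>lborel) = 1"
proof -
  have [measurable]: "(mollifier \<epsilon> :: 'a \<Rightarrow> real) \<in> borel_measurable borel"
    by (intro borel_measurable_continuous_onI smooth_algebra_continuous mollifier_smooth)
  show int: "integrable lborel (\<lambda>x. mollifier \<epsilon> (y - x))"
    using integrable_mollifier[of \<epsilon>, where 'a = 'a] by (subst (asm) lborel_reflect[of y]) (simp add: integrable_distr_eq)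
  show eq: "(LINT x|lborel. mollifier \<epsilon> (y - x)) = 1"
    using integral_mollifier[OF assms, where 'a = 'a] by (subst (asm) lborel_reflect[of y]) (simp add: integral_distr)
  show "(\<integral>\<^sup>+x. ennreal (mollifier \<epsilon> (y - x)) \<partial>lborel) = 1"
    using nn_integral_eq_integral[OF int AE_I2[OF mollifier_nonneg[OF assms]]] eq by simp
qed

lemma mollifier_bounded:
  assumes "0 < \<epsilon>"
  obtains M where "0 \<le> M" "\<And>x::'a::euclidean_space. mollifier \<epsilon> x \<le> M"
proof (rule that[of "1 / bump_mass \<epsilon> TYPE('a)"])
  have "flat_exp 0 t \<le> 1" for t by (simp add: flat_exp_def)
  then show "mollifier \<epsilon> x \<le> 1 / bump_mass \<epsilon> TYPE('a)" for x :: 'a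
    using bump_mass_pos[OF assms, where 'a = 'a] by (simp add: mollifier_def divide_right_mono)
  show "0 \<le> 1 / bump_mass \<epsilon> TYPE('a)"
    using bump_mass_pos[OF assms, where 'a = 'a] by simp
qed

lemma mollifier_abs_bounded:
  assumes "0 < \<epsilon>"
  obtains M where "0 \<le> M" "\<And>x::'a::euclidean_space. \<bar>mollifier \<epsilon> x\<bar> \<le> M"
  using mollifier_bounded[OF assms, where 'a = 'a] mollifier_nonneg[OF assms, where 'a = 'a]
  by (metis abs_of_nonneg)

lemma integrable_conv_mollifier:
  fixes f :: "'a::euclidean_space \<Rightarrow> complex"
  assumes "0 < \<epsilon>" "locint f"
  shows "integrable lborel (\<lambda>x. mollifier \<epsilon> (y - x) *\<^sub>R f x)" "continuous_on UNIV (conv (mollifier \<epsilon>) f)"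
proof -
  obtain M where M: "\<And>x::'a. \<bar>mollifier \<epsilon> x\<bar> \<le> M" using mollifier_abs_bounded[OF assms(1)] by metis
  note k = smooth_algebra_continuous[OF mollifier_smooth] M mollifier_eq_0[OF assms(1) less_imp_le]
  show "integrable lborel (\<lambda>x. mollifier \<epsilon> (y - x) *\<^sub>R f x)"
    by (rule integrable_conv[OF assms(2) k])
  show "continuous_on UNIV (conv (mollifier \<epsilon>) f)"
    by (rule continuous_on_conv[OF assms(2) k])
qed

text \<open>Jensen's inequality for the probability density \<open>m\<close>, with \<open>c\<close>
  as the mean of \<open>f\<close>.\<close>

lemma norm_conv_sq_le:
  fixes f :: "'a::euclidean_space \<Rightarrow> complex"
  assumes \<epsilon>: "0 < \<epsilon>" and f: "sq_int f"
  shows "ennreal ((norm (conv (mollifier \<epsilon>) f y))\<^sup>2) \<le> (\<integral>\<^sup>+x. ennreal (mollifier \<epsilon> (y - x)) * ennreal ((norm (f x))\<^sup>2) \<partial>lborel)"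
proof -
  define c where "c = conv (mollifier \<epsilon>) f y"
  define m where "m x = mollifier \<epsilon> (y - x)" for x
  have [measurable]: "m \<in> borel_measurable borel"
    unfolding m_def by (intro borel_measurable_translate smooth_algebra_continuous mollifier_smooth)
  have [measurable]: "f \<in> borel_measurable borel" using f by (simp add: sq_int_def)
  have m0: "0 \<le> m x" for x unfolding m_def by (rule mollifier_nonneg[OF \<epsilon>])
  obtain M where M: "0 \<le> M" "\<And>x::'a. mollifier \<epsilon> x \<le> M" using mollifier_bounded[OF \<epsilon>] by metis
  have i1: "integrable lborel (\<lambda>x. m x *\<^sub>R f x)"
    unfolding m_def by (rule integrable_conv_mollifier(1)[OF \<epsilon> sq_int_locint[OF f]])
  have i2: "integrable lborel (\<lambda>x. m x * (norm (f x))\<^sup>2)"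
  proof (rule Bochner_Integration.integrable_bound)
    show "integrable lborel (\<lambda>x. M * (norm (f x))\<^sup>2)" using sq_int_integrable[OF f] by simp
    have "m x * (norm (f x))\<^sup>2 \<le> M * (norm (f x))\<^sup>2" for x
      using M by (intro mult_right_mono) (auto simp: m_def)
    then show "AE x in lborel. norm (m x * (norm (f x))\<^sup>2) \<le> norm (M * (norm (f x))\<^sup>2)"
      using m0 M by (intro AE_I2) (simp add: abs_mult)
  qed simp
  have i3: "integrable lborel m" unfolding m_def by (rule translated_mollifier[OF \<epsilon>])
  have c: "(LINT x|lborel. m x *\<^sub>R f x) = c" by (simp add: c_def conv_def m_def)
  \<comment> \<open>The variance of \<open>f\<close> is nonnegative; expanding it about the mean
    gives the mean of the squares minus the square of the mean.\<close>
  have "0 \<le> (LINT x|lborel. m x * (norm (f x - c))\<^sup>2)"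
    using m0 by (intro integral_nonneg_AE) auto
  also have "\<dots> = (LINT x|lborel. m x * (norm (f x))\<^sup>2 - 2 * ((m x *\<^sub>R f x) \<bullet> c) + (c \<bullet> c) * m x)"
    by (intro Bochner_Integration.integral_cong refl)
      (simp add: power2_norm_eq_inner inner_diff_left inner_diff_right inner_commute algebra_simps)
  also have "\<dots> = (LINT x|lborel. m x * (norm (f x))\<^sup>2) - 2 * (c \<bullet> c) + c \<bullet> c"
  proof -
    have "(LINT x|lborel. m x) = 1" unfolding m_def by (rule translated_mollifier(2)[OF \<epsilon>])
    moreover have i4: "integrable lborel (\<lambda>x. (m x *\<^sub>R f x) \<bullet> c)" using i1 by (rule integrable_inner_left)
    moreover have "(LINT x|lborel. (m x *\<^sub>R f x) \<bullet> c) = c \<bullet> c"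
      using integral_inner_left[OF i1, of c] c by simp
    ultimately show ?thesis
      using i2 i3 i4 by (subst Bochner_Integration.integral_add, simp, simp,
        subst Bochner_Integration.integral_diff) simp_all
  qed
  finally have "(norm c)\<^sup>2 \<le> (LINT x|lborel. m x * (norm (f x))\<^sup>2)"
    by (simp add: power2_norm_eq_inner)
  then have "ennreal ((norm c)\<^sup>2) \<le> ennreal (LINT x|lborel. m x * (norm (f x))\<^sup>2)" by (rule ennreal_leI)
  also have "\<dots> = (\<integral>\<^sup>+x. ennreal (m x * (norm (f x))\<^sup>2) \<partial>lborel)"
    using i2 m0 by (subst nn_integral_eq_integral) auto
  also have "\<dots> = (\<integral>\<^sup>+x. ennreal (m x) * ennreal ((norm (f x))\<^sup>2) \<partial>lborel)"
    using m0 by (simp add: ennreal_mult)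
  finally show ?thesis by (simp add: c_def m_def)
qed

text \<open>Integrate the pointwise bound and exchange the integrals: by symmetry the mollifier has
  mass 1 in the other variable too. The contraction is uniform in \<epsilon>, which is what reduces
  convergence to a dense class.\<close>

lemma nn_integral_conv_sq_le:
  fixes f :: "'a::euclidean_space \<Rightarrow> complex"
  assumes \<epsilon>: "0 < \<epsilon>" and f: "sq_int f"
  shows "(\<integral>\<^sup>+y. ennreal ((norm (conv (mollifier \<epsilon>) f y))\<^sup>2) \<partial>lborel) \<le> (\<integral>\<^sup>+x. ennreal ((norm (f x))\<^sup>2) \<partial>lborel)"
proof -
  have [measurable]: "f \<in> borel_measurable borel" using f by (simp add: sq_int_def)
  have [measurable]: "(\<lambda>(y, x). mollifier \<epsilon> (y - x)) \<in> borel_measurable (borel \<Otimes>\<^sub>M (borel :: 'a measure))"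
    unfolding borel_prod split_beta'
    by (intro borel_measurable_continuous_onI
        continuous_on_compose2[OF smooth_algebra_continuous[OF mollifier_smooth]] continuous_intros) auto
  have "(\<integral>\<^sup>+y. ennreal ((norm (conv (mollifier \<epsilon>) f y))\<^sup>2) \<partial>lborel)
     \<le> (\<integral>\<^sup>+y. (\<integral>\<^sup>+x. ennreal (mollifier \<epsilon> (y - x)) * ennreal ((norm (f x))\<^sup>2) \<partial>lborel) \<partial>lborel)"
    by (intro nn_integral_mono norm_conv_sq_le assms)
  also have "\<dots> = (\<integral>\<^sup>+x. (\<integral>\<^sup>+y. ennreal (mollifier \<epsilon> (y - x)) * ennreal ((norm (f x))\<^sup>2) \<partial>lborel) \<partial>lborel)"
    by (rule lborel_pair.Fubini') measurable
  also have "\<dots> = (\<integral>\<^sup>+x. ennreal ((norm (f x))\<^sup>2) \<partial>lborel)"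
  proof (rule nn_integral_cong)
    fix x :: 'a
    have "mollifier \<epsilon> (y - x) = mollifier \<epsilon> (x - y)" for y :: 'a
      by (simp add: mollifier_def power2_norm_eq_inner[symmetric] norm_minus_commute)
    moreover have "(\<lambda>y. ennreal (mollifier \<epsilon> (x - y))) \<in> borel_measurable lborel"
      using translated_mollifier(1)[OF \<epsilon>, of x] by (auto intro!: borel_measurable_integrable)
    ultimately show "(\<integral>\<^sup>+y. ennreal (mollifier \<epsilon> (y - x)) * ennreal ((norm (f x))\<^sup>2) \<partial>lborel) = ennreal ((norm (f x))\<^sup>2)"
      using translated_mollifier(3)[OF \<epsilon>, of x] by (simp add: nn_integral_multc)
  qed
  finally show ?thesis .
qed

lemma conv_mollifier_uniform:
  fixes h :: "'a::euclidean_space \<Rightarrow> complex"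
  assumes \<epsilon>: "0 < \<epsilon>" and h: "locint h" and \<omega>: "\<And>x. norm (y - x) \<le> \<epsilon> \<Longrightarrow> norm (h x - h y) \<le> \<omega>"
  shows "norm (conv (mollifier \<epsilon>) h y - h y) \<le> \<omega>"
proof -
  have m: "integrable lborel (\<lambda>x. mollifier \<epsilon> (y - x))" "(LINT x|lborel. mollifier \<epsilon> (y - x)) = 1"
    using translated_mollifier[OF \<epsilon>] by auto
  have "conv (mollifier \<epsilon>) h y - h y = (LINT x|lborel. mollifier \<epsilon> (y - x) *\<^sub>R h x) - (LINT x|lborel. mollifier \<epsilon> (y - x) *\<^sub>R h y)"
    using m by (simp add: conv_def)
  also have "\<dots> = (LINT x|lborel. mollifier \<epsilon> (y - x) *\<^sub>R (h x - h y))"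
    unfolding scaleR_diff_right
    by (intro Bochner_Integration.integral_diff[symmetric] integrable_conv_mollifier \<epsilon> h integrable_scaleR_left) (use m in auto)
  also have "norm \<dots> \<le> (LINT x|lborel. mollifier \<epsilon> (y - x) * \<omega>)"
  proof (rule Bochner_Integration.integral_norm_bound_integral)
    show "integrable lborel (\<lambda>x. mollifier \<epsilon> (y - x) *\<^sub>R (h x - h y))"
      unfolding scaleR_diff_right
      by (intro Bochner_Integration.integrable_diff integrable_conv_mollifier \<epsilon> h integrable_scaleR_left) (use m in auto)
    show "integrable lborel (\<lambda>x. mollifier \<epsilon> (y - x) * \<omega>)" using m by simp
    fix x
    show "norm (mollifier \<epsilon> (y - x) *\<^sub>R (h x - h y)) \<le> mollifier \<epsilon> (y - x) * \<omega>"
    proof (cases "norm (y - x) \<le> \<epsilon>")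
      case True
      then show ?thesis using mollifier_nonneg[OF \<epsilon>, of "y - x"] \<omega> by (simp add: mult_left_mono)
    next
      case False
      then show ?thesis using mollifier_eq_0[OF \<epsilon>, of "y - x"] by simp
    qed
  qed
  also have "\<dots> = \<omega>" using m by simp
  finally show ?thesis .
qed

lemma conv_mollifier_tendsto_continuous:
  fixes h :: "'a::euclidean_space \<Rightarrow> complex"
  assumes cont: "continuous_on UNIV h" and supp: "\<And>x. R < norm x \<Longrightarrow> h x = 0" and li: "locint h" and \<delta>: "0 < \<delta>"
  shows "\<forall>\<^sub>F \<epsilon> in at_right 0. (\<integral>\<^sup>+y. ennreal ((norm (conv (mollifier \<epsilon>) h y - h y))\<^sup>2) \<partial>lborel) < ennreal \<delta>"
proof -
  \<comment> \<open>For \<open>\<epsilon> < 1\<close> the mean at a point of norm at most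
    \<open>R + 1\<close> involves points of norm at most \<open>R + 2\<close>. Farther out, both the
    function and its mean vanish.\<close>
  let ?K = "cball (0::'a) (R + 2)"
  define V where "V = measure lborel ?K"
  have V: "emeasure lborel ?K = ennreal V" "0 \<le> V"
    using emeasure_lborel_cball_finite[of "0::'a" "R + 2"] by (auto simp: V_def emeasure_eq_ennreal_measure top.not_eq_extremum)
  \<comment> \<open>Chosen such that \<open>\<omega>^2 * V < \<delta>\<close>; the summand 1 keeps
    the denominator positive even if the ball has measure 0.\<close>
  define \<omega> where "\<omega> = sqrt (\<delta> / (V + 1) / 2)"
  have \<omega>: "0 < \<omega>" "\<omega>\<^sup>2 * V < \<delta>"
  proof -
    show "0 < \<omega>" using \<delta> V by (simp add: \<omega>_def)
    have "\<omega>\<^sup>2 * V = \<delta> * V / (2 * (V + 1))" using \<delta> V by (simp add: \<omega>_def)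
    also have "\<dots> < \<delta>"
    proof (subst pos_divide_less_eq)
      have "0 < \<delta> * V + 2 * \<delta>" using \<delta> V by (simp add: add_nonneg_pos)
      then show "\<delta> * V < \<delta> * (2 * (V + 1))" by (simp add: algebra_simps)
    qed (use V in simp)
    finally show "\<omega>\<^sup>2 * V < \<delta>" .
  qed
  have "uniformly_continuous_on ?K h"
    using cont by (intro compact_uniformly_continuous continuous_on_subset[OF cont]) auto
  then obtain d where d: "0 < d" "\<And>x y. x \<in> ?K \<Longrightarrow> y \<in> ?K \<Longrightarrow> dist x y < d \<Longrightarrow> dist (h x) (h y) < \<omega>"
    using \<omega>(1) unfolding uniformly_continuous_on_def by metis
  have "(\<integral>\<^sup>+y. ennreal ((norm (conv (mollifier \<epsilon>) h y - h y))\<^sup>2) \<partial>lborel) < ennreal \<delta>"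
    if \<epsilon>: "0 < \<epsilon>" "\<epsilon> < min 1 d" for \<epsilon>
  proof -
    have pw: "norm (conv (mollifier \<epsilon>) h y - h y) \<le> \<omega> * indicator ?K y" for y
    proof (cases "norm y \<le> R + 1")
      case True
      have "norm (conv (mollifier \<epsilon>) h y - h y) \<le> \<omega>"
      proof (rule conv_mollifier_uniform[OF \<epsilon>(1) li])
        fix x assume x: "norm (y - x) \<le> \<epsilon>"
        have "norm x \<le> R + 2" using True x \<epsilon> norm_triangle_ineq4[of y "y - x"] by simp
        then show "norm (h x - h y) \<le> \<omega>"
          using d(2)[of x y] True x \<epsilon> by (simp add: dist_norm norm_minus_commute)
      qed
      then show ?thesis using True by (simp add: indicator_def)
    next
      case False
      have "norm (conv (mollifier \<epsilon>) h y - h y) \<le> 0"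
      proof (rule conv_mollifier_uniform[OF \<epsilon>(1) li])
        fix x assume x: "norm (y - x) \<le> \<epsilon>"
        have "R < norm x" using False x \<epsilon> norm_triangle_ineq2[of y x] norm_minus_commute[of y x]
            norm_triangle_ineq2[of y "y - x"] by simp
        moreover have "R < norm y" using False by simp
        ultimately show "norm (h x - h y) \<le> 0" using supp by simp
      qed
      then show ?thesis using \<omega>(1) by (simp add: indicator_def)
    qed
    have "(\<integral>\<^sup>+y. ennreal ((norm (conv (mollifier \<epsilon>) h y - h y))\<^sup>2) \<partial>lborel) \<le> (\<integral>\<^sup>+y. ennreal (\<omega>\<^sup>2) * indicator ?K y \<partial>lborel)"
    proof (rule nn_integral_mono)
      fix y
      have "(norm (conv (mollifier \<epsilon>) h y - h y))\<^sup>2 \<le> (\<omega> * indicator ?K y)\<^sup>2" by (rule power_mono[OF pw]) simp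
      then have "ennreal ((norm (conv (mollifier \<epsilon>) h y - h y))\<^sup>2) \<le> ennreal ((\<omega> * indicator ?K y)\<^sup>2)" by (rule ennreal_leI)
      also have "\<dots> = ennreal (\<omega>\<^sup>2) * indicator ?K y" by (simp add: indicator_def)
      finally show "ennreal ((norm (conv (mollifier \<epsilon>) h y - h y))\<^sup>2) \<le> ennreal (\<omega>\<^sup>2) * indicator ?K y" .
    qed
    also have "\<dots> = ennreal (\<omega>\<^sup>2 * V)" using V by (simp add: nn_integral_cmult_indicator ennreal_mult)
    also have "\<dots> < ennreal \<delta>" using \<omega> V by (simp add: ennreal_less_iff)
    finally show ?thesis .
  qed
  moreover have "0 < min 1 d" using d by simp
  ultimately show ?thesis unfolding eventually_at_right_field by blast
qed

text \<open>Radial retraction onto the disc of radius \<open>m + 1\<close>. Being continuous, it may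
  be composed with continuous approximants; taking \<open>Suc m\<close> keeps the radius
  positive.\<close>

definition truncate :: "nat \<Rightarrow> complex \<Rightarrow> complex" where
  "truncate m z = (real (Suc m) / max (real (Suc m)) (norm z)) *\<^sub>R z"

definition cutoff :: "nat \<Rightarrow> 'a::euclidean_space \<Rightarrow> real" where
  "cutoff m x = max 0 (min 1 (real m + 1 - norm x))"

lemma norm_truncate: "norm (truncate m z) \<le> real (Suc m)"
proof -
  have "norm z / max (real (Suc m)) (norm z) \<le> 1" by (simp add: divide_le_eq_1 max_def)
  then have "real (Suc m) * (norm z / max (real (Suc m)) (norm z)) \<le> real (Suc m) * 1"
    by (intro mult_left_mono) auto
  then show ?thesis by (simp add: truncate_def max_def)
qed

lemma ennreal_double: "0 \<le> a \<Longrightarrow> 2 * ennreal a = ennreal (2 * a)"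
  by (simp add: ennreal_mult)

lemma continuous_truncate: "continuous_on S (truncate m)"
  unfolding truncate_def by (intro continuous_intros) (auto simp: max_def)

lemma continuous_cutoff: "continuous_on S (cutoff m)"
  unfolding cutoff_def by (intro continuous_intros)

lemma cutoff_bounds: "0 \<le> cutoff m x" "cutoff m x \<le> 1"
  and cutoff_eq_1: "norm x \<le> real m \<Longrightarrow> cutoff m x = 1"
  and cutoff_eq_0: "real m + 1 < norm x \<Longrightarrow> cutoff m x = 0"
  by (auto simp: cutoff_def)

lemma truncate_cutoff_dist: "norm (cutoff m x *\<^sub>R truncate m z - z) \<le> norm z"
proof -
  define c where "c = cutoff m x * (real (Suc m) / max (real (Suc m)) (norm z))"
  have "real (Suc m) / max (real (Suc m)) (norm z) \<le> 1" by (simp add: divide_le_eq_1 max_def)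
  moreover have "0 \<le> real (Suc m) / max (real (Suc m)) (norm z)" by (simp add: max_def)
  ultimately have c: "0 \<le> c" "c \<le> 1"
    unfolding c_def by (simp_all only: mult_nonneg_nonneg mult_le_one cutoff_bounds)
  have "cutoff m x *\<^sub>R truncate m z - z = (c - 1) *\<^sub>R z"
    by (simp add: truncate_def c_def scaleR_diff_left)
  then have "norm (cutoff m x *\<^sub>R truncate m z - z) = (1 - c) * norm z" using c by simp
  also have "\<dots> \<le> 1 * norm z" using c by (intro mult_right_mono) auto
  finally show ?thesis by simp
qed

text \<open>The function is made bounded with bounded support first. It is then approximated by
  continuous functions that converge almost everywhere; since nothing bounds these, the same
  truncation and cutoff is applied to them, which supplies the majorant for dominated
  convergence.\<close>

lemma continuous_dense:
  fixes f :: "'a::euclidean_space \<Rightarrow> complex"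
  assumes f: "sq_int f" and \<delta>: "0 < \<delta>"
  obtains h R where "continuous_on UNIV h" "\<And>x. R < norm x \<Longrightarrow> h x = 0"
    "(\<integral>\<^sup>+x. ennreal ((norm (h x - f x))\<^sup>2) \<partial>lborel) < ennreal \<delta>"
proof -
  have [measurable]: "f \<in> borel_measurable borel" using f by (simp add: sq_int_def)
  have [measurable]: "truncate m \<in> borel_measurable borel" for m
    by (intro borel_measurable_continuous_onI continuous_truncate)
  have [measurable]: "(cutoff m :: 'a \<Rightarrow> real) \<in> borel_measurable borel" for m
    by (intro borel_measurable_continuous_onI continuous_cutoff)
  define F where "F m x = cutoff m x *\<^sub>R truncate m (f x)" for m x
  have [measurable]: "F m \<in> borel_measurable borel" for m unfolding F_def by measurable
  have "(\<lambda>m. \<integral>\<^sup>+x. ennreal ((norm (F m x - f x))\<^sup>2) \<partial>lborel) \<longlonglongrightarrow> (\<integral>\<^sup>+x. ennreal 0 \<partial>(lborel :: 'a measure))"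
  proof (rule nn_integral_dominated_convergence[where w = "\<lambda>x. ennreal ((norm (f x))\<^sup>2)"])
    show "AE x in lborel. ennreal ((norm (F j x - f x))\<^sup>2) \<le> ennreal ((norm (f x))\<^sup>2)" for j
      unfolding F_def by (intro AE_I2 ennreal_leI power_mono truncate_cutoff_dist) simp
    show "(\<integral>\<^sup>+x. ennreal ((norm (f x))\<^sup>2) \<partial>lborel) < \<infinity>" using f by (simp add: sq_int_def)
    show "AE x in lborel. (\<lambda>m. ennreal ((norm (F m x - f x))\<^sup>2)) \<longlonglongrightarrow> ennreal 0"
    proof (rule AE_I2)
      fix x
      obtain n where n: "max (norm x) (norm (f x)) \<le> real n" using real_arch_simple by blast
      have "ennreal ((norm (F m x - f x))\<^sup>2) = ennreal 0" if "n \<le> m" for m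
      proof -
        have "real n \<le> real m" using that by simp
        then have "norm x \<le> real m" "norm (f x) \<le> real (Suc m)" using n by auto
        then show ?thesis using cutoff_eq_1[of x m] by (simp add: F_def truncate_def max_absorb1)
      qed
      then show "(\<lambda>m. ennreal ((norm (F m x - f x))\<^sup>2)) \<longlonglongrightarrow> ennreal 0"
        by (intro tendsto_eventually eventually_sequentiallyI[of n])
    qed
  qed measurable
  then have "(\<lambda>m. \<integral>\<^sup>+x. ennreal ((norm (F m x - f x))\<^sup>2) \<partial>lborel) \<longlonglongrightarrow> 0" by simp
  from order_tendstoD(2)[OF this, of "ennreal (\<delta> / 4)"] \<delta>
  obtain m where m: "(\<integral>\<^sup>+x. ennreal ((norm (F m x - f x))\<^sup>2) \<partial>lborel) < ennreal (\<delta> / 4)"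
    by (auto simp: eventually_sequentially)
  \<comment> \<open>This form of measurability means precisely that \<open>f\<close> is a limit of
    continuous functions off a negligible set.\<close>
  have "f measurable_on UNIV"
    by (rule lebesgue_measurable_imp_measurable_on) (auto intro: measurable_completion)
  then obtain N g where N: "negligible N" and g: "\<And>n. continuous_on UNIV (g n)"
    "\<And>x. x \<notin> N \<Longrightarrow> (\<lambda>n. g n x) \<longlonglongrightarrow> f x"
    unfolding measurable_on_def by auto
  define H where "H n x = cutoff m x *\<^sub>R truncate m (g n x)" for n x
  have contH: "continuous_on UNIV (H n)" for n
    unfolding H_def
    by (intro continuous_intros continuous_cutoff continuous_on_compose2[OF continuous_truncate g(1)]) auto
  then have [measurable]: "H n \<in> borel_measurable borel" for n by (intro borel_measurable_continuous_onI)
  let ?K = "cball (0::'a) (real m + 1)"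
  have "(\<lambda>n. \<integral>\<^sup>+x. ennreal ((norm (H n x - F m x))\<^sup>2) \<partial>lebesgue) \<longlonglongrightarrow> (\<integral>\<^sup>+x. ennreal 0 \<partial>(lebesgue :: 'a measure))"
  proof (rule nn_integral_dominated_convergence[where w = "\<lambda>x. ennreal ((2 * real (Suc m))\<^sup>2) * indicator ?K x"])
    show "(\<lambda>x. ennreal ((norm (H n x - F m x))\<^sup>2)) \<in> borel_measurable lebesgue" for n
      by (rule measurable_completion) measurable
    show "AE x in lebesgue. ennreal ((norm (H n x - F m x))\<^sup>2) \<le> ennreal ((2 * real (Suc m))\<^sup>2) * indicator ?K x" for n
    proof (rule AE_I2)
      fix x
      have "norm (H n x - F m x) \<le> 2 * real (Suc m) * indicator ?K x"
      proof (cases "real m + 1 < norm x")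
        case True
        then show ?thesis by (simp add: H_def F_def cutoff_eq_0)
      next
        case False
        have "norm (cutoff m x *\<^sub>R w) \<le> norm w" for w :: complex
          using cutoff_bounds[of m x] by (simp add: mult_left_le_one_le)
        then have "norm (H n x) \<le> real (Suc m)" "norm (F m x) \<le> real (Suc m)"
          unfolding H_def F_def using norm_truncate order_trans by blast+
        then have "norm (H n x - F m x) \<le> 2 * real (Suc m)" using norm_triangle_ineq4[of "H n x" "F m x"] by simp
        then show ?thesis using False by (simp add: indicator_def)
      qed
      then have "(norm (H n x - F m x))\<^sup>2 \<le> (2 * real (Suc m) * indicator ?K x)\<^sup>2" by (intro power_mono) auto
      then have "ennreal ((norm (H n x - F m x))\<^sup>2) \<le> ennreal ((2 * real (Suc m) * indicator ?K x)\<^sup>2)" by (rule ennreal_leI)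
      also have "\<dots> = ennreal ((2 * real (Suc m))\<^sup>2) * indicator ?K x" by (simp add: indicator_def)
      finally show "ennreal ((norm (H n x - F m x))\<^sup>2) \<le> ennreal ((2 * real (Suc m))\<^sup>2) * indicator ?K x" .
    qed
    show "(\<integral>\<^sup>+x. ennreal ((2 * real (Suc m))\<^sup>2) * indicator ?K x \<partial>lebesgue) < \<infinity>"
      using emeasure_lborel_cball_finite[of "0::'a" "real m + 1"]
      by (simp add: nn_integral_completion nn_integral_cmult_indicator ennreal_mult_less_top)
    have "AE x in lebesgue. x \<notin> N" using N by (intro AE_not_in) (simp add: negligible_iff_null_sets)
    then show "AE x in lebesgue. (\<lambda>n. ennreal ((norm (H n x - F m x))\<^sup>2)) \<longlonglongrightarrow> ennreal 0"
    proof eventually_elim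
      case (elim x)
      have "(\<lambda>n. H n x) \<longlonglongrightarrow> F m x"
        unfolding H_def F_def
        by (intro tendsto_intros continuous_on_tendsto_compose[OF continuous_truncate[of UNIV] g(2)[OF elim]]) auto
      then have "(\<lambda>n. (norm (H n x - F m x))\<^sup>2) \<longlonglongrightarrow> (norm (F m x - F m x))\<^sup>2"
        by (intro tendsto_intros)
      then show ?case by (intro tendsto_ennrealI) simp
    qed
    show "(\<lambda>x. ennreal ((2 * real (Suc m))\<^sup>2) * indicator ?K x) \<in> borel_measurable lebesgue"
      by (intro measurable_completion borel_measurable_times_ennreal borel_measurable_indicator) simp_all
  qed simp
  then have "(\<lambda>n. \<integral>\<^sup>+x. ennreal ((norm (H n x - F m x))\<^sup>2) \<partial>lborel) \<longlonglongrightarrow> 0" by (simp add: nn_integral_completion)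
  from order_tendstoD(2)[OF this, of "ennreal (\<delta> / 4)"] \<delta>
  obtain n where n: "(\<integral>\<^sup>+x. ennreal ((norm (H n x - F m x))\<^sup>2) \<partial>lborel) < ennreal (\<delta> / 4)"
    by (auto simp: eventually_sequentially)
  show ?thesis
  proof (rule that[of "H n" "real m + 1"])
    show "continuous_on UNIV (H n)" by fact
    show "H n x = 0" if "real m + 1 < norm x" for x using that by (simp add: H_def cutoff_eq_0)
    have "(\<integral>\<^sup>+x. ennreal ((norm (H n x - f x))\<^sup>2) \<partial>lborel)
        = (\<integral>\<^sup>+x. ennreal ((norm ((H n x - F m x) + (F m x - f x)))\<^sup>2) \<partial>lborel)" by simp
    also have "\<dots> \<le> 2 * (\<integral>\<^sup>+x. ennreal ((norm (H n x - F m x))\<^sup>2) \<partial>lborel) + 2 * (\<integral>\<^sup>+x. ennreal ((norm (F m x - f x))\<^sup>2) \<partial>lborel)"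
      by (rule nn_integral_sq_add_le) auto
    also have "\<dots> < 2 * ennreal (\<delta> / 4) + 2 * ennreal (\<delta> / 4)"
      using m n by (intro add_strict_mono ennreal_mult_strict_left_mono) auto
    also have "\<dots> = ennreal \<delta>"
      using \<delta> by (simp add: ennreal_double ennreal_plus[symmetric] del: ennreal_plus)
    finally show "(\<integral>\<^sup>+x. ennreal ((norm (H n x - f x))\<^sup>2) \<partial>lborel) < ennreal \<delta>" .
  qed
qed

text \<open>A three-term estimate around a continuous \<open>h\<close> with bounded support. Using
  the inequality for squares of sums twice turns the three errors \<open>\<delta> / 16\<close> into
  \<open>10 * (\<delta> / 16)\<close>.\<close>

lemma conv_mollifier_tendsto:
  fixes f :: "'a::euclidean_space \<Rightarrow> complex"
  assumes f: "sq_int f" and \<delta>: "0 < \<delta>"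
  shows "\<forall>\<^sub>F \<epsilon> in at_right 0. (\<integral>\<^sup>+y. ennreal ((norm (conv (mollifier \<epsilon>) f y - f y))\<^sup>2) \<partial>lborel) < ennreal \<delta>"
proof -
  obtain h R where h: "continuous_on UNIV h" "\<And>x. R < norm x \<Longrightarrow> h x = 0"
    "(\<integral>\<^sup>+x. ennreal ((norm (h x - f x))\<^sup>2) \<partial>lborel) < ennreal (\<delta> / 16)"
    using continuous_dense[OF f, of "\<delta> / 16"] \<delta> by auto
  have [measurable]: "f \<in> borel_measurable borel" using f by (simp add: sq_int_def)
  have [measurable]: "h \<in> borel_measurable borel" using h by (intro borel_measurable_continuous_onI)
  have d: "sq_int (\<lambda>x. h x - f x)" using h(3) by (auto simp: sq_int_def intro: less_trans)
  then have "sq_int (\<lambda>x. (h x - f x) - (0 - f x))"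
    by (rule sq_int_diff) (use f in \<open>simp add: sq_int_def\<close>)
  then have hs: "sq_int h" by simp
  have "\<forall>\<^sub>F \<epsilon> in at_right 0. (\<integral>\<^sup>+y. ennreal ((norm (conv (mollifier \<epsilon>) h y - h y))\<^sup>2) \<partial>lborel) < ennreal (\<delta> / 16)"
    by (rule conv_mollifier_tendsto_continuous[OF h(1,2) sq_int_locint[OF hs]]) (use \<delta> in auto)
  moreover have "\<forall>\<^sub>F \<epsilon> in at_right (0::real). 0 < \<epsilon>" by (rule eventually_at_right_less)
  ultimately show ?thesis
  proof eventually_elim
    case (elim \<epsilon>)
    let ?n = "\<lambda>g. \<integral>\<^sup>+x. ennreal ((norm (g x :: complex))\<^sup>2) \<partial>(lborel :: 'a measure)"
    have [measurable]: "conv (mollifier \<epsilon>) g \<in> borel_measurable borel" if "sq_int g" for g :: "'a \<Rightarrow> complex"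
      by (intro borel_measurable_continuous_onI integrable_conv_mollifier elim sq_int_locint that)
    note [measurable] = this[OF hs] this[OF f] this[OF d]
    have lin: "conv (mollifier \<epsilon>) (\<lambda>x. h x - f x) y = conv (mollifier \<epsilon>) h y - conv (mollifier \<epsilon>) f y" for y
      unfolding conv_def scaleR_diff_right
      by (intro Bochner_Integration.integral_diff integrable_conv_mollifier elim sq_int_locint hs f)
    have 1: "?n (\<lambda>x. conv (mollifier \<epsilon>) f x - conv (mollifier \<epsilon>) h x) < ennreal (\<delta> / 16)"
      using order.strict_trans1[OF nn_integral_conv_sq_le[OF elim(2) d] h(3)]
      by (simp add: lin norm_minus_commute)
    have "?n (\<lambda>x. conv (mollifier \<epsilon>) f x - f x) = ?n (\<lambda>x. (conv (mollifier \<epsilon>) f x - conv (mollifier \<epsilon>) h x) +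
        ((conv (mollifier \<epsilon>) h x - h x) + (h x - f x)))" by simp
    also have "\<dots> \<le> 2 * ?n (\<lambda>x. conv (mollifier \<epsilon>) f x - conv (mollifier \<epsilon>) h x)
        + 2 * ?n (\<lambda>x. (conv (mollifier \<epsilon>) h x - h x) + (h x - f x))"
      by (rule nn_integral_sq_add_le) auto
    also have "\<dots> \<le> 2 * ennreal (\<delta> / 16) + 2 * ?n (\<lambda>x. (conv (mollifier \<epsilon>) h x - h x) + (h x - f x))"
      using 1 by (intro add_right_mono mult_left_mono) auto
    also have "\<dots> \<le> 2 * ennreal (\<delta> / 16) + 2 * (2 * ennreal (\<delta> / 16) + 2 * ennreal (\<delta> / 16))"
    proof (intro add_left_mono mult_left_mono)
      have "?n (\<lambda>x. (conv (mollifier \<epsilon>) h x - h x) + (h x - f x))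
          \<le> 2 * ?n (\<lambda>x. conv (mollifier \<epsilon>) h x - h x) + 2 * ?n (\<lambda>x. h x - f x)"
        by (rule nn_integral_sq_add_le) auto
      also have "\<dots> \<le> 2 * ennreal (\<delta> / 16) + 2 * ennreal (\<delta> / 16)"
        using elim(1) h(3) by (intro add_mono mult_left_mono) auto
      finally show "?n (\<lambda>x. (conv (mollifier \<epsilon>) h x - h x) + (h x - f x)) \<le> 2 * ennreal (\<delta> / 16) + 2 * ennreal (\<delta> / 16)" .
    qed simp
    also have "2 * ennreal (\<delta> / 16) + 2 * (2 * ennreal (\<delta> / 16) + 2 * ennreal (\<delta> / 16)) = ennreal (10 * (\<delta> / 16))"
      using \<delta> by (simp add: ennreal_double ennreal_plus[symmetric] del: ennreal_plus)
    also have "\<dots> < ennreal \<delta>" using \<delta> by (intro ennreal_lessI) auto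
    finally show ?case .
  qed
qed

section \<open>Approximation in the Sobolev space\<close>

text \<open>A Lebesgue measurable real function agrees with a Borel one almost everywhere; this is
  applied to the real and imaginary parts.\<close>

lemma sq_int_representative:
  assumes "u \<in> L2"
  obtains u0 where "sq_int u0" "AE x in lborel. u x = u0 x"
proof -
  have u: "u \<in> borel_measurable (completion lborel)" "integrable lebesgue (\<lambda>x. (norm (u x))\<^sup>2)"
    using assms by (auto simp: L2_def)
  have "(\<lambda>x. Re (u x)) \<in> borel_measurable (completion lborel)" "(\<lambda>x. Im (u x)) \<in> borel_measurable (completion lborel)"
    using u(1) by measurable
  then obtain a b where ab [measurable]: "a \<in> borel_measurable lborel" "b \<in> borel_measurable lborel"
    and AE: "AE x in lborel. Re (u x) = a x" "AE x in lborel. Im (u x) = b x"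
    using completion_ex_borel_measurable_real[of "\<lambda>x. Re (u x)" lborel]
      completion_ex_borel_measurable_real[of "\<lambda>x. Im (u x)" lborel] by blast
  define u0 where "u0 x = Complex (a x) (b x)" for x
  have eq: "AE x in lborel. u x = u0 x" using AE by eventually_elim (simp add: u0_def complex_eq_iff)
  have "u0 \<in> borel_measurable borel"
    unfolding u0_def Complex_eq using ab by measurable
  moreover have "(\<integral>\<^sup>+x. ennreal ((norm (u0 x))\<^sup>2) \<partial>lborel) < \<infinity>"
  proof -
    have "(\<integral>\<^sup>+x. ennreal ((norm (u0 x))\<^sup>2) \<partial>lborel) = (\<integral>\<^sup>+x. ennreal ((norm (u x))\<^sup>2) \<partial>lebesgue)"
      unfolding nn_integral_completion
      by (rule nn_integral_cong_AE) (use eq in eventually_elim, simp)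
    also have "\<dots> < \<infinity>" using u(2) by (simp add: integrable_iff_bounded)
    finally show ?thesis .
  qed
  ultimately show ?thesis using eq by (intro that[of u0]) (auto simp: sq_int_def)
qed

lemma integral_lebesgue_representative:
  fixes k :: "'a::euclidean_space \<Rightarrow> real" and u u0 :: "'a \<Rightarrow> complex"
  assumes "continuous_on UNIV k" "sq_int u0" "AE x in lborel. u x = u0 x" "u \<in> L2"
  shows "(LINT x|lebesgue. k x *\<^sub>R u x) = (LINT x|lborel. k x *\<^sub>R u0 x)"
proof -
  have [measurable]: "k \<in> borel_measurable borel" "u0 \<in> borel_measurable borel"
    using assms by (auto simp: sq_int_def intro: borel_measurable_continuous_onI)
  have k': "k \<in> borel_measurable lebesgue" "u0 \<in> borel_measurable lebesgue"
    by (auto intro: measurable_completion)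
  have u: "u \<in> borel_measurable lebesgue" using assms by (simp add: L2_def)
  have "AE x in lebesgue. u x = u0 x" using assms(3) by (rule AE_completion)
  then have "(LINT x|lebesgue. k x *\<^sub>R u x) = (LINT x|lebesgue. k x *\<^sub>R u0 x)"
    using k' u by (intro integral_cong_AE borel_measurable_scaleR) (auto elim: eventually_mono)
  also have "\<dots> = (LINT x|lborel. k x *\<^sub>R u0 x)"
    by (rule integral_completion) simp
  finally show ?thesis .
qed

text \<open>The derivative falls on the kernel, and the translated kernel is a test function. The
  sign from the reflection \<open>x \<mapsto> y - x\<close> cancels the sign in the definition of
  the weak derivative.\<close>

lemma has_derivative_conv_mollifier:
  fixes u :: "'a::euclidean_space \<Rightarrow> complex"
  assumes \<epsilon>: "0 < \<epsilon>"
    and u: "u \<in> L2" "sq_int u0" "AE x in lborel. u x = u0 x"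
    and g: "\<And>b. b \<in> Basis \<Longrightarrow> has_weak_derivative u b (g b)" "\<And>b. b \<in> Basis \<Longrightarrow> g b \<in> L2"
      "\<And>b. b \<in> Basis \<Longrightarrow> sq_int (w b)" "\<And>b. b \<in> Basis \<Longrightarrow> AE x in lborel. g b x = w b x"
  shows "(conv (mollifier \<epsilon>) u0 has_derivative (\<lambda>h. \<Sum>b\<in>Basis. (h \<bullet> b) *\<^sub>R conv (mollifier \<epsilon>) (w b) y)) (at y)"
proof -
  let ?k = "mollifier \<epsilon> :: 'a \<Rightarrow> real"
  obtain k' where k': "\<And>x. (?k has_derivative k' x) (at x)" "\<And>v. (\<lambda>x. k' x v) \<in> smooth_algebra"
    using smooth_algebra_derivative[OF mollifier_smooth[of \<epsilon>]] by blast
  have cont': "continuous_on UNIV (\<lambda>x. k' x b)" for b using smooth_algebra_continuous[OF k'(2)] .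
  have supp: "?k z = 0" if "\<epsilon> < norm z" for z by (rule mollifier_eq_0[OF \<epsilon> less_imp_le[OF that]])
  have supp': "k' z b = 0" if "\<epsilon> < norm z" for z b
  proof -
    have op: "open {z::'a. \<epsilon> < norm z}" by (intro open_Collect_less continuous_intros)
    have "((\<lambda>_. 0) has_derivative (\<lambda>_. 0)) (at z)" by simp
    then have "(?k has_derivative (\<lambda>_. 0)) (at z)"
      by (rule has_derivative_transform_within_open[OF _ op]) (use that supp in auto)
    then show ?thesis using has_derivative_unique[OF k'(1)] by metis
  qed
  have "\<exists>M. \<forall>z. \<bar>k' z b\<bar> \<le> M" for b
  proof -
    have "bounded ((\<lambda>z. k' z b) ` cball 0 \<epsilon>)"
      by (intro compact_imp_bounded compact_continuous_image continuous_on_subset[OF cont']) auto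
    then obtain M where M: "\<forall>z\<in>cball 0 \<epsilon>. \<bar>k' z b\<bar> \<le> M" by (auto simp: bounded_iff)
    have "\<bar>k' z b\<bar> \<le> max 0 M" for z
      using bspec[OF M, of z] supp'[of z b] by (cases "norm z \<le> \<epsilon>") auto
    then show ?thesis by blast
  qed
  then obtain M where M: "\<And>b z. \<bar>k' z b\<bar> \<le> M b" by metis
  obtain M0 where M0: "0 \<le> M0" "\<And>z::'a. \<bar>?k z\<bar> \<le> M0" using mollifier_abs_bounded[OF \<epsilon>] by metis
  define L where "L = M0 + (\<Sum>b\<in>Basis. \<bar>M b\<bar>)"
  have L: "\<bar>k' z b\<bar> \<le> L" if "b \<in> Basis" for z b
  proof -
    have "\<bar>M b\<bar> \<le> (\<Sum>b\<in>Basis. \<bar>M b\<bar>)" using that by (intro member_le_sum) auto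
    then show ?thesis using M[of z b] M0(1) by (simp add: L_def)
  qed
  have L0: "0 \<le> L" "\<bar>?k z\<bar> \<le> L" for z
    using M0 sum_nonneg[of Basis "\<lambda>b. \<bar>M b\<bar>"] by (auto simp: L_def intro: order_trans add_increasing2)
  have "(conv ?k u0 has_derivative (\<lambda>h. \<Sum>b\<in>Basis. (h \<bullet> b) *\<^sub>R conv (\<lambda>z. k' z b) u0 y)) (at y)"
    by (rule has_derivative_conv[OF sq_int_locint[OF u(2)] k'(1) cont' L supp supp' L0]) (use \<epsilon> in auto)
  moreover have "conv (\<lambda>z. k' z b) u0 y = conv ?k (w b) y" if b: "b \<in> Basis" for b
  proof -
    define \<phi> where "\<phi> x = ?k (y - x)" for x
    have \<phi>: "\<phi> \<in> test_functions"
      unfolding \<phi>_def by (rule translated_mollifier_test_function[OF \<epsilon>])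
    have "(\<phi> has_derivative (\<lambda>h. k' (y - x) (- h))) (at x)" for x
      unfolding \<phi>_def
      by (rule has_derivative_compose[OF _ k'(1)]) (auto intro!: derivative_eq_intros)
    then have "frechet_derivative \<phi> (at x) = (\<lambda>h. k' (y - x) (- h))" for x
      using frechet_derivative_at by metis
    moreover have "k' (y - x) (- b) = - k' (y - x) b" for x
      using linear_neg[OF has_derivative_linear[OF k'(1)]] .
    ultimately have "(LINT x|lebesgue. - k' (y - x) b *\<^sub>R u x) = - (LINT x|lebesgue. \<phi> x *\<^sub>R g b x)"
      using g(1)[OF b] \<phi> unfolding has_weak_derivative_def by fastforce
    then have "(LINT x|lebesgue. k' (y - x) b *\<^sub>R u x) = (LINT x|lebesgue. \<phi> x *\<^sub>R g b x)"
      by simp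
    moreover have "(LINT x|lebesgue. k' (y - x) b *\<^sub>R u x) = (LINT x|lborel. k' (y - x) b *\<^sub>R u0 x)"
      by (rule integral_lebesgue_representative[OF _ u(2,3,1)])
        (auto intro!: continuous_on_compose2[OF cont'] continuous_intros)
    moreover have "(LINT x|lebesgue. \<phi> x *\<^sub>R g b x) = (LINT x|lborel. \<phi> x *\<^sub>R w b x)"
      unfolding \<phi>_def
      by (rule integral_lebesgue_representative[OF smooth_algebra_continuous[OF translated_mollifier_smooth] g(3,4,2)[OF b]])
    ultimately show ?thesis by (simp add: conv_def \<phi>_def)
  qed
  ultimately show ?thesis by simp
qed

text \<open>A single mollification approximates the function and all its weak partial derivatives
  together, since it commutes with differentiation and a common \<epsilon> exists for finitely many
  directions.\<close>

theorem H1_C1_approximation: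
  fixes u :: "'a::euclidean_space \<Rightarrow> complex"
  assumes "u \<in> H1"
  obtains u0 w where "u0 \<in> borel_measurable borel" "AE x in lborel. u x = u0 x"
    "\<And>b. b \<in> Basis \<Longrightarrow> w b \<in> borel_measurable borel"
    "\<And>b. b \<in> Basis \<Longrightarrow> AE x in lborel. weak_derivative u b x = w b x"
    "\<And>\<delta>. 0 < \<delta> \<Longrightarrow> \<exists>v v'. (\<forall>y. (v has_derivative (\<lambda>h. \<Sum>b\<in>Basis. (h \<bullet> b) *\<^sub>R v' b y)) (at y)) \<and>
       (\<forall>b\<in>Basis. continuous_on UNIV (v' b)) \<and>
       (\<integral>\<^sup>+x. ennreal ((norm (v x - u0 x))\<^sup>2) \<partial>lborel) < ennreal \<delta> \<and>
       (\<forall>b\<in>Basis. (\<integral>\<^sup>+x. ennreal ((norm (v' b x - w b x))\<^sup>2) \<partial>lborel) < ennreal \<delta>)"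
proof -
  have uL2: "u \<in> L2" using assms by (simp add: H1_def)
  have weak: "has_weak_derivative u b (weak_derivative u b)" and dL2: "weak_derivative u b \<in> L2" if "b \<in> Basis" for b
    using assms that someI_ex[of "has_weak_derivative u b"] by (auto simp: H1_def weak_derivative_def)
  obtain u0 where u0: "sq_int u0" "AE x in lborel. u x = u0 x" using sq_int_representative[OF uL2] .
  have "\<exists>w. sq_int w \<and> (AE x in lborel. weak_derivative u b x = w x)" if "b \<in> Basis" for b
    using sq_int_representative[OF dL2[OF that]] by blast
  then obtain w where w: "\<And>b. b \<in> Basis \<Longrightarrow> sq_int (w b)"
    "\<And>b. b \<in> Basis \<Longrightarrow> AE x in lborel. weak_derivative u b x = w b x" by metis
  show ?thesis
  proof (rule that[of u0 w])
    fix \<delta> :: real assume \<delta>: "0 < \<delta>"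
    have "\<forall>\<^sub>F \<epsilon> in at_right 0. 0 < \<epsilon> \<and>
      (\<integral>\<^sup>+x. ennreal ((norm (conv (mollifier \<epsilon>) u0 x - u0 x))\<^sup>2) \<partial>lborel) < ennreal \<delta> \<and>
      (\<forall>b\<in>Basis. (\<integral>\<^sup>+x. ennreal ((norm (conv (mollifier \<epsilon>) (w b) x - w b x))\<^sup>2) \<partial>lborel) < ennreal \<delta>)"
      by (intro eventually_conj eventually_ball_finite ballI conv_mollifier_tendsto u0 w \<delta>
          eventually_at_right_less finite_Basis)
    from eventually_happens'[OF _ this] obtain \<epsilon> where \<epsilon>: "0 < \<epsilon>"
      "(\<integral>\<^sup>+x. ennreal ((norm (conv (mollifier \<epsilon>) u0 x - u0 x))\<^sup>2) \<partial>lborel) < ennreal \<delta>"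
      "\<forall>b\<in>Basis. (\<integral>\<^sup>+x. ennreal ((norm (conv (mollifier \<epsilon>) (w b) x - w b x))\<^sup>2) \<partial>lborel) < ennreal \<delta>"
      by auto
    have "(conv (mollifier \<epsilon>) u0 has_derivative (\<lambda>h. \<Sum>b\<in>Basis. (h \<bullet> b) *\<^sub>R conv (mollifier \<epsilon>) (w b) y)) (at y)" for y
      by (rule has_derivative_conv_mollifier[OF \<epsilon>(1) uL2 u0 weak dL2 w])
    moreover have "continuous_on UNIV (conv (mollifier \<epsilon>) (w b))" if "b \<in> Basis" for b
      by (intro integrable_conv_mollifier(2) \<epsilon> sq_int_locint w that)
    ultimately show "\<exists>v v'. (\<forall>y. (v has_derivative (\<lambda>h. \<Sum>b\<in>Basis. (h \<bullet> b) *\<^sub>R v' b y)) (at y)) \<and>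
       (\<forall>b\<in>Basis. continuous_on UNIV (v' b)) \<and>
       (\<integral>\<^sup>+x. ennreal ((norm (v x - u0 x))\<^sup>2) \<partial>lborel) < ennreal \<delta> \<and>
       (\<forall>b\<in>Basis. (\<integral>\<^sup>+x. ennreal ((norm (v' b x - w b x))\<^sup>2) \<partial>lborel) < ennreal \<delta>)"
      using \<epsilon>(2,3) by (intro exI[of _ "conv (mollifier \<epsilon>) u0"] exI[of _ "\<lambda>b. conv (mollifier \<epsilon>) (w b)"]) blast
  qed (use u0 w in \<open>auto simp: sq_int_def\<close>)
qed

section \<open>Reduction to one particle\<close>

text \<open>The gradient in \<open>x $ j\<close> of \<open>\<Sum>k. ln r_jk\<close>. Rotated by a
  right angle and multiplied by \<alpha> it is the magnetic potential.\<close>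

definition repulsion :: "'n::finite \<Rightarrow> (real^2)^'n \<Rightarrow> real^2" where
  "repulsion j x = (\<Sum>k\<in>UNIV - {j}. (1 / (dist (x $ j) (x $ k))\<^sup>2) *\<^sub>R (x $ j - x $ k))"

definition vortex_poly :: "'n::finite \<Rightarrow> ('n \<Rightarrow> real^2) \<Rightarrow> complex poly" where
  "vortex_poly j y = (\<Prod>k\<in>UNIV - {j}. [:- to_complex (y k), 1:])"

definition insert_at :: "'n::finite \<Rightarrow> ('n \<Rightarrow> real^2) \<Rightarrow> real^2 \<Rightarrow> (real^2)^'n" where
  "insert_at j y z = vec_lambda (y(j := z))"

lemma degree_vortex_poly: "degree (vortex_poly j (y :: 'n::finite \<Rightarrow> _)) = CARD('n) - 1"
  unfolding vortex_poly_def by (subst degree_prod_sum_eq) (auto simp: card_Diff_singleton)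

lemma norm_to_complex: "cmod (to_complex x) = norm x"
  by (simp add: to_complex_def cmod_def norm_vec_def L2_set_def sum_2)

lemma cnj_inverse: "cnj (1 / v) = (1 / (cmod v)\<^sup>2) *\<^sub>R v"
proof (cases "v = 0")
  case False
  have "cnj (1 / v) = v / (v * cnj v)" using False by simp
  also have "v * cnj v = of_real ((cmod v)\<^sup>2)" by (rule complex_norm_square[symmetric, folded of_real_power])
  finally show ?thesis by (simp add: scaleR_conv_of_real)
qed simp

text \<open>The logarithmic derivative of the product is the sum of \<open>1 / (w - y_k)\<close>,
  and \<open>cnj (1 / v)\<close> is \<open>v / |v|^2\<close>. So the abstract field and weight
  become those of the particle system.\<close>

lemma cnj_log_derivative_vortex_poly:
  assumes "poly (vortex_poly j y) (to_complex z) \<noteq> 0"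
  shows "cnj (poly (pderiv (vortex_poly j y)) (to_complex z) / poly (vortex_poly j y) (to_complex z))
    = to_complex (repulsion j (insert_at j y z))"
proof -
  let ?w = "to_complex z" and ?A = "UNIV - {j}"
  have ne: "?w - to_complex (y k) \<noteq> 0" if "k \<in> ?A" for k
    using assms that by (auto simp: vortex_poly_def poly_prod)
  have "poly (pderiv (vortex_poly j y)) ?w / poly (vortex_poly j y) ?w
     = (\<Sum>k\<in>?A. (\<Prod>i\<in>?A - {k}. ?w - to_complex (y i)) / (\<Prod>i\<in>?A. ?w - to_complex (y i)))"
    by (simp add: vortex_poly_def pderiv_prod poly_sum poly_prod pderiv_pCons sum_divide_distrib)
  also have "\<dots> = (\<Sum>k\<in>?A. 1 / (?w - to_complex (y k)))"
  proof (rule sum.cong[OF refl])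
    fix k assume k: "k \<in> ?A"
    have "(\<Prod>i\<in>?A. ?w - to_complex (y i)) = (?w - to_complex (y k)) * (\<Prod>i\<in>?A - {k}. ?w - to_complex (y i))"
      using k by (intro prod.remove) auto
    moreover have "(\<Prod>i\<in>?A - {k}. ?w - to_complex (y i)) \<noteq> 0" using ne by auto
    ultimately show "(\<Prod>i\<in>?A - {k}. ?w - to_complex (y i)) / (\<Prod>i\<in>?A. ?w - to_complex (y i)) = 1 / (?w - to_complex (y k))"
      by simp
  qed
  also have "cnj \<dots> = (\<Sum>k\<in>?A. (1 / (dist z (y k))\<^sup>2) *\<^sub>R (?w - to_complex (y k)))"
    unfolding cnj_sum
  proof (rule sum.cong[OF refl])
    fix k
    have d: "(dist z (y k))\<^sup>2 = (cmod (?w - to_complex (y k)))\<^sup>2"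
      using norm_to_complex[of "z - y k"] linear_diff[OF bounded_linear.linear[OF bounded_linear_to_complex]]
      by (metis dist_norm)
    show "cnj (1 / (?w - to_complex (y k))) = (1 / (dist z (y k))\<^sup>2) *\<^sub>R (?w - to_complex (y k))"
      unfolding d by (rule cnj_inverse)
  qed
  also have "\<dots> = to_complex (repulsion j (insert_at j y z))"
    unfolding repulsion_def insert_at_def
    by (simp add: linear_sum[OF bounded_linear.linear[OF bounded_linear_to_complex]]
        linear_scale[OF bounded_linear.linear[OF bounded_linear_to_complex]]
        linear_diff[OF bounded_linear.linear[OF bounded_linear_to_complex]])
  finally show ?thesis .
qed

lemma magnetic_potential_nth:
  "magnetic_potential \<alpha> j x $ 1 = - \<alpha> * repulsion j x $ 2"
  "magnetic_potential \<alpha> j x $ 2 = \<alpha> * repulsion j x $ 1"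
  by (simp_all add: magnetic_potential_def repulsion_def)

section \<open>Slices in the position of one particle\<close>

lemma insert_at_eq: "insert_at j y z = insert_at j y 0 + axis j z"
  by (simp add: insert_at_def vec_eq_iff axis_def)

lemma bounded_linear_axis: "bounded_linear (axis j :: 'a::euclidean_space \<Rightarrow> 'a^'n::finite)"
  by (rule linear_conv_bounded_linear[THEN iffD1]) (simp add: linear_iff axis_def vec_eq_iff)

lemma continuous_on_insert_at: "continuous_on S (insert_at j y)"
proof -
  have "insert_at j y = (\<lambda>z. insert_at j y 0 + axis j z)" using insert_at_eq by blast
  then show ?thesis
    by (rule ssubst) (intro continuous_intros bounded_linear.continuous_on[OF bounded_linear_axis])
qed

lemma has_derivative_insert_at: "(insert_at j y has_derivative axis j) (at z)"
proof -
  have eq: "insert_at j y = (\<lambda>z. insert_at j y 0 + axis j z)" using insert_at_eq by blast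
  have "((\<lambda>z. insert_at j y 0 + axis j z) has_derivative axis j) (at z)"
    using has_derivative_add[OF has_derivative_const bounded_linear_imp_has_derivative[OF bounded_linear_axis]]
    by simp
  then show ?thesis by (subst eq)
qed

lemma has_derivative_slice:
  fixes v :: "(real^2)^'n::finite \<Rightarrow> complex"
  assumes "\<And>x. (v has_derivative (\<lambda>h. \<Sum>b\<in>Basis. (h \<bullet> b) *\<^sub>R v' b x)) (at x)"
  shows "((\<lambda>z. v (insert_at j y z)) has_derivative
    (\<lambda>h. (h $ 1) *\<^sub>R v' (axis j (axis 1 1)) (insert_at j y z) + (h $ 2) *\<^sub>R v' (axis j (axis 2 1)) (insert_at j y z))) (at z)"
proof -
  define x where "x = insert_at j y z"
  define L where "L h = (\<Sum>b\<in>Basis. (h \<bullet> b) *\<^sub>R v' b x)" for h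
  have der: "(v has_derivative L) (at x)" unfolding L_def[abs_def] by (rule assms)
  have lin: "linear L" using der by (rule has_derivative_linear)
  have L_basis: "L b = v' b x" if "b \<in> Basis" for b
  proof -
    have "L b = (\<Sum>b'\<in>Basis. if b' = b then v' b' x else 0)"
      unfolding L_def using that by (intro sum.cong) (auto simp: inner_Basis)
    then show ?thesis using that by simp
  qed
  have "L (axis j h) = (h $ 1) *\<^sub>R v' (axis j (axis 1 1)) x + (h $ 2) *\<^sub>R v' (axis j (axis 2 1)) x" for h
  proof -
    have "axis j h = (h $ 1) *\<^sub>R axis j (axis 1 1) + (h $ 2) *\<^sub>R axis j (axis 2 (1::real))"
      by (simp add: vec_eq_iff axis_def forall_2)
    then have "L (axis j h) = (h $ 1) *\<^sub>R L (axis j (axis 1 1)) + (h $ 2) *\<^sub>R L (axis j (axis 2 1))"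
      by (simp add: linear_add[OF lin] linear_scale[OF lin])
    then show ?thesis by (simp add: L_basis)
  qed
  moreover have "((\<lambda>z. v (insert_at j y z)) has_derivative (\<lambda>h. L (axis j h))) (at z)"
    using has_derivative_compose[OF has_derivative_insert_at der[unfolded x_def]] by simp
  ultimately show ?thesis by (simp add: x_def)
qed

lemma borel_measurable_slice_integral:
  fixes f :: "(real^2)^'n::finite \<Rightarrow> ennreal"
  assumes f: "f \<in> borel_measurable borel"
  shows "(\<lambda>y. \<integral>\<^sup>+z. f (insert_at j y z) \<partial>lborel) \<in> borel_measurable (\<Pi>\<^sub>M i\<in>UNIV - {j}. lborel)"
proof -
  have "(\<lambda>(y, z). y(j := z)) \<in> measurable ((\<Pi>\<^sub>M i\<in>UNIV - {j}. lborel) \<Otimes>\<^sub>M lborel) (\<Pi>\<^sub>M i\<in>insert j (UNIV - {j}). (lborel :: (real^2) measure))"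
    by (rule measurable_add_dim)
  moreover have "insert j (UNIV - {j}) = UNIV" by auto
  ultimately have "(\<lambda>(y, z). y(j := z)) \<in> measurable ((\<Pi>\<^sub>M i\<in>UNIV - {j}. lborel) \<Otimes>\<^sub>M lborel) (\<Pi>\<^sub>M i\<in>UNIV. (lborel :: (real^2) measure))"
    by simp
  from measurable_compose[OF measurable_compose[OF this borel_measurable_vec_lambda] f]
  show ?thesis
    by (intro lborel.borel_measurable_nn_integral) (simp add: insert_at_def split_beta')
qed

text \<open>By Fubini the errors on the slices integrate to the total error, which tends to 0 along
  a sequence of approximants. The index that suits a given slice may depend on the slice.\<close>

lemma AE_slice_C1_approximable:
  fixes u0 w1 w2 :: "(real^2)^'n::finite \<Rightarrow> complex"
  assumes [measurable]: "u0 \<in> borel_measurable borel" "w1 \<in> borel_measurable borel" "w2 \<in> borel_measurable borel"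
    and approx: "\<And>\<delta>. 0 < \<delta> \<Longrightarrow> \<exists>v v'. (\<forall>x. (v has_derivative (\<lambda>h. \<Sum>b\<in>Basis. (h \<bullet> b) *\<^sub>R v' b x)) (at x)) \<and>
       (\<forall>b\<in>Basis. continuous_on UNIV (v' b)) \<and>
       (\<integral>\<^sup>+x. ennreal ((norm (v x - u0 x))\<^sup>2 + (norm (v' (axis j (axis 1 1)) x - w1 x))\<^sup>2
          + (norm (v' (axis j (axis 2 1)) x - w2 x))\<^sup>2) \<partial>lborel) < ennreal \<delta>"
  shows "AE y in (\<Pi>\<^sub>M i\<in>UNIV - {j}. lborel).
    C1_approximable (\<lambda>z. u0 (insert_at j y z)) (\<lambda>z. w1 (insert_at j y z)) (\<lambda>z. w2 (insert_at j y z))"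
proof -
  let ?e = "\<lambda>v v' x. (norm (v x - u0 x))\<^sup>2 + (norm (v' (axis j (axis 1 1)) x - w1 x))\<^sup>2
          + (norm (v' (axis j (axis 2 1)) x - w2 x))\<^sup>2"
  let ?M = "\<Pi>\<^sub>M i\<in>UNIV - {j}. (lborel :: (real^2) measure)"
  define P where "P m v v' \<longleftrightarrow> (\<forall>x. (v has_derivative (\<lambda>h. \<Sum>b\<in>Basis. (h \<bullet> b) *\<^sub>R v' b x)) (at x)) \<and>
       (\<forall>b\<in>Basis. continuous_on UNIV (v' b)) \<and>
       (\<integral>\<^sup>+x. ennreal (?e v v' x) \<partial>lborel) < ennreal (1 / real (Suc m))" for m v v'
  have "\<exists>v v'. P m v v'" for m unfolding P_def by (rule approx) simp
  then obtain v v' where P: "\<And>m. P m (v m) (v' m)" by metis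
  have der: "\<And>m x. (v m has_derivative (\<lambda>h. \<Sum>b\<in>Basis. (h \<bullet> b) *\<^sub>R v' m b x)) (at x)"
    and cont: "\<And>m b. b \<in> Basis \<Longrightarrow> continuous_on UNIV (v' m b)"
    and small: "\<And>m. (\<integral>\<^sup>+x. ennreal (?e (v m) (v' m) x) \<partial>lborel) < ennreal (1 / real (Suc m))"
    using P unfolding P_def by blast+
  have b: "axis j (axis 1 (1::real)) \<in> (Basis :: ((real^2)^'n) set)" "axis j (axis 2 (1::real)) \<in> (Basis :: ((real^2)^'n) set)" by simp_all
  have [measurable]: "v m \<in> borel_measurable borel" for m
    by (intro borel_measurable_continuous_onI continuous_at_imp_continuous_on ballI has_derivative_continuous[OF der])
  have [measurable]: "v' m (axis j (axis 1 1)) \<in> borel_measurable borel" "v' m (axis j (axis 2 1)) \<in> borel_measurable borel" for m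
    by (intro borel_measurable_continuous_onI cont b)+
  define \<phi> where "\<phi> m y = (\<integral>\<^sup>+z. ennreal (?e (v m) (v' m) (insert_at j y z)) \<partial>lborel)" for m y
  have \<phi>[measurable]: "\<phi> m \<in> borel_measurable ?M" for m
    unfolding \<phi>_def by (rule borel_measurable_slice_integral) measurable
  have int: "(\<integral>\<^sup>+y. \<phi> m y \<partial>?M) \<le> ennreal (1 / real (Suc m))" for m
  proof -
    have "(\<integral>\<^sup>+y. \<phi> m y \<partial>?M) = (\<integral>\<^sup>+x. ennreal (?e (v m) (v' m) x) \<partial>lborel)"
      unfolding \<phi>_def insert_at_def by (rule nn_integral_vec_split[symmetric]) measurable
    then show ?thesis using small[of m] by simp
  qed
  have "(\<lambda>m. ennreal (1 / real (Suc m))) \<longlonglongrightarrow> ennreal 0"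
    using LIMSEQ_inverse_real_of_nat by (intro tendsto_ennrealI) (simp add: inverse_eq_divide)
  then have "(\<lambda>m. ennreal (1 / real (Suc m))) \<longlonglongrightarrow> 0" by (simp only: ennreal_0)
  then have "(\<lambda>m. \<integral>\<^sup>+y. \<phi> m y \<partial>?M) \<longlonglongrightarrow> 0"
    by (rule tendsto_sandwich[OF always_eventually[OF allI[OF zero_le]] always_eventually[OF allI[OF int]] tendsto_const])
  \<comment> \<open>Fatou's lemma takes the place of selecting an almost everywhere convergent
    subsequence: a vanishing lower limit already yields one good index for every \<epsilon>.\<close>
  then have "liminf (\<lambda>m. \<integral>\<^sup>+y. \<phi> m y \<partial>?M) = 0"
    by (intro lim_imp_Liminf) auto
  moreover have "(\<integral>\<^sup>+y. liminf (\<lambda>m. \<phi> m y) \<partial>?M) \<le> liminf (\<lambda>m. \<integral>\<^sup>+y. \<phi> m y \<partial>?M)"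
    by (rule nn_integral_liminf) measurable
  ultimately have "(\<integral>\<^sup>+y. liminf (\<lambda>m. \<phi> m y) \<partial>?M) = 0" by simp
  then have "AE y in ?M. liminf (\<lambda>m. \<phi> m y) = 0"
    by (subst (asm) nn_integral_0_iff_AE) auto
  then show ?thesis
  proof eventually_elim
    case (elim y)
    show ?case
      unfolding C1_approximable_def
    proof (intro allI impI)
      fix \<epsilon> :: real assume \<epsilon>: "0 < \<epsilon>"
      have "\<exists>m. \<phi> m y < ennreal \<epsilon>"
      proof (rule ccontr)
        assume "\<not> (\<exists>m. \<phi> m y < ennreal \<epsilon>)"
        then have "ennreal \<epsilon> \<le> liminf (\<lambda>m. \<phi> m y)"
          by (intro Liminf_bounded always_eventually) (auto simp: not_less)
        then show False using elim \<epsilon> by simp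
      qed
      then obtain m where m: "\<phi> m y < ennreal \<epsilon>" ..
      show "\<exists>f f1 f2. (\<forall>x. (f has_derivative (\<lambda>h. (h $ 1) *\<^sub>R f1 x + (h $ 2) *\<^sub>R f2 x)) (at x)) \<and>
          continuous_on UNIV f1 \<and> continuous_on UNIV f2 \<and>
          (\<integral>\<^sup>+x. ennreal ((norm (f x - u0 (insert_at j y x)))\<^sup>2 + (norm (f1 x - w1 (insert_at j y x)))\<^sup>2
            + (norm (f2 x - w2 (insert_at j y x)))\<^sup>2) \<partial>lborel) < ennreal \<epsilon>"
      proof (intro exI conjI allI)
        show "((\<lambda>z. v m (insert_at j y z)) has_derivative
          (\<lambda>h. (h $ 1) *\<^sub>R v' m (axis j (axis 1 1)) (insert_at j y z) + (h $ 2) *\<^sub>R v' m (axis j (axis 2 1)) (insert_at j y z))) (at z)" for z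
          by (rule has_derivative_slice[OF der])
        show "continuous_on UNIV (\<lambda>z. v' m (axis j (axis 1 1)) (insert_at j y z))"
          "continuous_on UNIV (\<lambda>z. v' m (axis j (axis 2 1)) (insert_at j y z))"
          by (auto intro!: continuous_on_compose2[OF cont[OF b(1)]] continuous_on_compose2[OF cont[OF b(2)]] continuous_on_insert_at)
        show "(\<integral>\<^sup>+x. ennreal ((norm (v m (insert_at j y x) - u0 (insert_at j y x)))\<^sup>2
            + (norm (v' m (axis j (axis 1 1)) (insert_at j y x) - w1 (insert_at j y x)))\<^sup>2
            + (norm (v' m (axis j (axis 2 1)) (insert_at j y x) - w2 (insert_at j y x)))\<^sup>2) \<partial>lborel) < ennreal \<epsilon>"
          using m by (simp add: \<phi>_def)
      qed
    qed
  qed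
qed

lemma borel_measurable_repulsion [measurable]:
  "(repulsion j :: (real^2)^'n::finite \<Rightarrow> _) \<in> borel_measurable borel"
proof -
  have [measurable]: "(\<lambda>x :: (real^2)^'n. x $ k) \<in> borel_measurable borel" for k
    by (intro borel_measurable_continuous_onI continuous_intros)
  show ?thesis unfolding repulsion_def by measurable
qed

definition magnetic_energy ::
  "real \<Rightarrow> 'n::finite \<Rightarrow> ((real^2)^'n \<Rightarrow> complex) \<Rightarrow> ((real^2)^'n \<Rightarrow> complex) \<Rightarrow> ((real^2)^'n \<Rightarrow> complex) \<Rightarrow> (real^2)^'n \<Rightarrow> real" where
  "magnetic_energy \<alpha> j v v1 v2 x = (norm (\<i> * v1 x + of_real (- \<alpha> * repulsion j x $ 2) * v x))\<^sup>2
     + (norm (\<i> * v2 x + of_real (\<alpha> * repulsion j x $ 1) * v x))\<^sup>2"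

lemma borel_measurable_magnetic_energy [measurable]:
  fixes v :: "(real^2)^'n::finite \<Rightarrow> complex"
  assumes [measurable]: "v \<in> borel_measurable borel" "v1 \<in> borel_measurable borel" "v2 \<in> borel_measurable borel"
  shows "magnetic_energy \<alpha> j v v1 v2 \<in> borel_measurable borel"
proof -
  have nth [measurable]: "(\<lambda>x :: real^2. x $ c) \<in> borel_measurable borel" for c
    by (intro borel_measurable_continuous_onI continuous_intros)
  have [measurable]: "(\<lambda>x. repulsion j x $ c) \<in> borel_measurable borel" for c
    by (rule measurable_compose[OF borel_measurable_repulsion nth])
  show ?thesis unfolding magnetic_energy_def by measurable
qed

text \<open>With the other positions frozen, the plane inequality applies to the polynomial that has
  them as roots. Its degree \<open>N - 1\<close> matches the range of \<open>l\<close> in the Hardy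
  constant.\<close>

lemma one_particle_inequality:
  fixes u0 w1 w2 :: "(real^2)^'n::finite \<Rightarrow> complex"
  assumes card: "CARD('n) \<ge> 2"
    and meas [measurable]: "u0 \<in> borel_measurable borel" "w1 \<in> borel_measurable borel" "w2 \<in> borel_measurable borel"
    and approx: "AE y in (\<Pi>\<^sub>M i\<in>UNIV - {j}. lborel).
      C1_approximable (\<lambda>z. u0 (insert_at j y z)) (\<lambda>z. w1 (insert_at j y z)) (\<lambda>z. w2 (insert_at j y z))"
  shows "ennreal (hardy_constant CARD('n) \<alpha>) * (\<integral>\<^sup>+x. ennreal ((norm (repulsion j x))\<^sup>2 * (norm (u0 x))\<^sup>2) \<partial>lborel)
    \<le> (\<integral>\<^sup>+x. ennreal (magnetic_energy \<alpha> j u0 w1 w2 x) \<partial>lborel)"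
proof -
  let ?M = "\<Pi>\<^sub>M i\<in>UNIV - {j}. (lborel :: (real^2) measure)"
  define D where "D = hardy_constant CARD('n) \<alpha>"
  have D: "D \<le> (dist_to_int (real l * \<alpha>) / real l)\<^sup>2" if "0 < l" "l \<le> CARD('n) - 1" for l
    unfolding D_def hardy_constant_def using that by (intro Min_le) auto
  \<comment> \<open>The minimum is attained, hence a square; with at least two particles the index
    set is nonempty.\<close>
  have "D \<in> (\<lambda>l. (dist_to_int (real l * \<alpha>) / real l)\<^sup>2) ` {1..CARD('n) - 1}"
    unfolding D_def hardy_constant_def using card by (intro Min_in) auto
  then have D0: "0 \<le> D" by auto
  define W where "W x = ennreal ((norm (repulsion j x))\<^sup>2 * (norm (u0 x))\<^sup>2)" for x
  define E where "E x = ennreal (magnetic_energy \<alpha> j u0 w1 w2 x)" for x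
  have [measurable]: "W \<in> borel_measurable borel" "E \<in> borel_measurable borel"
    unfolding W_def E_def by measurable
  have slice: "ennreal D * (\<integral>\<^sup>+z. W (insert_at j y z) \<partial>lborel) \<le> (\<integral>\<^sup>+z. E (insert_at j y z) \<partial>lborel)"
    if a: "C1_approximable (\<lambda>z. u0 (insert_at j y z)) (\<lambda>z. w1 (insert_at j y z)) (\<lambda>z. w2 (insert_at j y z))" for y
  proof -
    define p where "p = vortex_poly j y"
    have deg: "degree p = CARD('n) - 1" by (simp add: p_def degree_vortex_poly)
    have [measurable]: "insert_at j y \<in> borel_measurable borel"
      by (intro borel_measurable_continuous_onI continuous_on_insert_at)
    have AE: "AE z in lborel. poly p (to_complex z) \<noteq> 0"
      using AE_poly_cmod_neq[of p 0] deg card by simp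
    have "(\<integral>\<^sup>+z. W (insert_at j y z) \<partial>lborel) = (\<integral>\<^sup>+z. ennreal (vortex_weight p (\<lambda>z. u0 (insert_at j y z)) z) \<partial>lborel)"
    proof (rule nn_integral_cong_AE, use AE in eventually_elim)
      case (elim z)
      have "norm (repulsion j (insert_at j y z)) = cmod (poly (pderiv p) (to_complex z) / poly p (to_complex z))"
        using cnj_log_derivative_vortex_poly[of j y z] elim unfolding p_def[symmetric]
        by (metis complex_mod_cnj norm_to_complex)
      then show ?case by (simp add: W_def vortex_weight_def)
    qed
    moreover have "(\<integral>\<^sup>+z. E (insert_at j y z) \<partial>lborel) = (\<integral>\<^sup>+z. ennreal (vortex_energy p \<alpha> (\<lambda>z. u0 (insert_at j y z))
        (\<lambda>z. w1 (insert_at j y z)) (\<lambda>z. w2 (insert_at j y z)) z) \<partial>lborel)"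
    proof (rule nn_integral_cong_AE, use AE in eventually_elim)
      case (elim z)
      have "vortex_field p \<alpha> z = \<alpha> * \<i> * to_complex (repulsion j (insert_at j y z))"
        using cnj_log_derivative_vortex_poly[of j y z] elim unfolding p_def[symmetric] vortex_field_def by simp
      then have "Re (vortex_field p \<alpha> z) = - \<alpha> * repulsion j (insert_at j y z) $ 2"
        "Im (vortex_field p \<alpha> z) = \<alpha> * repulsion j (insert_at j y z) $ 1"
        by (simp_all add: to_complex_def)
      then show ?case by (simp add: E_def magnetic_energy_def vortex_energy_def)
    qed
    moreover have "ennreal D * (\<integral>\<^sup>+z. ennreal (vortex_weight p (\<lambda>z. u0 (insert_at j y z)) z) \<partial>lborel)
      \<le> (\<integral>\<^sup>+z. ennreal (vortex_energy p \<alpha> (\<lambda>z. u0 (insert_at j y z))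
        (\<lambda>z. w1 (insert_at j y z)) (\<lambda>z. w2 (insert_at j y z)) z) \<partial>lborel)"
      using D D0 card by (intro vortex_inequality a) (auto simp: deg)
    ultimately show ?thesis by simp
  qed
  have "ennreal D * (\<integral>\<^sup>+x. W x \<partial>lborel) = (\<integral>\<^sup>+y. ennreal D * (\<integral>\<^sup>+z. W (insert_at j y z) \<partial>lborel) \<partial>?M)"
    by (subst nn_integral_vec_split[of W j])
      (auto simp: insert_at_def[symmetric] intro!: nn_integral_cmult[symmetric] borel_measurable_slice_integral)
  also have "\<dots> \<le> (\<integral>\<^sup>+y. (\<integral>\<^sup>+z. E (insert_at j y z) \<partial>lborel) \<partial>?M)"
    by (rule nn_integral_mono_AE, rule eventually_mono[OF approx], erule slice)
  also have "\<dots> = (\<integral>\<^sup>+x. E x \<partial>lborel)"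
    by (subst nn_integral_vec_split[of E j]) (auto simp: insert_at_def)
  finally show ?thesis by (simp add: W_def E_def D_def)
qed

lemma nn_integral_sum_ennreal:
  assumes "\<And>j x. 0 \<le> f j x" "\<And>j. f j \<in> borel_measurable lborel"
  shows "(\<integral>\<^sup>+x. ennreal (\<Sum>j\<in>A. f j x) \<partial>lborel) = (\<Sum>j\<in>A. \<integral>\<^sup>+x. ennreal (f j x) \<partial>lborel)"
proof -
  have "(\<integral>\<^sup>+x. ennreal (\<Sum>j\<in>A. f j x) \<partial>lborel) = (\<integral>\<^sup>+x. (\<Sum>j\<in>A. ennreal (f j x)) \<partial>lborel)"
    using assms(1) by (intro nn_integral_cong) simp
  also have "\<dots> = (\<Sum>j\<in>A. \<integral>\<^sup>+x. ennreal (f j x) \<partial>lborel)"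
    using assms(2) by (intro nn_integral_sum) simp
  finally show ?thesis .
qed

theorem theorem2p7:
  fixes \<alpha> :: real and u :: "(real^2)^'n::finite \<Rightarrow> complex"
  assumes "CARD('n) \<ge> 2"
    and "u \<in> H1"
  shows "(\<integral>\<^sup>+x. ennreal (\<Sum>j\<in>UNIV. (norm (magnetic_gradient \<alpha> j u x))\<^sup>2) \<partial>lebesgue)
    \<ge> ennreal (hardy_constant CARD('n) \<alpha>) *
      (\<integral>\<^sup>+x. ennreal ((norm (u x))\<^sup>2 *
          (\<Sum>(k, j)\<in>{(k, j). k \<noteq> j}. 1 / (dist (x $ k) (x $ j))\<^sup>2)) \<partial>lebesgue)"
proof -
  define e1 :: "'n \<Rightarrow> (real^2)^'n" where "e1 j = axis j (axis 1 1)" for j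
  define e2 :: "'n \<Rightarrow> (real^2)^'n" where "e2 j = axis j (axis 2 1)" for j
  have basis: "e1 j \<in> Basis" "e2 j \<in> Basis" for j by (simp_all add: e1_def e2_def)
  obtain u0 w where u0 [measurable]: "u0 \<in> borel_measurable borel" and u: "AE x in lborel. u x = u0 x"
    and w: "\<And>b. b \<in> Basis \<Longrightarrow> w b \<in> borel_measurable borel"
    and du: "\<And>b. b \<in> Basis \<Longrightarrow> AE x in lborel. weak_derivative u b x = w b x"
    and approx: "\<And>\<delta>. 0 < \<delta> \<Longrightarrow> \<exists>v v'. (\<forall>y. (v has_derivative (\<lambda>h. \<Sum>b\<in>Basis. (h \<bullet> b) *\<^sub>R v' b y)) (at y)) \<and>
       (\<forall>b\<in>Basis. continuous_on UNIV (v' b)) \<and>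
       (\<integral>\<^sup>+x. ennreal ((norm (v x - u0 x))\<^sup>2) \<partial>lborel) < ennreal \<delta> \<and>
       (\<forall>b\<in>Basis. (\<integral>\<^sup>+x. ennreal ((norm (v' b x - w b x))\<^sup>2) \<partial>lborel) < ennreal \<delta>)"
    using H1_C1_approximation[OF assms(2)] by blast
  have [measurable]: "w (e1 j) \<in> borel_measurable borel" "w (e2 j) \<in> borel_measurable borel" for j
    using w basis by auto
  define E where "E j = magnetic_energy \<alpha> j u0 (w (e1 j)) (w (e2 j))" for j
  have [measurable]: "E j \<in> borel_measurable borel" for j unfolding E_def by measurable
  have E0: "0 \<le> E j x" for j x by (simp add: E_def magnetic_energy_def)
  define D where "D = ennreal (hardy_constant CARD('n) \<alpha>)"
  have one: "D * (\<integral>\<^sup>+x. ennreal ((norm (repulsion j x))\<^sup>2 * (norm (u0 x))\<^sup>2) \<partial>lborel) \<le> (\<integral>\<^sup>+x. ennreal (E j x) \<partial>lborel)" for j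
    unfolding D_def E_def
  proof (rule one_particle_inequality[OF assms(1)])
    show "AE y in (\<Pi>\<^sub>M i\<in>UNIV - {j}. lborel). C1_approximable (\<lambda>z. u0 (insert_at j y z))
        (\<lambda>z. w (e1 j) (insert_at j y z)) (\<lambda>z. w (e2 j) (insert_at j y z))"
    proof (rule AE_slice_C1_approximable)
      fix \<delta> :: real assume "0 < \<delta>"
      then have \<delta>: "0 < \<delta> / 3" by simp
      from approx[OF this] obtain v v' where
        v: "\<And>y. (v has_derivative (\<lambda>h. \<Sum>b\<in>Basis. (h \<bullet> b) *\<^sub>R v' b y)) (at y)"
        and v': "\<And>b. b \<in> Basis \<Longrightarrow> continuous_on UNIV (v' b)"
        and small: "(\<integral>\<^sup>+x. ennreal ((norm (v x - u0 x))\<^sup>2) \<partial>lborel) < ennreal (\<delta> / 3)"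
          "\<And>b. b \<in> Basis \<Longrightarrow> (\<integral>\<^sup>+x. ennreal ((norm (v' b x - w b x))\<^sup>2) \<partial>lborel) < ennreal (\<delta> / 3)"
        by blast
      have [measurable]: "v \<in> borel_measurable borel"
        by (intro borel_measurable_continuous_onI continuous_at_imp_continuous_on ballI has_derivative_continuous[OF v])
      have [measurable]: "v' (e1 j) \<in> borel_measurable borel" "v' (e2 j) \<in> borel_measurable borel"
        by (intro borel_measurable_continuous_onI v' basis)+
      have "(\<integral>\<^sup>+x. ennreal ((norm (v x - u0 x))\<^sup>2 + (norm (v' (e1 j) x - w (e1 j) x))\<^sup>2
          + (norm (v' (e2 j) x - w (e2 j) x))\<^sup>2) \<partial>lborel)
        = (\<integral>\<^sup>+x. ennreal ((norm (v x - u0 x))\<^sup>2) \<partial>lborel) + (\<integral>\<^sup>+x. ennreal ((norm (v' (e1 j) x - w (e1 j) x))\<^sup>2) \<partial>lborel)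
          + (\<integral>\<^sup>+x. ennreal ((norm (v' (e2 j) x - w (e2 j) x))\<^sup>2) \<partial>lborel)"
        by (simp add: nn_integral_add)
      also have "\<dots> < ennreal (\<delta> / 3) + ennreal (\<delta> / 3) + ennreal (\<delta> / 3)"
        by (intro add_strict_mono small basis)
      also have "\<dots> = ennreal \<delta>" using \<delta> by (simp add: ennreal_plus[symmetric] del: ennreal_plus)
      finally show "\<exists>v v'. (\<forall>x. (v has_derivative (\<lambda>h. \<Sum>b\<in>Basis. (h \<bullet> b) *\<^sub>R v' b x)) (at x)) \<and>
         (\<forall>b\<in>Basis. continuous_on UNIV (v' b)) \<and>
         (\<integral>\<^sup>+x. ennreal ((norm (v x - u0 x))\<^sup>2 + (norm (v' (axis j (axis 1 1)) x - w (e1 j) x))\<^sup>2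
          + (norm (v' (axis j (axis 2 1)) x - w (e2 j) x))\<^sup>2) \<partial>lborel) < ennreal \<delta>"
        using v v' unfolding e1_def[symmetric] e2_def[symmetric] by blast
    qed measurable
  qed measurable
  \<comment> \<open>Almost everywhere \<open>u\<close> and its weak derivatives may be replaced by
    the Borel representatives, for all particles simultaneously because there are finitely
    many.\<close>
  have grad: "AE x in lborel. \<forall>j\<in>UNIV. (norm (magnetic_gradient \<alpha> j u x))\<^sup>2 = E j x"
  proof (rule AE_finite_allI)
    fix j :: 'n
    show "AE x in lborel. (norm (magnetic_gradient \<alpha> j u x))\<^sup>2 = E j x"
      using u du[OF basis(1)[of j]] du[OF basis(2)[of j]]
      by eventually_elim
        (simp add: power2_norm_eq_inner inner_vec_def sum_2 magnetic_gradient_def weak_gradient_def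
          magnetic_potential_nth E_def magnetic_energy_def e1_def e2_def)
  qed simp
  \<comment> \<open>The inequality for configurations holds at every \<open>x\<close>, including
    coinciding positions; the passage from \<open>u\<close> to \<open>u0\<close> is what restricts
    this to almost every \<open>x\<close>.\<close>
  have sum: "AE x in lborel. (norm (u x))\<^sup>2 * (\<Sum>(k, j)\<in>{(k, j). k \<noteq> j}. 1 / (dist (x $ k) (x $ j))\<^sup>2)
      \<le> (\<Sum>j\<in>UNIV. (norm (repulsion j x))\<^sup>2 * (norm (u0 x))\<^sup>2)"
    using u
  proof eventually_elim
    case (elim x)
    have "(\<Sum>(k, j)\<in>{(k, j). k \<noteq> j}. 1 / (dist (x $ k) (x $ j))\<^sup>2) \<le> (\<Sum>j\<in>UNIV. (norm (repulsion j x))\<^sup>2)"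
      using sum_norm_sq_ge_inverse_sq[of "($) x"] by (simp add: repulsion_def)
    from mult_left_mono[OF this, of "(norm (u0 x))\<^sup>2"] show ?case
      using elim by (simp add: sum_distrib_left mult.commute)
  qed
  have "D * (\<integral>\<^sup>+x. ennreal ((norm (u x))\<^sup>2 * (\<Sum>(k, j)\<in>{(k, j). k \<noteq> j}. 1 / (dist (x $ k) (x $ j))\<^sup>2)) \<partial>lborel)
    \<le> D * (\<integral>\<^sup>+x. ennreal (\<Sum>j\<in>UNIV. (norm (repulsion j x))\<^sup>2 * (norm (u0 x))\<^sup>2) \<partial>lborel)"
    by (intro mult_left_mono nn_integral_mono_AE) (use sum in \<open>auto elim!: eventually_mono intro: ennreal_leI\<close>)
  also have "\<dots> = (\<Sum>j\<in>UNIV. D * (\<integral>\<^sup>+x. ennreal ((norm (repulsion j x))\<^sup>2 * (norm (u0 x))\<^sup>2) \<partial>lborel))"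
    by (subst nn_integral_sum_ennreal) (auto simp: sum_distrib_left)
  also have "\<dots> \<le> (\<Sum>j\<in>UNIV. \<integral>\<^sup>+x. ennreal (E j x) \<partial>lborel)"
    by (intro sum_mono one)
  also have "\<dots> = (\<integral>\<^sup>+x. ennreal (\<Sum>j\<in>UNIV. E j x) \<partial>lborel)"
    using E0 by (subst nn_integral_sum_ennreal) auto
  also have "\<dots> = (\<integral>\<^sup>+x. ennreal (\<Sum>j\<in>UNIV. (norm (magnetic_gradient \<alpha> j u x))\<^sup>2) \<partial>lborel)"
    by (rule nn_integral_cong_AE) (use grad in \<open>eventually_elim, simp\<close>)
  finally show ?thesis by (simp add: nn_integral_completion D_def)
qed

end
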